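(* Let $\mathbb{C}$ be an exact category, let $F\colon\mathsf{PreOrd}(\mathbb{C})\to\mathsf{ParOrd}(\mathbb{C})$ be the left adjoint of the inclusion of internal partial orders into internal preorders, and let $(\mathcal{E},\mathcal{M})$ be the associated factorization system in $\mathsf{PreOrd}(\mathbb{C})$. Let $(f,\overline f)\colon(A,\rho)\to(B,\sigma)$ be a morphism in $\mathsf{PreOrd}(\mathbb{C})$. Then: (a) $(f,\overline f)$ is in the class $\mathcal{E}$ if and only if it is fully faithful, i.e. the square with sides $\overline f\colon\rho\to\sigma$, $\rho\to A\times A$, $\sigma\to B\times B$ and $f\times f\colon A\times A\to B\times B$ is a pullback, and, moreover, the induced arrow $\frac{A}{\sim_\rho}\to\frac{B}{\sim_\sigma}$ is a regular epimorphism. (b) $(f,\overline f)$ is in the class $\mathcal{M}$ if and only if both commutative squares relating $\hat f\colon\,\sim_\rho\,\to\,\sim_\sigma$ and $f\colon A\to B$ (one for the first projections $\sim_\rho\,\to A$, $\sim_\sigma\,\to B$ and one for the second projections) are pullbacks; that is, the internal functor $(f,\hat f)\colon(A,\sim_\rho)\to(B,\sim_\sigma)$ is a discrete fibration. Here $\hat f$ is the morphism induced by $(f,\overline f)$.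
   Context: Exact means Barr-exact: finitely complete, every morphism factors as a regular epimorphism followed by a monomorphism, regular epimorphisms are pullback-stable, and every internal equivalence relation is a kernel pair. An object $(A,\rho)$ of $\mathsf{PreOrd}(\mathbb{C})$ is an object $A$ with a relation (subobject) $\langle r_1,r_2\rangle\colon \rho\to A\times A$ that is reflexive and transitive. A morphism $(A,\rho)\to(B,\sigma)$ is a pair $(f\colon A\to B,\ \overline f\colon\rho\to\sigma)$ with $fr_1=s_1\overline f$ and $fr_2=s_2\overline f$, where $\langle s_1,s_2\rangle\colon\sigma\to B\times B$. With $\rho^o=\langle r_2,r_1\rangle$, put $\sim_\rho\,=\rho\wedge\rho^o$, an internal equivalence relation on $A$; $(A,\rho)$ is an internal partial order if $\sim_\rho\,=\Delta_A$, and $\mathsf{ParOrd}(\mathbb{C})$ is the full subcategory of these. The reflector $F$ sends $(A,\rho)$ to $\left(\frac{A}{\sim_\rho},\pi_A(\rho)\right)$, where $\pi_A\colon A\to\frac{A}{\sim_\rho}$ is the quotient and $\pi_A(\rho)$ is the regular image of $\rho$ along $\pi_A$. $\mathcal{E}$ is the class of morphisms of $\mathsf{PreOrd}(\mathbb{C})$ inverted by $F$ (sent to isomorphisms), and $\mathcal{M}$ is the closure under pullbacks of the class of morphisms lying in $\mathsf{ParOrd}(\mathbb{C})$; equivalently (since $F$ is semi-left-exact), $\mathcal{M}$ consists of the morphisms whose naturality square for the unit of the adjunction is a pullback. These form a factorization system $(\mathcal{E},\mathcal{M})$. *)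

theory Defs
  imports Main
begin

section \<open>Categories, functors, adjunctions\<close>

record ('o, 'a) cat =
  Ob :: "'o set"
  Ar :: "'a set"
  Dom :: "'a \<Rightarrow> 'o"
  Cod :: "'a \<Rightarrow> 'o"
  Id :: "'o \<Rightarrow> 'a"
  Comp :: "'a \<Rightarrow> 'a \<Rightarrow> 'a" (infixl "\<cdot>\<index>" 70)

definition Hom :: "('o, 'a) cat \<Rightarrow> 'o \<Rightarrow> 'o \<Rightarrow> 'a set" where
  "Hom C A B = {f \<in> Ar C. Dom C f = A \<and> Cod C f = B}"

locale category =
  fixes C :: "('o, 'a) cat" (structure)
  assumes Dom_Ob: "f \<in> Ar C \<Longrightarrow> Dom C f \<in> Ob C"
    and Cod_Ob: "f \<in> Ar C \<Longrightarrow> Cod C f \<in> Ob C"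
    and Id_Hom: "A \<in> Ob C \<Longrightarrow> Id C A \<in> Hom C A A"
    and Comp_Hom: "f \<in> Hom C X Y \<Longrightarrow> g \<in> Hom C Y Z \<Longrightarrow> g \<cdot> f \<in> Hom C X Z"
    and Comp_Id: "f \<in> Hom C X Y \<Longrightarrow> f \<cdot> Id C X = f"
    and Id_Comp: "f \<in> Hom C X Y \<Longrightarrow> Id C Y \<cdot> f = f"
    and Comp_assoc: "f \<in> Hom C W X \<Longrightarrow> g \<in> Hom C X Y \<Longrightarrow> h \<in> Hom C Y Z \<Longrightarrow>
      h \<cdot> g \<cdot> f = h \<cdot> (g \<cdot> f)"

definition full_subcategory :: "('o, 'a) cat \<Rightarrow> ('o \<Rightarrow> bool) \<Rightarrow> ('o, 'a) cat" where
  "full_subcategory C P =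
     C\<lparr>Ob := {X \<in> Ob C. P X}, Ar := {f \<in> Ar C. P (Dom C f) \<and> P (Cod C f)}\<rparr>"

definition is_iso :: "('o, 'a) cat \<Rightarrow> 'a \<Rightarrow> bool" where
  "is_iso C f \<longleftrightarrow> f \<in> Ar C \<and>
     (\<exists>g \<in> Hom C (Cod C f) (Dom C f).
        g \<cdot>\<^bsub>C\<^esub> f = Id C (Dom C f) \<and> f \<cdot>\<^bsub>C\<^esub> g = Id C (Cod C f))"

record ('o, 'a, 'p, 'b) fctr =
  on_ob :: "'o \<Rightarrow> 'p"
  on_ar :: "'a \<Rightarrow> 'b"

definition is_functor :: "('o, 'a) cat \<Rightarrow> ('p, 'b) cat \<Rightarrow> ('o, 'a, 'p, 'b) fctr \<Rightarrow> bool" where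
  "is_functor C D F \<longleftrightarrow>
     (\<forall>A \<in> Ob C. on_ob F A \<in> Ob D \<and> on_ar F (Id C A) = Id D (on_ob F A)) \<and>
     (\<forall>f \<in> Ar C. on_ar F f \<in> Hom D (on_ob F (Dom C f)) (on_ob F (Cod C f))) \<and>
     (\<forall>f \<in> Ar C. \<forall>g \<in> Ar C. Cod C f = Dom C g \<longrightarrow>
        on_ar F (g \<cdot>\<^bsub>C\<^esub> f) = on_ar F g \<cdot>\<^bsub>D\<^esub> on_ar F f)"

definition id_functor :: "('o, 'a, 'o, 'a) fctr" where
  "id_functor = \<lparr>on_ob = (\<lambda>A. A), on_ar = (\<lambda>f. f)\<rparr>"

definition comp_functor ::
  "('p, 'b, 'q, 'c) fctr \<Rightarrow> ('o, 'a, 'p, 'b) fctr \<Rightarrow> ('o, 'a, 'q, 'c) fctr" where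
  "comp_functor G F = \<lparr>on_ob = on_ob G \<circ> on_ob F, on_ar = on_ar G \<circ> on_ar F\<rparr>"

definition is_nat_trans :: "('o, 'a) cat \<Rightarrow> ('p, 'b) cat \<Rightarrow>
    ('o, 'a, 'p, 'b) fctr \<Rightarrow> ('o, 'a, 'p, 'b) fctr \<Rightarrow> ('o \<Rightarrow> 'b) \<Rightarrow> bool" where
  "is_nat_trans C D F G \<tau> \<longleftrightarrow>
     (\<forall>A \<in> Ob C. \<tau> A \<in> Hom D (on_ob F A) (on_ob G A)) \<and>
     (\<forall>f \<in> Ar C. on_ar G f \<cdot>\<^bsub>D\<^esub> \<tau> (Dom C f) = \<tau> (Cod C f) \<cdot>\<^bsub>D\<^esub> on_ar F f)"

definition is_left_adjoint :: "('o, 'a) cat \<Rightarrow> ('p, 'b) cat \<Rightarrow>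
    ('o, 'a, 'p, 'b) fctr \<Rightarrow> ('p, 'b, 'o, 'a) fctr \<Rightarrow> bool" where
  "is_left_adjoint C D F G \<longleftrightarrow> is_functor C D F \<and> is_functor D C G \<and>
     (\<exists>\<eta> \<epsilon>. is_nat_trans C C id_functor (comp_functor G F) \<eta> \<and>
            is_nat_trans D D (comp_functor F G) id_functor \<epsilon> \<and>
            (\<forall>A \<in> Ob C. \<epsilon> (on_ob F A) \<cdot>\<^bsub>D\<^esub> on_ar F (\<eta> A) = Id D (on_ob F A)) \<and>
            (\<forall>B \<in> Ob D. on_ar G (\<epsilon> B) \<cdot>\<^bsub>C\<^esub> \<eta> (on_ob G B) = Id C (on_ob G B)))"


section \<open>Limits, colimits, exactness\<close>

text \<open>A finite diagram is a finite directed graph in the category: a list \<open>Os\<close> of objects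
  (the nodes, numbered by position) and a list \<open>Es\<close> of labelled edges \<open>(i, j, f)\<close>
  from node \<open>i\<close> to node \<open>j\<close>.\<close>

definition is_diagram :: "('o, 'a) cat \<Rightarrow> 'o list \<Rightarrow> (nat \<times> nat \<times> 'a) list \<Rightarrow> bool" where
  "is_diagram C Os Es \<longleftrightarrow> set Os \<subseteq> Ob C \<and>
     (\<forall>(i, j, f) \<in> set Es. i < length Os \<and> j < length Os \<and> f \<in> Hom C (Os ! i) (Os ! j))"

definition is_cone :: "('o, 'a) cat \<Rightarrow> 'o list \<Rightarrow> (nat \<times> nat \<times> 'a) list \<Rightarrow>
    'o \<Rightarrow> (nat \<Rightarrow> 'a) \<Rightarrow> bool" where
  "is_cone C Os Es L p \<longleftrightarrow> L \<in> Ob C \<and> (\<forall>i < length Os. p i \<in> Hom C L (Os ! i)) \<and>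
     (\<forall>(i, j, f) \<in> set Es. f \<cdot>\<^bsub>C\<^esub> p i = p j)"

definition is_limit :: "('o, 'a) cat \<Rightarrow> 'o list \<Rightarrow> (nat \<times> nat \<times> 'a) list \<Rightarrow>
    'o \<Rightarrow> (nat \<Rightarrow> 'a) \<Rightarrow> bool" where
  "is_limit C Os Es L p \<longleftrightarrow> is_cone C Os Es L p \<and>
     (\<forall>M q. is_cone C Os Es M q \<longrightarrow>
        (\<exists>!h. h \<in> Hom C M L \<and> (\<forall>i < length Os. p i \<cdot>\<^bsub>C\<^esub> h = q i)))"

definition finitely_complete :: "('o, 'a) cat \<Rightarrow> bool" where
  "finitely_complete C \<longleftrightarrow> (\<forall>Os Es. is_diagram C Os Es \<longrightarrow> (\<exists>L p. is_limit C Os Es L p))"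

text \<open>\<open>is_pullback C f g p q\<close>: the square \<open>f \<cdot> p = g \<cdot> q\<close> is a pullback, so \<open>p\<close> is opposite to \<open>g\<close>
  and \<open>q\<close> is opposite to \<open>f\<close>.\<close>

definition is_pullback :: "('o, 'a) cat \<Rightarrow> 'a \<Rightarrow> 'a \<Rightarrow> 'a \<Rightarrow> 'a \<Rightarrow> bool" where
  "is_pullback C f g p q \<longleftrightarrow>
     f \<in> Ar C \<and> g \<in> Ar C \<and> Cod C f = Cod C g \<and>
     p \<in> Hom C (Dom C p) (Dom C f) \<and> q \<in> Hom C (Dom C p) (Dom C g) \<and>
     f \<cdot>\<^bsub>C\<^esub> p = g \<cdot>\<^bsub>C\<^esub> q \<and>
     (\<forall>M u v. u \<in> Hom C M (Dom C f) \<longrightarrow> v \<in> Hom C M (Dom C g) \<longrightarrow> f \<cdot>\<^bsub>C\<^esub> u = g \<cdot>\<^bsub>C\<^esub> v \<longrightarrow>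
        (\<exists>!h. h \<in> Hom C M (Dom C p) \<and> p \<cdot>\<^bsub>C\<^esub> h = u \<and> q \<cdot>\<^bsub>C\<^esub> h = v))"

definition is_product :: "('o, 'a) cat \<Rightarrow> 'o \<Rightarrow> 'o \<Rightarrow> 'a \<Rightarrow> 'a \<Rightarrow> bool" where
  "is_product C A B p q \<longleftrightarrow> p \<in> Hom C (Dom C p) A \<and> q \<in> Hom C (Dom C p) B \<and>
     (\<forall>M u v. u \<in> Hom C M A \<longrightarrow> v \<in> Hom C M B \<longrightarrow>
        (\<exists>!h. h \<in> Hom C M (Dom C p) \<and> p \<cdot>\<^bsub>C\<^esub> h = u \<and> q \<cdot>\<^bsub>C\<^esub> h = v))"

definition is_coequalizer :: "('o, 'a) cat \<Rightarrow> 'a \<Rightarrow> 'a \<Rightarrow> 'a \<Rightarrow> bool" where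
  "is_coequalizer C u v e \<longleftrightarrow>
     u \<in> Ar C \<and> v \<in> Hom C (Dom C u) (Cod C u) \<and> e \<in> Hom C (Cod C u) (Cod C e) \<and>
     e \<cdot>\<^bsub>C\<^esub> u = e \<cdot>\<^bsub>C\<^esub> v \<and>
     (\<forall>Z g. g \<in> Hom C (Cod C u) Z \<longrightarrow> g \<cdot>\<^bsub>C\<^esub> u = g \<cdot>\<^bsub>C\<^esub> v \<longrightarrow>
        (\<exists>!h. h \<in> Hom C (Cod C e) Z \<and> h \<cdot>\<^bsub>C\<^esub> e = g))"

definition is_mono :: "('o, 'a) cat \<Rightarrow> 'a \<Rightarrow> bool" where
  "is_mono C m \<longleftrightarrow> m \<in> Ar C \<and>
     (\<forall>M. \<forall>u \<in> Hom C M (Dom C m). \<forall>v \<in> Hom C M (Dom C m). m \<cdot>\<^bsub>C\<^esub> u = m \<cdot>\<^bsub>C\<^esub> v \<longrightarrow> u = v)"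

definition regular_epi :: "('o, 'a) cat \<Rightarrow> 'a \<Rightarrow> bool" where
  "regular_epi C e \<longleftrightarrow> (\<exists>u v. is_coequalizer C u v e)"

text \<open>Products and pullbacks are used through an arbitrary but fixed choice of limit cones.\<close>

definition prod_cone :: "('o, 'a) cat \<Rightarrow> 'o \<Rightarrow> 'o \<Rightarrow> 'a \<times> 'a" where
  "prod_cone C A B = (SOME (p, q). is_product C A B p q)"

definition prod1 :: "('o, 'a) cat \<Rightarrow> 'o \<Rightarrow> 'o \<Rightarrow> 'a" where
  "prod1 C A B = fst (prod_cone C A B)"

definition prod2 :: "('o, 'a) cat \<Rightarrow> 'o \<Rightarrow> 'o \<Rightarrow> 'a" where
  "prod2 C A B = snd (prod_cone C A B)"

definition prod_ob :: "('o, 'a) cat \<Rightarrow> 'o \<Rightarrow> 'o \<Rightarrow> 'o" where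
  "prod_ob C A B = Dom C (prod1 C A B)"

definition pairing :: "('o, 'a) cat \<Rightarrow> 'a \<Rightarrow> 'a \<Rightarrow> 'a" where
  "pairing C u v = (THE h. h \<in> Hom C (Dom C u) (prod_ob C (Cod C u) (Cod C v)) \<and>
     prod1 C (Cod C u) (Cod C v) \<cdot>\<^bsub>C\<^esub> h = u \<and> prod2 C (Cod C u) (Cod C v) \<cdot>\<^bsub>C\<^esub> h = v)"

definition prod_map :: "('o, 'a) cat \<Rightarrow> 'a \<Rightarrow> 'a \<Rightarrow> 'a" where
  "prod_map C f g = pairing C (f \<cdot>\<^bsub>C\<^esub> prod1 C (Dom C f) (Dom C g))
                              (g \<cdot>\<^bsub>C\<^esub> prod2 C (Dom C f) (Dom C g))"

definition pb_cone :: "('o, 'a) cat \<Rightarrow> 'a \<Rightarrow> 'a \<Rightarrow> 'a \<times> 'a" where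
  "pb_cone C f g = (SOME (p, q). is_pullback C f g p q)"

definition pb1 :: "('o, 'a) cat \<Rightarrow> 'a \<Rightarrow> 'a \<Rightarrow> 'a" where
  "pb1 C f g = fst (pb_cone C f g)"

definition pb2 :: "('o, 'a) cat \<Rightarrow> 'a \<Rightarrow> 'a \<Rightarrow> 'a" where
  "pb2 C f g = snd (pb_cone C f g)"

text \<open>Internal relations on an object: \<open>Car X\<close> is the underlying object, and the subobject is
  given by a representing monomorphism \<open>\<langle>lft X, rgt X\<rangle> : Rel X \<rightarrow> Car X \<times> Car X\<close>.\<close>

record ('o, 'a) irel =
  Car :: 'o
  Rel :: 'o
  lft :: 'a
  rgt :: 'a

definition rel_arrow :: "('o, 'a) cat \<Rightarrow> ('o, 'a) irel \<Rightarrow> 'a" where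
  "rel_arrow C X = pairing C (lft X) (rgt X)"

definition is_relation :: "('o, 'a) cat \<Rightarrow> ('o, 'a) irel \<Rightarrow> bool" where
  "is_relation C X \<longleftrightarrow> Car X \<in> Ob C \<and> lft X \<in> Hom C (Rel X) (Car X) \<and>
     rgt X \<in> Hom C (Rel X) (Car X) \<and> is_mono C (rel_arrow C X)"

definition rel_le :: "('o, 'a) cat \<Rightarrow> ('o, 'a) irel \<Rightarrow> ('o, 'a) irel \<Rightarrow> bool" where
  "rel_le C X Y \<longleftrightarrow> Car X = Car Y \<and>
     (\<exists>h \<in> Hom C (Rel X) (Rel Y). rel_arrow C Y \<cdot>\<^bsub>C\<^esub> h = rel_arrow C X)"

text \<open>Equality of subobjects, i.e. isomorphism of the representing monomorphisms.\<close>

definition rel_eq :: "('o, 'a) cat \<Rightarrow> ('o, 'a) irel \<Rightarrow> ('o, 'a) irel \<Rightarrow> bool" where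
  "rel_eq C X Y \<longleftrightarrow> rel_le C X Y \<and> rel_le C Y X"

definition diag_rel :: "('o, 'a) cat \<Rightarrow> 'o \<Rightarrow> ('o, 'a) irel" where
  "diag_rel C A = \<lparr>Car = A, Rel = A, lft = Id C A, rgt = Id C A\<rparr>"

definition op_rel :: "('o, 'a) irel \<Rightarrow> ('o, 'a) irel" where
  "op_rel X = \<lparr>Car = Car X, Rel = Rel X, lft = rgt X, rgt = lft X\<rparr>"

definition meet_rel :: "('o, 'a) cat \<Rightarrow> ('o, 'a) irel \<Rightarrow> ('o, 'a) irel \<Rightarrow> ('o, 'a) irel" where
  "meet_rel C X Y = (let p = pb1 C (rel_arrow C X) (rel_arrow C Y) in
     \<lparr>Car = Car X, Rel = Dom C p, lft = lft X \<cdot>\<^bsub>C\<^esub> p, rgt = rgt X \<cdot>\<^bsub>C\<^esub> p\<rparr>)"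

definition reflexive :: "('o, 'a) cat \<Rightarrow> ('o, 'a) irel \<Rightarrow> bool" where
  "reflexive C X \<longleftrightarrow> rel_le C (diag_rel C (Car X)) X"

definition symmetric :: "('o, 'a) cat \<Rightarrow> ('o, 'a) irel \<Rightarrow> bool" where
  "symmetric C X \<longleftrightarrow> rel_le C (op_rel X) X"

text \<open>The object of composable pairs is the pullback of \<open>rgt X\<close> along \<open>lft X\<close>.\<close>

definition transitive :: "('o, 'a) cat \<Rightarrow> ('o, 'a) irel \<Rightarrow> bool" where
  "transitive C X \<longleftrightarrow> (let p = pb1 C (rgt X) (lft X); q = pb2 C (rgt X) (lft X) in
     \<exists>t \<in> Hom C (Dom C p) (Rel X).
       lft X \<cdot>\<^bsub>C\<^esub> t = lft X \<cdot>\<^bsub>C\<^esub> p \<and> rgt X \<cdot>\<^bsub>C\<^esub> t = rgt X \<cdot>\<^bsub>C\<^esub> q)"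

definition is_equivalence_rel :: "('o, 'a) cat \<Rightarrow> ('o, 'a) irel \<Rightarrow> bool" where
  "is_equivalence_rel C X \<longleftrightarrow>
     is_relation C X \<and> reflexive C X \<and> symmetric C X \<and> transitive C X"

definition is_kernel_pair :: "('o, 'a) cat \<Rightarrow> ('o, 'a) irel \<Rightarrow> bool" where
  "is_kernel_pair C X \<longleftrightarrow>
     (\<exists>q \<in> Ar C. Dom C q = Car X \<and> is_pullback C q q (lft X) (rgt X))"

locale exact_category = category +
  assumes complete: "finitely_complete C"
    and factorization: "f \<in> Ar C \<Longrightarrow>
      \<exists>e m. regular_epi C e \<and> is_mono C m \<and> Cod C e = Dom C m \<and> f = m \<cdot> e"
    and regular_epi_stable: "is_pullback C g e p q \<Longrightarrow> regular_epi C e \<Longrightarrow> regular_epi C p"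
    and effective: "is_equivalence_rel C X \<Longrightarrow> is_kernel_pair C X"


section \<open>Internal preorders and partial orders\<close>

definition is_preorder :: "('o, 'a) cat \<Rightarrow> ('o, 'a) irel \<Rightarrow> bool" where
  "is_preorder C X \<longleftrightarrow> is_relation C X \<and> reflexive C X \<and> transitive C X"

text \<open>A morphism of preorders: \<open>base\<close> is the arrow between the underlying objects, \<open>relm\<close> the arrow
  between the objects of relations.\<close>

record ('o, 'a) rel_mor =
  src :: "('o, 'a) irel"
  tgt :: "('o, 'a) irel"
  base :: 'a
  relm :: 'a

definition PreOrd :: "('o, 'a) cat \<Rightarrow> (('o, 'a) irel, ('o, 'a) rel_mor) cat" where
  "PreOrd C = \<lparr>
     Ob = {X. is_preorder C X},
     Ar = {m. is_preorder C (src m) \<and> is_preorder C (tgt m) \<and>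
              base m \<in> Hom C (Car (src m)) (Car (tgt m)) \<and>
              relm m \<in> Hom C (Rel (src m)) (Rel (tgt m)) \<and>
              base m \<cdot>\<^bsub>C\<^esub> lft (src m) = lft (tgt m) \<cdot>\<^bsub>C\<^esub> relm m \<and>
              base m \<cdot>\<^bsub>C\<^esub> rgt (src m) = rgt (tgt m) \<cdot>\<^bsub>C\<^esub> relm m},
     Dom = src,
     Cod = tgt,
     Id = (\<lambda>X. \<lparr>src = X, tgt = X, base = Id C (Car X), relm = Id C (Rel X)\<rparr>),
     Comp = (\<lambda>n m. \<lparr>src = src m, tgt = tgt n,
                     base = base n \<cdot>\<^bsub>C\<^esub> base m, relm = relm n \<cdot>\<^bsub>C\<^esub> relm m\<rparr>)\<rparr>"

definition sim :: "('o, 'a) cat \<Rightarrow> ('o, 'a) irel \<Rightarrow> ('o, 'a) irel" where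
  "sim C X = meet_rel C X (op_rel X)"

definition is_partial_order :: "('o, 'a) cat \<Rightarrow> ('o, 'a) irel \<Rightarrow> bool" where
  "is_partial_order C X \<longleftrightarrow> is_preorder C X \<and> rel_eq C (sim C X) (diag_rel C (Car X))"

definition ParOrd :: "('o, 'a) cat \<Rightarrow> (('o, 'a) irel, ('o, 'a) rel_mor) cat" where
  "ParOrd C = full_subcategory (PreOrd C) (is_partial_order C)"

text \<open>The action on objects and arrows of the inclusion of \<open>ParOrd C\<close> into \<open>PreOrd C\<close> is the
  identity.\<close>

definition incl :: "(('o, 'a) irel, ('o, 'a) rel_mor, ('o, 'a) irel, ('o, 'a) rel_mor) fctr" where
  "incl = \<lparr>on_ob = (\<lambda>X. X), on_ar = (\<lambda>m. m)\<rparr>"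

text \<open>\<open>sim_map C m\<close> is the arrow \<open>Rel (sim C (src m)) \<rightarrow> Rel (sim C (tgt m))\<close> induced by \<open>relm m\<close>
  on the pullbacks defining the two meets.\<close>

definition sim_map :: "('o, 'a) cat \<Rightarrow> ('o, 'a) rel_mor \<Rightarrow> 'a" where
  "sim_map C m = (let X = src m; Y = tgt m in
     THE h. h \<in> Hom C (Rel (sim C X)) (Rel (sim C Y)) \<and>
       pb1 C (rel_arrow C Y) (rel_arrow C (op_rel Y)) \<cdot>\<^bsub>C\<^esub> h
         = relm m \<cdot>\<^bsub>C\<^esub> pb1 C (rel_arrow C X) (rel_arrow C (op_rel X)) \<and>
       pb2 C (rel_arrow C Y) (rel_arrow C (op_rel Y)) \<cdot>\<^bsub>C\<^esub> h
         = relm m \<cdot>\<^bsub>C\<^esub> pb2 C (rel_arrow C X) (rel_arrow C (op_rel X)))"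

text \<open>The quotient of \<open>Car X\<close> by \<open>sim C X\<close>: a chosen coequalizer of the two projections.\<close>

definition quot :: "('o, 'a) cat \<Rightarrow> ('o, 'a) irel \<Rightarrow> 'a" where
  "quot C X = (SOME e. is_coequalizer C (lft (sim C X)) (rgt (sim C X)) e)"

definition quot_map :: "('o, 'a) cat \<Rightarrow> ('o, 'a) rel_mor \<Rightarrow> 'a" where
  "quot_map C m =
     (THE h. h \<in> Hom C (Cod C (quot C (src m))) (Cod C (quot C (tgt m))) \<and>
             h \<cdot>\<^bsub>C\<^esub> quot C (src m) = quot C (tgt m) \<cdot>\<^bsub>C\<^esub> base m)"

definition fully_faithful :: "('o, 'a) cat \<Rightarrow> ('o, 'a) rel_mor \<Rightarrow> bool" where
  "fully_faithful C m \<longleftrightarrow>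
     is_pullback C (prod_map C (base m) (base m)) (rel_arrow C (tgt m)) (rel_arrow C (src m)) (relm m)"


section \<open>The two classes of the factorization system\<close>

definition class_E :: "('o, 'a) cat \<Rightarrow>
    (('o, 'a) irel, ('o, 'a) rel_mor, ('o, 'a) irel, ('o, 'a) rel_mor) fctr \<Rightarrow>
    ('o, 'a) rel_mor set" where
  "class_E C F = {m \<in> Ar (PreOrd C). is_iso (ParOrd C) (on_ar F m)}"

inductive_set pullback_closure :: "('o, 'a) cat \<Rightarrow> 'a set \<Rightarrow> 'a set"
  for D :: "('o, 'a) cat" and S :: "'a set" where
  incl: "m \<in> S \<Longrightarrow> m \<in> pullback_closure D S"
| pullback: "n \<in> pullback_closure D S \<Longrightarrow> is_pullback D g n p q \<Longrightarrow> p \<in> pullback_closure D S"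

definition class_M :: "('o, 'a) cat \<Rightarrow> ('o, 'a) rel_mor set" where
  "class_M C = pullback_closure (PreOrd C) (Ar (ParOrd C))"

end

theory Submission
  imports Defs
begin

text \<open>An internal relation is determined by the pairs of generalized elements it relates, so preorders,
  \<open>\<sim>\<close>, full faithfulness and discrete fibrations all become first-order conditions on generalized
  elements, while arrows into a quotient are handled by lifting along a regular epimorphism, arguing
  upstairs and descending. Exactness makes \<open>\<sim>\<close> the kernel pair of the quotient map \<open>\<pi>\<close>, and the image
  order on the quotient then makes \<open>\<pi>\<close> a fully faithful unit.

  (a) Since the units are fully faithful regular epimorphisms, \<open>F m\<close> reflects the order iff \<open>m\<close> does, and
  full faithfulness makes the induced arrow of quotients monic; a monic regular epimorphism is invertible.

  (b) Unique lifting of \<open>\<sim>\<close> along \<open>m\<close> holds trivially between partial orders, where \<open>\<sim>\<close> is equality, and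
  is stable under pullback. Conversely it makes the naturality square of the unit at \<open>m\<close> a pullback: a
  pair \<open>(y, u)\<close> with \<open>\<pi> y = F m u\<close> lifts locally by choosing a representative of \<open>u\<close> and moving it along
  \<open>\<sim>\<close>, and uniqueness of lifts makes the local solutions descend.\<close>

section \<open>Arrows\<close>

text \<open>\<open>F\<close> is an arbitrary left adjoint and \<open>quot\<close> a chosen
  coequalizer, so nothing relates them by definition. An explicit reflection is therefore built on
  the chosen quotient and compared with the unit of \<open>F\<close> by universality: their
  underlying arrows agree up to an isomorphism of \<open>C\<close>, and both are fully faithful,
  which is all that (a) needs. \<open>class_M\<close> refers to abstract pullbacks in
  \<open>PreOrd C\<close>. What they are in \<open>C\<close> is found by probing them with
  preorders: discrete ones reveal the underlying object, an intersection of inverse images reveals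
  the relation. A generalized element of a quotient has a representative only after restriction
  along a cover. Choosing several representatives means refining covers, so regular epimorphisms
  must compose; this is derived from factorizations and the diagonal fill-in. Order relations
  descend along covers because they are given by monomorphisms. Both squares of (b) express one
  lifting condition, read in the two directions of the symmetric relation
  \<open>\<sim>\<close>.\<close>

context category
begin

lemma Hom_iff: "f \<in> Hom C A B \<longleftrightarrow> f \<in> Ar C \<and> Dom C f = A \<and> Cod C f = B"
  by (auto simp: Hom_def)

lemma comp_arrow [simp]:
  assumes "f \<in> Ar C" "g \<in> Ar C" "Cod C f = Dom C g"
  shows "g \<cdot> f \<in> Ar C" "Dom C (g \<cdot> f) = Dom C f" "Cod C (g \<cdot> f) = Cod C g"
  using Comp_Hom[of f "Dom C f" "Dom C g" g "Cod C g"] assms by (auto simp: Hom_def)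

lemma comp_assoc [simp]:
  assumes "f \<in> Ar C" "g \<in> Ar C" "h \<in> Ar C" "Cod C f = Dom C g" "Cod C g = Dom C h"
  shows "h \<cdot> g \<cdot> f = h \<cdot> (g \<cdot> f)"
  using Comp_assoc[of f "Dom C f" "Dom C g" g "Dom C h" h "Cod C h"] assms by (auto simp: Hom_def)

lemma id_arrow [simp]:
  assumes "A \<in> Ob C"
  shows "Id C A \<in> Ar C" "Dom C (Id C A) = A" "Cod C (Id C A) = A"
  using Id_Hom[OF assms] by (auto simp: Hom_def)

lemma comp_id [simp]: "f \<in> Ar C \<Longrightarrow> Dom C f = A \<Longrightarrow> f \<cdot> Id C A = f"
  using Comp_Id[of f A "Cod C f"] by (auto simp: Hom_def)

lemma id_comp [simp]: "f \<in> Ar C \<Longrightarrow> Cod C f = A \<Longrightarrow> Id C A \<cdot> f = f"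
  using Id_Comp[of f "Dom C f" A] by (auto simp: Hom_def)

declare Dom_Ob [simp] Cod_Ob [simp]

text \<open>With composites bracketed to the right, an equation for \<open>g \<cdot> f\<close>
  cannot be applied inside a longer composite; this gives its form precomposed with
  \<open>x\<close>. \<open>square_extend\<close> does the same for commutative squares.\<close>

lemma comp_eq_extend:
  assumes "g \<cdot> f = k" "x \<in> Ar C" "f \<in> Ar C" "g \<in> Ar C" "Cod C x = Dom C f" "Cod C f = Dom C g"
  shows "g \<cdot> (f \<cdot> x) = k \<cdot> x"
  using assms comp_assoc[of x f g] by simp

lemma square_extend:
  assumes "g \<cdot> f = k \<cdot> l" "x \<in> Ar C" "f \<in> Ar C" "g \<in> Ar C" "k \<in> Ar C" "l \<in> Ar C"
    "Cod C x = Dom C f" "Cod C f = Dom C g" "Dom C l = Dom C f" "Cod C l = Dom C k"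
  shows "g \<cdot> (f \<cdot> x) = k \<cdot> (l \<cdot> x)"
  using assms comp_assoc[of x f g] comp_assoc[of x l k] by simp

lemma monoD:
  assumes "is_mono C m" "m \<cdot> u = m \<cdot> v" "u \<in> Ar C" "v \<in> Ar C" "Dom C u = Dom C v"
    "Cod C u = Dom C m" "Cod C v = Dom C m"
  shows "u = v"
  using assms unfolding is_mono_def Hom_def by blast

section \<open>Isomorphisms\<close>

lemma isoE:
  assumes "is_iso C f"
  obtains g where "f \<in> Ar C" "g \<in> Ar C" "Dom C g = Cod C f" "Cod C g = Dom C f"
    "g \<cdot> f = Id C (Dom C f)" "f \<cdot> g = Id C (Cod C f)"
  using assms unfolding is_iso_def Hom_def by auto

lemma isoI:
  assumes "f \<in> Ar C" "g \<in> Ar C" "Dom C g = Cod C f" "Cod C g = Dom C f"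
    "g \<cdot> f = Id C (Dom C f)" "f \<cdot> g = Id C (Cod C f)"
  shows "is_iso C f"
  using assms unfolding is_iso_def Hom_def by auto

text \<open>If \<open>k\<close> inverts \<open>g \<cdot> f\<close>, then \<open>k \<cdot> g\<close>
  is a left inverse of \<open>f\<close> at once; it is a right inverse because \<open>g\<close> can
  be cancelled on the left.\<close>

lemma iso_cancel_left:
  assumes "is_iso C g" "is_iso C (g \<cdot> f)" "f \<in> Ar C" "Cod C f = Dom C g"
  shows "is_iso C f"
proof -
  obtain g' where g: "g \<in> Ar C" "g' \<in> Ar C" "Dom C g' = Cod C g" "Cod C g' = Dom C g"
    "g' \<cdot> g = Id C (Dom C g)" "g \<cdot> g' = Id C (Cod C g)" using assms(1) by (rule isoE)
  obtain k where k: "g \<cdot> f \<in> Ar C" "k \<in> Ar C" "Dom C k = Cod C (g \<cdot> f)" "Cod C k = Dom C (g \<cdot> f)"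
    "k \<cdot> (g \<cdot> f) = Id C (Dom C (g \<cdot> f))" "g \<cdot> f \<cdot> k = Id C (Cod C (g \<cdot> f))"
    using assms(2) by (rule isoE)
  have 1: "k \<cdot> g \<cdot> f = Id C (Dom C f)" using k g assms by simp
  have "f \<cdot> (k \<cdot> g) = g' \<cdot> g \<cdot> (f \<cdot> (k \<cdot> g))" using k g assms by simp
  also have "\<dots> = g' \<cdot> ((g \<cdot> f \<cdot> k) \<cdot> g)" using k(1-4) g(1-4) assms by simp
  also have "\<dots> = Id C (Cod C f)" using k g assms by simp
  finally show ?thesis using 1 k g assms by (intro isoI[of f "k \<cdot> g"]) auto
qed

lemma iso_comp:
  assumes "is_iso C g" "is_iso C f" "Cod C f = Dom C g"
  shows "is_iso C (g \<cdot> f)"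
proof -
  obtain g' where g: "g \<in> Ar C" "g' \<in> Ar C" "Dom C g' = Cod C g" "Cod C g' = Dom C g"
    "g' \<cdot> g = Id C (Dom C g)" "g \<cdot> g' = Id C (Cod C g)" using assms(1) by (rule isoE)
  obtain f' where f: "f \<in> Ar C" "f' \<in> Ar C" "Dom C f' = Cod C f" "Cod C f' = Dom C f"
    "f' \<cdot> f = Id C (Dom C f)" "f \<cdot> f' = Id C (Cod C f)" using assms(2) by (rule isoE)
  have "g' \<cdot> (g \<cdot> f) = f" "f \<cdot> (f' \<cdot> g') = g'"
    using comp_eq_extend[OF g(5), of f] comp_eq_extend[OF f(6), of g'] f g assms(3) by auto
  then show ?thesis using f g assms(3) by (intro isoI[of _ "f' \<cdot> g'"]) auto
qed

text \<open>\<open>g\<close> is the composite of the isomorphism \<open>g \<cdot> f\<close> with the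
  inverse of \<open>f\<close>.\<close>

lemma iso_cancel_right:
  assumes "is_iso C f" "is_iso C (g \<cdot> f)" "g \<in> Ar C" "Cod C f = Dom C g"
  shows "is_iso C g"
proof -
  obtain f' where f: "f \<in> Ar C" "f' \<in> Ar C" "Dom C f' = Cod C f" "Cod C f' = Dom C f"
    "f' \<cdot> f = Id C (Dom C f)" "f \<cdot> f' = Id C (Cod C f)" using assms(1) by (rule isoE)
  have "is_iso C f'" using f by (intro isoI[of f' f]) auto
  then have "is_iso C (g \<cdot> f \<cdot> f')" by (rule iso_comp[OF assms(2)]) (use f assms in auto)
  moreover have "g \<cdot> f \<cdot> f' = g" using f assms by simp
  ultimately show ?thesis by metis
qed

section \<open>Coequalizers and regular epimorphisms\<close>

lemma coequalizerD:
  assumes "is_coequalizer C u v e"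
  shows "u \<in> Ar C" "v \<in> Ar C" "e \<in> Ar C" "Dom C v = Dom C u" "Cod C v = Cod C u" "Dom C e = Cod C u"
    "e \<cdot> u = e \<cdot> v"
  using assms unfolding is_coequalizer_def Hom_def by auto

lemma coequalizer_ex1:
  "is_coequalizer C u v e \<Longrightarrow> g \<in> Hom C (Cod C u) Z \<Longrightarrow> g \<cdot> u = g \<cdot> v \<Longrightarrow>
    \<exists>!h. h \<in> Hom C (Cod C e) Z \<and> h \<cdot> e = g"
  by (simp add: is_coequalizer_def)

lemma coequalizer_factor:
  assumes "is_coequalizer C u v e" "g \<in> Ar C" "Dom C g = Cod C u" "g \<cdot> u = g \<cdot> v"
  obtains h where "h \<in> Ar C" "Dom C h = Cod C e" "Cod C h = Cod C g" "h \<cdot> e = g"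
proof -
  have "g \<in> Hom C (Cod C u) (Cod C g)" using assms by (simp add: Hom_iff)
  then obtain h where "h \<in> Hom C (Cod C e) (Cod C g)" "h \<cdot> e = g"
    using coequalizer_ex1[OF assms(1) _ assms(4)] by blast
  then show ?thesis using that by (auto simp: Hom_iff)
qed

lemma coequalizer_epi:
  assumes "is_coequalizer C u v e" "g \<in> Ar C" "h \<in> Ar C" "Dom C g = Cod C e" "Dom C h = Cod C e"
    "g \<cdot> e = h \<cdot> e"
  shows "g = h"
proof -
  note e = coequalizerD[OF assms(1)]
  \<comment> \<open>The codomains are those of the two composites, which are equal.\<close>
  have c: "Cod C g = Cod C h"
    using comp_arrow(3)[of e g] comp_arrow(3)[of e h] e assms by simp
  have "g \<cdot> e \<cdot> u = g \<cdot> e \<cdot> v" using e assms(2-5) by simp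
  moreover have "g \<cdot> e \<in> Hom C (Cod C u) (Cod C g)" using e assms(2-5) by (simp add: Hom_iff)
  ultimately have "\<exists>!k. k \<in> Hom C (Cod C e) (Cod C g) \<and> k \<cdot> e = g \<cdot> e"
    using coequalizer_ex1[OF assms(1)] by simp
  then show ?thesis using assms c by (metis Hom_iff)
qed

lemma regular_epi_arrow: "regular_epi C e \<Longrightarrow> e \<in> Ar C"
  unfolding regular_epi_def using coequalizerD by blast

lemma regular_epi_cancel:
  assumes "regular_epi C e" "g \<in> Ar C" "h \<in> Ar C" "Dom C g = Cod C e" "Dom C h = Cod C e"
    "g \<cdot> e = h \<cdot> e"
  shows "g = h"
  using assms coequalizer_epi unfolding regular_epi_def by metis

text \<open>\<open>e\<close> coequalizes some unspecified pair. Asking \<open>g\<close> to respect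
  every pair identified by \<open>e\<close> covers that one, and amounts to constancy of
  \<open>g\<close> on the kernel pair of \<open>e\<close>.\<close>

lemma regular_epi_descend:
  assumes e: "regular_epi C e" and g: "g \<in> Ar C" "Dom C g = Dom C e"
    and eq: "\<And>u v. u \<in> Ar C \<Longrightarrow> v \<in> Ar C \<Longrightarrow> Dom C u = Dom C v \<Longrightarrow> Cod C u = Dom C e \<Longrightarrow>
      Cod C v = Dom C e \<Longrightarrow> e \<cdot> u = e \<cdot> v \<Longrightarrow> g \<cdot> u = g \<cdot> v"
  obtains h where "h \<in> Ar C" "Dom C h = Cod C e" "Cod C h = Cod C g" "h \<cdot> e = g"
proof -
  obtain u v where uv: "is_coequalizer C u v e" using e unfolding regular_epi_def by blast
  note d = coequalizerD[OF uv]
  have "g \<cdot> u = g \<cdot> v" using d by (intro eq) auto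
  then show ?thesis using coequalizer_factor[OF uv] g d that by metis
qed

text \<open>Orthogonality of regular epimorphisms and monomorphisms: whatever \<open>e\<close>
  identifies is identified by \<open>m \<cdot> g\<close>, hence by \<open>g\<close>, so
  \<open>g\<close> descends along \<open>e\<close>.\<close>

lemma regular_epi_mono_fill:
  assumes e: "regular_epi C e" and m: "is_mono C m" and g: "g \<in> Ar C" and h: "h \<in> Ar C"
    and t: "Dom C g = Dom C e" "Cod C g = Dom C m" "Dom C h = Cod C e" "Cod C h = Cod C m"
    and sq: "m \<cdot> g = h \<cdot> e"
  obtains d where "d \<in> Ar C" "Dom C d = Cod C e" "Cod C d = Dom C m" "d \<cdot> e = g" "m \<cdot> d = h"
proof -
  have ar: "e \<in> Ar C" "m \<in> Ar C" using regular_epi_arrow[OF e] m by (auto simp: is_mono_def)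
  have "g \<cdot> u = g \<cdot> v" if "u \<in> Ar C" "v \<in> Ar C" "Dom C u = Dom C v" "Cod C u = Dom C e"
    "Cod C v = Dom C e" "e \<cdot> u = e \<cdot> v" for u v
  proof (rule monoD[OF m])
    have "m \<cdot> (g \<cdot> u) = h \<cdot> (e \<cdot> u)"
      by (rule square_extend[OF sq]) (use that ar g h t in auto)
    moreover have "m \<cdot> (g \<cdot> v) = h \<cdot> (e \<cdot> v)"
      by (rule square_extend[OF sq]) (use that ar g h t in auto)
    ultimately show "m \<cdot> (g \<cdot> u) = m \<cdot> (g \<cdot> v)" using that(6) by metis
  qed (use that ar g h t in auto)
  then obtain d where d: "d \<in> Ar C" "Dom C d = Cod C e" "Cod C d = Cod C g" "d \<cdot> e = g"
    using regular_epi_descend[OF e g t(1)] by metis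
  have "m \<cdot> d = h"
  proof (rule regular_epi_cancel[OF e])
    show "m \<cdot> d \<cdot> e = h \<cdot> e" using d ar t sq by simp
  qed (use d ar h t in auto)
  then show ?thesis using that d t by metis
qed

text \<open>The diagonal of the square \<open>e \<cdot> 1 = 1 \<cdot> e\<close> is a two-sided
  inverse.\<close>

lemma regular_epi_mono_iso:
  assumes e: "regular_epi C e" and m: "is_mono C e"
  shows "is_iso C e"
proof -
  have ar: "e \<in> Ar C" by (rule regular_epi_arrow[OF e])
  obtain d where "d \<in> Ar C" "Dom C d = Cod C e" "Cod C d = Dom C e" "d \<cdot> e = Id C (Dom C e)"
    "e \<cdot> d = Id C (Cod C e)"
    by (rule regular_epi_mono_fill[OF e m, of "Id C (Dom C e)" "Id C (Cod C e)"]) (use ar in auto)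
  then show ?thesis using ar by (intro isoI) auto
qed

text \<open>An isomorphism is a coequalizer of two identities.\<close>

lemma iso_regular_epi:
  assumes "is_iso C f"
  shows "regular_epi C f"
proof -
  obtain g where g: "f \<in> Ar C" "g \<in> Ar C" "Dom C g = Cod C f" "Cod C g = Dom C f"
    "g \<cdot> f = Id C (Dom C f)" "f \<cdot> g = Id C (Cod C f)" using assms by (rule isoE)
  have "\<exists>!h. h \<in> Hom C (Cod C f) Z \<and> h \<cdot> f = k" if "k \<in> Hom C (Dom C f) Z" for k Z
  proof (rule ex1I[of _ "k \<cdot> g"])
    show "k \<cdot> g \<in> Hom C (Cod C f) Z \<and> k \<cdot> g \<cdot> f = k" using that g by (auto simp: Hom_iff)
    fix h assume h: "h \<in> Hom C (Cod C f) Z \<and> h \<cdot> f = k"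
    then have "k \<cdot> g = h \<cdot> f \<cdot> g" by simp
    also have "\<dots> = h" using h g by (auto simp: Hom_iff)
    finally show "h = k \<cdot> g" ..
  qed
  then have "is_coequalizer C (Id C (Dom C f)) (Id C (Dom C f)) f"
    unfolding is_coequalizer_def using g by (auto simp: Hom_iff)
  then show ?thesis unfolding regular_epi_def by blast
qed

text \<open>Coequalizers are defined up to an isomorphism of the codomain, so the pair coequalized
  by \<open>e\<close> also serves \<open>i \<cdot> e\<close>.\<close>

lemma iso_comp_regular_epi:
  assumes "is_iso C i" "regular_epi C e" "Cod C e = Dom C i"
  shows "regular_epi C (i \<cdot> e)"
proof -
  obtain j where j: "i \<in> Ar C" "j \<in> Ar C" "Dom C j = Cod C i" "Cod C j = Dom C i"
    "j \<cdot> i = Id C (Dom C i)" "i \<cdot> j = Id C (Cod C i)" using assms(1) by (rule isoE)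
  obtain u v where uv: "is_coequalizer C u v e" using assms(2) unfolding regular_epi_def by blast
  note d = coequalizerD[OF uv]
  have "\<exists>!h. h \<in> Hom C (Cod C i) Z \<and> h \<cdot> (i \<cdot> e) = g"
    if g: "g \<in> Hom C (Cod C u) Z" "g \<cdot> u = g \<cdot> v" for g Z
  proof -
    obtain h where h: "h \<in> Ar C" "Dom C h = Cod C e" "Cod C h = Cod C g" "h \<cdot> e = g"
      using coequalizer_factor[OF uv] g by (auto simp: Hom_iff)
    show ?thesis
    proof (rule ex1I[of _ "h \<cdot> j"])
      have "j \<cdot> (i \<cdot> e) = e" using comp_eq_extend[OF j(5), of e] j d assms(3) by simp
      then show "h \<cdot> j \<in> Hom C (Cod C i) Z \<and> h \<cdot> j \<cdot> (i \<cdot> e) = g"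
        using h j d g assms(3) by (auto simp: Hom_iff)
      fix k assume k: "k \<in> Hom C (Cod C i) Z \<and> k \<cdot> (i \<cdot> e) = g"
      then have ka: "k \<in> Ar C" "Dom C k = Cod C i" by (auto simp: Hom_iff)
      have "k \<cdot> i = h"
        by (rule coequalizer_epi[OF uv]) (use k h ka j d assms(3) in auto)
      then have "h \<cdot> j = k \<cdot> i \<cdot> j" by simp
      also have "\<dots> = k" using ka j by simp
      finally show "k = h \<cdot> j" ..
    qed
  qed
  then have "is_coequalizer C u v (i \<cdot> e)"
    unfolding is_coequalizer_def using d j assms(3)
    by (auto simp: Hom_iff)
  then show ?thesis unfolding regular_epi_def by blast
qed

section \<open>Pullback squares\<close>

lemma pullbackD:
  assumes "is_pullback C f g p q"
  shows "f \<in> Ar C" "g \<in> Ar C" "p \<in> Ar C" "q \<in> Ar C" "Cod C g = Cod C f" "Cod C p = Dom C f"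
    "Dom C q = Dom C p" "Cod C q = Dom C g" "f \<cdot> p = g \<cdot> q"
  using assms unfolding is_pullback_def Hom_def by auto

lemma pullback_ex1:
  "is_pullback C f g p q \<Longrightarrow> u \<in> Hom C M (Dom C f) \<Longrightarrow> v \<in> Hom C M (Dom C g) \<Longrightarrow>
    f \<cdot> u = g \<cdot> v \<Longrightarrow> \<exists>!h. h \<in> Hom C M (Dom C p) \<and> p \<cdot> h = u \<and> q \<cdot> h = v"
  by (simp add: is_pullback_def)

lemma pullback_lift:
  assumes "is_pullback C f g p q" "u \<in> Ar C" "v \<in> Ar C" "Dom C u = Dom C v" "Cod C u = Dom C f"
    "Cod C v = Dom C g" "f \<cdot> u = g \<cdot> v"
  obtains h where "h \<in> Ar C" "Dom C h = Dom C u" "Cod C h = Dom C p" "p \<cdot> h = u" "q \<cdot> h = v"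
proof -
  have "u \<in> Hom C (Dom C u) (Dom C f)" "v \<in> Hom C (Dom C u) (Dom C g)" using assms by (auto simp: Hom_iff)
  then have "\<exists>!h. h \<in> Hom C (Dom C u) (Dom C p) \<and> p \<cdot> h = u \<and> q \<cdot> h = v"
    using pullback_ex1[OF assms(1)] assms(7) by simp
  then show ?thesis using that by (auto simp: Hom_iff)
qed

lemma pullback_jointly_monic:
  assumes "is_pullback C f g p q" "h \<in> Ar C" "k \<in> Ar C" "Dom C h = Dom C k" "Cod C h = Dom C p"
    "Cod C k = Dom C p" "p \<cdot> h = p \<cdot> k" "q \<cdot> h = q \<cdot> k"
  shows "h = k"
proof -
  note d = pullbackD[OF assms(1)]
  have "p \<cdot> h \<in> Hom C (Dom C h) (Dom C f)" "q \<cdot> h \<in> Hom C (Dom C h) (Dom C g)"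
    "f \<cdot> (p \<cdot> h) = g \<cdot> (q \<cdot> h)"
    using d assms(2-6) square_extend[OF d(9), of h] by (auto simp: Hom_iff)
  then have "\<exists>!l. l \<in> Hom C (Dom C h) (Dom C p) \<and> p \<cdot> l = p \<cdot> h \<and> q \<cdot> l = q \<cdot> h"
    using pullback_ex1[OF assms(1)] by simp
  moreover have "h \<in> Hom C (Dom C h) (Dom C p)" "k \<in> Hom C (Dom C h) (Dom C p)"
    using assms by (auto simp: Hom_iff)
  ultimately show ?thesis using assms(7,8) by metis
qed

text \<open>Unique existence is split into existence of a mediating arrow and joint monicity of the
  legs, which are proved by separate arguments below.\<close>

lemma pullbackI:
  assumes "f \<in> Ar C" "g \<in> Ar C" "p \<in> Ar C" "q \<in> Ar C" "Cod C g = Cod C f" "Cod C p = Dom C f"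
    "Dom C q = Dom C p" "Cod C q = Dom C g" "f \<cdot> p = g \<cdot> q"
    and lift: "\<And>u v. u \<in> Ar C \<Longrightarrow> v \<in> Ar C \<Longrightarrow> Dom C u = Dom C v \<Longrightarrow> Cod C u = Dom C f \<Longrightarrow>
      Cod C v = Dom C g \<Longrightarrow> f \<cdot> u = g \<cdot> v \<Longrightarrow>
      \<exists>h \<in> Hom C (Dom C u) (Dom C p). p \<cdot> h = u \<and> q \<cdot> h = v"
    and uniq: "\<And>h k. h \<in> Ar C \<Longrightarrow> k \<in> Ar C \<Longrightarrow> Dom C h = Dom C k \<Longrightarrow> Cod C h = Dom C p \<Longrightarrow>
      Cod C k = Dom C p \<Longrightarrow> p \<cdot> h = p \<cdot> k \<Longrightarrow> q \<cdot> h = q \<cdot> k \<Longrightarrow> h = k"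
  shows "is_pullback C f g p q"
proof -
  have "\<exists>!h. h \<in> Hom C M (Dom C p) \<and> p \<cdot> h = u \<and> q \<cdot> h = v"
    if uv: "u \<in> Hom C M (Dom C f)" "v \<in> Hom C M (Dom C g)" "f \<cdot> u = g \<cdot> v" for M u v
  proof -
    have "u \<in> Ar C" "v \<in> Ar C" "Dom C u = M" "Dom C v = M" "Cod C u = Dom C f" "Cod C v = Dom C g"
      using that by (auto simp: Hom_iff)
    then obtain h where h: "h \<in> Hom C M (Dom C p)" "p \<cdot> h = u" "q \<cdot> h = v"
      using lift[of u v] uv(3) by auto
    show ?thesis
      by (rule ex1I[of _ h]) (use h in \<open>auto simp: Hom_iff intro!: uniq\<close>)
  qed
  then show ?thesis
    unfolding is_pullback_def using assms by (auto simp: Hom_iff)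
qed

end

text \<open>Passes from unit and counit to the universal property of the unit, the form used for
  (a). The mediating arrow is the counit at \<open>B\<close> after \<open>on_ar F g\<close>: the
  triangle identity at \<open>on_ob G B\<close> shows that it works, the one at
  \<open>on_ob F A\<close> that it is unique.\<close>

lemma adjoint_universal:
  assumes "category C" "category D" "is_left_adjoint C D F G"
  obtains \<eta> where
    "\<And>A. A \<in> Ob C \<Longrightarrow> on_ob F A \<in> Ob D"
    "\<And>A. A \<in> Ob C \<Longrightarrow> \<eta> A \<in> Hom C A (on_ob G (on_ob F A))"
    "\<And>f A B. f \<in> Hom C A B \<Longrightarrow> on_ar F f \<in> Hom D (on_ob F A) (on_ob F B)"
    "\<And>f A B. f \<in> Hom C A B \<Longrightarrow> on_ar G (on_ar F f) \<cdot>\<^bsub>C\<^esub> \<eta> A = \<eta> B \<cdot>\<^bsub>C\<^esub> f"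
    "\<And>A B g. A \<in> Ob C \<Longrightarrow> B \<in> Ob D \<Longrightarrow> g \<in> Hom C A (on_ob G B) \<Longrightarrow>
      \<exists>!h. h \<in> Hom D (on_ob F A) B \<and> on_ar G h \<cdot>\<^bsub>C\<^esub> \<eta> A = g"
proof -
  interpret C: category C by (rule assms(1))
  interpret D: category D by (rule assms(2))
  obtain \<eta> \<epsilon> where F: "is_functor C D F" and G: "is_functor D C G"
    and \<eta>: "is_nat_trans C C id_functor (comp_functor G F) \<eta>"
    and \<epsilon>: "is_nat_trans D D (comp_functor F G) id_functor \<epsilon>"
    and tri: "\<And>A. A \<in> Ob C \<Longrightarrow> \<epsilon> (on_ob F A) \<cdot>\<^bsub>D\<^esub> on_ar F (\<eta> A) = Id D (on_ob F A)"
      "\<And>B. B \<in> Ob D \<Longrightarrow> on_ar G (\<epsilon> B) \<cdot>\<^bsub>C\<^esub> \<eta> (on_ob G B) = Id C (on_ob G B)"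
    using assms(3) unfolding is_left_adjoint_def by blast
  have F_ob: "\<And>A. A \<in> Ob C \<Longrightarrow> on_ob F A \<in> Ob D" and G_ob: "\<And>B. B \<in> Ob D \<Longrightarrow> on_ob G B \<in> Ob C"
    using F G by (auto simp: is_functor_def)
  have F_ar: "\<And>f. f \<in> Ar C \<Longrightarrow> on_ar F f \<in> Ar D \<and> Dom D (on_ar F f) = on_ob F (Dom C f) \<and>
      Cod D (on_ar F f) = on_ob F (Cod C f)"
    and G_ar: "\<And>f. f \<in> Ar D \<Longrightarrow> on_ar G f \<in> Ar C \<and> Dom C (on_ar G f) = on_ob G (Dom D f) \<and>
      Cod C (on_ar G f) = on_ob G (Cod D f)"
    using F G by (auto simp: is_functor_def Hom_def)
  have F_comp: "\<And>f g. f \<in> Ar C \<Longrightarrow> g \<in> Ar C \<Longrightarrow> Cod C f = Dom C g \<Longrightarrow>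
      on_ar F (g \<cdot>\<^bsub>C\<^esub> f) = on_ar F g \<cdot>\<^bsub>D\<^esub> on_ar F f"
    and G_comp: "\<And>f g. f \<in> Ar D \<Longrightarrow> g \<in> Ar D \<Longrightarrow> Cod D f = Dom D g \<Longrightarrow>
      on_ar G (g \<cdot>\<^bsub>D\<^esub> f) = on_ar G g \<cdot>\<^bsub>C\<^esub> on_ar G f"
    using F G by (auto simp: is_functor_def)
  have \<eta>_ar: "\<And>A. A \<in> Ob C \<Longrightarrow> \<eta> A \<in> Ar C \<and> Dom C (\<eta> A) = A \<and> Cod C (\<eta> A) = on_ob G (on_ob F A)"
    and \<eta>_nat: "\<And>f. f \<in> Ar C \<Longrightarrow> on_ar G (on_ar F f) \<cdot>\<^bsub>C\<^esub> \<eta> (Dom C f) = \<eta> (Cod C f) \<cdot>\<^bsub>C\<^esub> f"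
    using \<eta> by (auto simp: is_nat_trans_def id_functor_def comp_functor_def Hom_def)
  have \<epsilon>_ar: "\<And>B. B \<in> Ob D \<Longrightarrow> \<epsilon> B \<in> Ar D \<and> Dom D (\<epsilon> B) = on_ob F (on_ob G B) \<and> Cod D (\<epsilon> B) = B"
    and \<epsilon>_nat: "\<And>f. f \<in> Ar D \<Longrightarrow> f \<cdot>\<^bsub>D\<^esub> \<epsilon> (Dom D f) = \<epsilon> (Cod D f) \<cdot>\<^bsub>D\<^esub> on_ar F (on_ar G f)"
    using \<epsilon> by (auto simp: is_nat_trans_def id_functor_def comp_functor_def Hom_def)
  show thesis
  proof (rule that[of \<eta>])
    show "\<exists>!h. h \<in> Hom D (on_ob F A) B \<and> on_ar G h \<cdot>\<^bsub>C\<^esub> \<eta> A = g"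
      if A: "A \<in> Ob C" and B: "B \<in> Ob D" and g: "g \<in> Hom C A (on_ob G B)" for A B g
    proof (rule ex1I[of _ "\<epsilon> B \<cdot>\<^bsub>D\<^esub> on_ar F g"])
      have g': "g \<in> Ar C" "Dom C g = A" "Cod C g = on_ob G B" using g by (auto simp: Hom_def)
      have "on_ar G (\<epsilon> B \<cdot>\<^bsub>D\<^esub> on_ar F g) \<cdot>\<^bsub>C\<^esub> \<eta> A = on_ar G (\<epsilon> B) \<cdot>\<^bsub>C\<^esub> (\<eta> (on_ob G B) \<cdot>\<^bsub>C\<^esub> g)"
        using \<epsilon>_ar[OF B] F_ar[OF g'(1)] G_ar \<eta>_ar[OF A] \<eta>_nat[OF g'(1)] g' A B
        by (simp add: G_comp)
      also have "\<dots> = g"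
        using C.comp_eq_extend[OF tri(2)[OF B], of g] G_ar[of "\<epsilon> B"] \<epsilon>_ar[OF B]
          \<eta>_ar[OF G_ob[OF B]] g' G_ob[OF B] by simp
      finally show "\<epsilon> B \<cdot>\<^bsub>D\<^esub> on_ar F g \<in> Hom D (on_ob F A) B \<and>
          on_ar G (\<epsilon> B \<cdot>\<^bsub>D\<^esub> on_ar F g) \<cdot>\<^bsub>C\<^esub> \<eta> A = g"
        using \<epsilon>_ar[OF B] F_ar[OF g'(1)] g' by (simp add: D.Hom_iff)
      fix h assume h: "h \<in> Hom D (on_ob F A) B \<and> on_ar G h \<cdot>\<^bsub>C\<^esub> \<eta> A = g"
      then have h': "h \<in> Ar D" "Dom D h = on_ob F A" "Cod D h = B" "on_ar G h \<cdot>\<^bsub>C\<^esub> \<eta> A = g"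
        by (auto simp: Hom_def)
      note G = G_ar[OF h'(1)] and \<eta>A = \<eta>_ar[OF A]
      have "on_ar F g = on_ar F (on_ar G h) \<cdot>\<^bsub>D\<^esub> on_ar F (\<eta> A)"
        using F_comp[of "\<eta> A" "on_ar G h"] G \<eta>A h' by simp
      then have "\<epsilon> B \<cdot>\<^bsub>D\<^esub> on_ar F g = \<epsilon> B \<cdot>\<^bsub>D\<^esub> on_ar F (on_ar G h) \<cdot>\<^bsub>D\<^esub> on_ar F (\<eta> A)"
        using \<epsilon>_ar[OF B] F_ar[of "on_ar G h"] F_ar[of "\<eta> A"] G \<eta>A h' by simp
      also have "\<dots> = h \<cdot>\<^bsub>D\<^esub> (\<epsilon> (on_ob F A) \<cdot>\<^bsub>D\<^esub> on_ar F (\<eta> A))"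
        using \<epsilon>_nat[OF h'(1)] \<epsilon>_ar[OF F_ob[OF A]] F_ar[of "\<eta> A"] \<eta>A h'
        by (metis D.comp_assoc)
      also have "\<dots> = h" using tri(1)[OF A] h' by simp
      finally show "h = \<epsilon> B \<cdot>\<^bsub>D\<^esub> on_ar F g" ..
    qed
  qed (use F_ob F_ar \<eta>_ar \<eta>_nat in \<open>auto simp: Hom_def\<close>)
qed

section \<open>Internal relations through generalized elements\<close>

text \<open>Membership of a pair of generalized elements in the subobject. The stage is not a
  parameter: \<open>x\<close> and \<open>y\<close> share the domain of the witness \<open>h\<close>,
  so quantifying over them quantifies over stages as well.\<close>

definition in_rel :: "('o, 'a) cat \<Rightarrow> ('o, 'a) irel \<Rightarrow> 'a \<Rightarrow> 'a \<Rightarrow> bool" where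
  "in_rel C X x y \<longleftrightarrow> (\<exists>h \<in> Ar C. Cod C h = Rel X \<and> lft X \<cdot>\<^bsub>C\<^esub> h = x \<and> rgt X \<cdot>\<^bsub>C\<^esub> h = y)"

text \<open>The inverse image of \<open>X\<close> along \<open>f\<close>, a pullback of the
  subobject along \<open>f \<times> f\<close>. It serves to build a test preorder on the vertex of a
  pullback in \<open>PreOrd C\<close>.\<close>

definition inv_rel :: "('o, 'a) cat \<Rightarrow> 'a \<Rightarrow> ('o, 'a) irel \<Rightarrow> ('o, 'a) irel" where
  "inv_rel C f X = (let p = pb1 C (prod_map C f f) (rel_arrow C X) in
     \<lparr>Car = Dom C f, Rel = Dom C p,
      lft = prod1 C (Dom C f) (Dom C f) \<cdot>\<^bsub>C\<^esub> p, rgt = prod2 C (Dom C f) (Dom C f) \<cdot>\<^bsub>C\<^esub> p\<rparr>)"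

text \<open>Finite limits carry the translation into generalized elements, the description of
  pullbacks of preorders and one half of (b). Factorizations and effectiveness enter only with
  quotients.\<close>

locale finitely_complete_category = category +
  assumes complete: "finitely_complete C"
begin

section \<open>Chosen products and pullbacks\<close>

lemma product_exists:
  assumes "A \<in> Ob C" "B \<in> Ob C"
  shows "\<exists>p q. is_product C A B p q"
proof -
  have "is_diagram C [A, B] []" using assms by (auto simp: is_diagram_def)
  then obtain L p where L: "is_limit C [A, B] [] L p"
    using complete unfolding finitely_complete_def by blast
  then have p: "p 0 \<in> Hom C L A" "p 1 \<in> Hom C L B"
    by (auto simp: is_limit_def is_cone_def All_less_Suc2)
  have "\<exists>!h. h \<in> Hom C M L \<and> p 0 \<cdot> h = u \<and> p 1 \<cdot> h = v"
    if uv: "u \<in> Hom C M A" "v \<in> Hom C M B" for M u v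
  proof -
    let ?q = "\<lambda>i::nat. if i = 0 then u else v"
    have "M \<in> Ob C" using uv by (auto simp: Hom_iff)
    then have "is_cone C [A, B] [] M ?q" using uv by (auto simp: is_cone_def All_less_Suc2)
    then have "\<exists>!h. h \<in> Hom C M L \<and> (\<forall>i<length [A, B]. p i \<cdot> h = ?q i)"
      using L unfolding is_limit_def by blast
    then show ?thesis by (simp add: All_less_Suc2)
  qed
  moreover have "Dom C (p 0) = L" using p by (auto simp: Hom_iff)
  ultimately have "is_product C A B (p 0) (p 1)"
    using p unfolding is_product_def by auto
  then show ?thesis by blast
qed

lemma pullback_exists:
  assumes "f \<in> Ar C" "g \<in> Ar C" "Cod C f = Cod C g"
  shows "\<exists>p q. is_pullback C f g p q"
proof -
  let ?Os = "[Dom C f, Dom C g, Cod C f]" and ?Es = "[(0, 2, f), (1, 2, g)]"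
  have "is_diagram C ?Os ?Es" using assms by (auto simp: is_diagram_def Hom_iff)
  then obtain L p where L: "is_limit C ?Os ?Es L p"
    using complete unfolding finitely_complete_def by blast
  then have p: "p 0 \<in> Ar C" "Dom C (p 0) = L" "Cod C (p 0) = Dom C f"
    "p 1 \<in> Ar C" "Dom C (p 1) = L" "Cod C (p 1) = Dom C g" "f \<cdot> p 0 = p 2" "g \<cdot> p 1 = p 2"
    by (auto simp: is_limit_def is_cone_def All_less_Suc2 Hom_iff)
  have "\<exists>!h. h \<in> Hom C M L \<and> p 0 \<cdot> h = u \<and> p 1 \<cdot> h = v"
    if uv: "u \<in> Hom C M (Dom C f)" "v \<in> Hom C M (Dom C g)" "f \<cdot> u = g \<cdot> v" for M u v
  proof -
    \<comment> \<open>The corner of the cospan is a third node, whose leg is forced to be the common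
      composite \<open>f \<cdot> u\<close>.\<close>
    let ?q = "\<lambda>i::nat. if i = 0 then u else if i = 1 then v else f \<cdot> u"
    have "is_cone C ?Os ?Es M ?q"
      using uv assms by (auto simp: is_cone_def All_less_Suc2 Hom_iff)
    then have ex: "\<exists>!h. h \<in> Hom C M L \<and> (\<forall>i<length ?Os. p i \<cdot> h = ?q i)"
      using L unfolding is_limit_def by blast
    \<comment> \<open>\<open>p 2\<close> is \<open>f \<cdot> p 0\<close>, so compatibility of a
      mediating arrow with the corner leg follows from compatibility with the first leg.\<close>
    have "f \<cdot> (p 0 \<cdot> h) = p 2 \<cdot> h" if "h \<in> Hom C M L" for h
      by (rule comp_eq_extend[OF p(7)]) (use that p assms in \<open>auto simp: Hom_iff\<close>)
    then have "(\<forall>i<length ?Os. p i \<cdot> h = ?q i) \<longleftrightarrow> p 0 \<cdot> h = u \<and> p 1 \<cdot> h = v"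
      if "h \<in> Hom C M L" for h
      using that by (auto simp: All_less_Suc2 numeral_2_eq_2)
    then show ?thesis using ex by (smt (verit) ex1E ex1I)
  qed
  then have "is_pullback C f g (p 0) (p 1)"
    unfolding is_pullback_def using p assms by (auto simp: Hom_iff)
  then show ?thesis by blast
qed

lemma prod_cone_product:
  assumes "A \<in> Ob C" "B \<in> Ob C"
  shows "is_product C A B (prod1 C A B) (prod2 C A B)"
proof -
  have "case prod_cone C A B of (p, q) \<Rightarrow> is_product C A B p q"
    unfolding prod_cone_def by (rule someI_ex) (use product_exists[OF assms] in auto)
  then show ?thesis by (simp add: prod1_def prod2_def case_prod_beta)
qed

lemma pb_cone_pullback:
  assumes "f \<in> Ar C" "g \<in> Ar C" "Cod C f = Cod C g"
  shows "is_pullback C f g (pb1 C f g) (pb2 C f g)"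
proof -
  have "case pb_cone C f g of (p, q) \<Rightarrow> is_pullback C f g p q"
    unfolding pb_cone_def by (rule someI_ex) (use pullback_exists[OF assms] in auto)
  then show ?thesis by (simp add: pb1_def pb2_def case_prod_beta)
qed

lemma prod_arrow [simp]:
  assumes "A \<in> Ob C" "B \<in> Ob C"
  shows "prod1 C A B \<in> Ar C" "Dom C (prod1 C A B) = prod_ob C A B" "Cod C (prod1 C A B) = A"
    "prod2 C A B \<in> Ar C" "Dom C (prod2 C A B) = prod_ob C A B" "Cod C (prod2 C A B) = B"
    "prod_ob C A B \<in> Ob C"
  using prod_cone_product[OF assms] Dom_Ob unfolding is_product_def prod_ob_def
  by (auto simp: Hom_iff)

lemma product_ex1:
  assumes "u \<in> Ar C" "v \<in> Ar C" "Dom C u = Dom C v"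
  shows "\<exists>!h. h \<in> Hom C (Dom C u) (prod_ob C (Cod C u) (Cod C v)) \<and>
    prod1 C (Cod C u) (Cod C v) \<cdot> h = u \<and> prod2 C (Cod C u) (Cod C v) \<cdot> h = v"
proof -
  have "is_product C (Cod C u) (Cod C v) (prod1 C (Cod C u) (Cod C v)) (prod2 C (Cod C u) (Cod C v))"
    by (rule prod_cone_product) (use assms in auto)
  moreover have "u \<in> Hom C (Dom C u) (Cod C u)" "v \<in> Hom C (Dom C u) (Cod C v)"
    using assms by (auto simp: Hom_iff)
  ultimately show ?thesis unfolding is_product_def prod_ob_def by blast
qed

lemma pairing_arrow [simp]:
  assumes "u \<in> Ar C" "v \<in> Ar C" "Dom C u = Dom C v"
  shows "pairing C u v \<in> Ar C" "Dom C (pairing C u v) = Dom C u"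
    "Cod C (pairing C u v) = prod_ob C (Cod C u) (Cod C v)"
    "prod1 C (Cod C u) (Cod C v) \<cdot> pairing C u v = u"
    "prod2 C (Cod C u) (Cod C v) \<cdot> pairing C u v = v"
  using theI'[OF product_ex1[OF assms]] unfolding pairing_def by (auto simp: Hom_iff)

lemma product_eqI:
  assumes "h \<in> Ar C" "k \<in> Ar C" "Dom C h = Dom C k" "Cod C h = prod_ob C A B" "Cod C k = prod_ob C A B"
    "A \<in> Ob C" "B \<in> Ob C" "prod1 C A B \<cdot> h = prod1 C A B \<cdot> k" "prod2 C A B \<cdot> h = prod2 C A B \<cdot> k"
  shows "h = k"
  using product_ex1[of "prod1 C A B \<cdot> h" "prod2 C A B \<cdot> h"] assms by (auto simp: Hom_iff)

lemma pairing_comp_eq_iff: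
  assumes "u \<in> Ar C" "v \<in> Ar C" "Dom C u = Dom C v" "h \<in> Ar C" "Cod C h = Dom C u"
    and "k \<in> Ar C" "Dom C k = Dom C h" "Cod C k = prod_ob C (Cod C u) (Cod C v)"
  shows "pairing C u v \<cdot> h = k \<longleftrightarrow>
    u \<cdot> h = prod1 C (Cod C u) (Cod C v) \<cdot> k \<and> v \<cdot> h = prod2 C (Cod C u) (Cod C v) \<cdot> k"
proof -
  have "prod1 C (Cod C u) (Cod C v) \<cdot> (pairing C u v \<cdot> h) = u \<cdot> h"
    by (rule comp_eq_extend) (use assms in auto)
  moreover have "prod2 C (Cod C u) (Cod C v) \<cdot> (pairing C u v \<cdot> h) = v \<cdot> h"
    by (rule comp_eq_extend) (use assms in auto)
  ultimately show ?thesis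
    using product_eqI[of "pairing C u v \<cdot> h" k "Cod C u" "Cod C v"] assms by auto
qed

lemma pairing_comp_eq_pairing_comp_iff:
  assumes "u \<in> Ar C" "v \<in> Ar C" "Dom C u = Dom C v" "h \<in> Ar C" "Cod C h = Dom C u"
    and "u' \<in> Ar C" "v' \<in> Ar C" "Dom C u' = Dom C v'" "k \<in> Ar C" "Cod C k = Dom C u'"
    and "Dom C k = Dom C h" "Cod C u = Cod C u'" "Cod C v = Cod C v'"
  shows "pairing C u v \<cdot> h = pairing C u' v' \<cdot> k \<longleftrightarrow> u \<cdot> h = u' \<cdot> k \<and> v \<cdot> h = v' \<cdot> k"
proof -
  have "prod1 C (Cod C u) (Cod C v) \<cdot> (pairing C u' v' \<cdot> k) = u' \<cdot> k"
    by (rule comp_eq_extend) (use assms in auto)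
  moreover have "prod2 C (Cod C u) (Cod C v) \<cdot> (pairing C u' v' \<cdot> k) = v' \<cdot> k"
    by (rule comp_eq_extend) (use assms in auto)
  ultimately show ?thesis
    using pairing_comp_eq_iff[of u v h "pairing C u' v' \<cdot> k"] assms by simp
qed

lemma prod_map_arrow [simp]:
  assumes "f \<in> Ar C" "g \<in> Ar C"
  shows "prod_map C f g \<in> Ar C" "Dom C (prod_map C f g) = prod_ob C (Dom C f) (Dom C g)"
    "Cod C (prod_map C f g) = prod_ob C (Cod C f) (Cod C g)"
  using assms by (simp_all add: prod_map_def)

lemma prod_map_comp_eq_pairing_comp_iff:
  assumes "f \<in> Ar C" "g \<in> Ar C" "h \<in> Ar C" "Cod C h = prod_ob C (Dom C f) (Dom C g)"
    and "u \<in> Ar C" "v \<in> Ar C" "Dom C u = Dom C v" "k \<in> Ar C" "Cod C k = Dom C u"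
    and "Dom C k = Dom C h" "Cod C u = Cod C f" "Cod C v = Cod C g"
  shows "prod_map C f g \<cdot> h = pairing C u v \<cdot> k \<longleftrightarrow>
    f \<cdot> (prod1 C (Dom C f) (Dom C g) \<cdot> h) = u \<cdot> k \<and> g \<cdot> (prod2 C (Dom C f) (Dom C g) \<cdot> h) = v \<cdot> k"
  unfolding prod_map_def
  by (subst pairing_comp_eq_pairing_comp_iff) (use assms in auto)

section \<open>Membership, inclusion and intersection of relations\<close>

lemma relationD [simp]:
  assumes "is_relation C X"
  shows "lft X \<in> Ar C" "Dom C (lft X) = Rel X" "Cod C (lft X) = Car X"
    "rgt X \<in> Ar C" "Dom C (rgt X) = Rel X" "Cod C (rgt X) = Car X" "Car X \<in> Ob C" "Rel X \<in> Ob C"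
  using assms Dom_Ob[of "lft X"] unfolding is_relation_def by (auto simp: Hom_iff)

lemma rel_arrow_arrow [simp]:
  assumes "is_relation C X"
  shows "rel_arrow C X \<in> Ar C" "Dom C (rel_arrow C X) = Rel X"
    "Cod C (rel_arrow C X) = prod_ob C (Car X) (Car X)"
  using assms by (simp_all add: rel_arrow_def)

lemma rel_arrow_comp_eq_iff:
  assumes "is_relation C X" "is_relation C Y" "Car X = Car Y" "h \<in> Ar C" "k \<in> Ar C"
    "Cod C h = Rel X" "Cod C k = Rel Y" "Dom C k = Dom C h"
  shows "rel_arrow C X \<cdot> h = rel_arrow C Y \<cdot> k \<longleftrightarrow> lft X \<cdot> h = lft Y \<cdot> k \<and> rgt X \<cdot> h = rgt Y \<cdot> k"
  unfolding rel_arrow_def by (subst pairing_comp_eq_pairing_comp_iff) (use assms in auto)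

text \<open>A monomorphism into a product is a jointly monic pair of legs; this and
  \<open>relationI\<close> keep the product out of sight in most later arguments.\<close>

lemma relation_jointly_monic:
  assumes "is_relation C X" "h \<in> Ar C" "k \<in> Ar C" "Cod C h = Rel X" "Cod C k = Rel X"
    "Dom C h = Dom C k" "lft X \<cdot> h = lft X \<cdot> k" "rgt X \<cdot> h = rgt X \<cdot> k"
  shows "h = k"
proof (rule monoD[of "rel_arrow C X"])
  show "is_mono C (rel_arrow C X)" using assms(1) by (simp add: is_relation_def)
  show "rel_arrow C X \<cdot> h = rel_arrow C X \<cdot> k"
    by (subst rel_arrow_comp_eq_iff) (use assms in auto)
qed (use assms in auto)

lemma relationI:
  assumes "lft X \<in> Ar C" "Dom C (lft X) = Rel X" "Cod C (lft X) = Car X"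
    "rgt X \<in> Ar C" "Dom C (rgt X) = Rel X" "Cod C (rgt X) = Car X"
    and "\<And>h k. h \<in> Ar C \<Longrightarrow> k \<in> Ar C \<Longrightarrow> Cod C h = Rel X \<Longrightarrow> Cod C k = Rel X \<Longrightarrow>
      Dom C h = Dom C k \<Longrightarrow> lft X \<cdot> h = lft X \<cdot> k \<Longrightarrow> rgt X \<cdot> h = rgt X \<cdot> k \<Longrightarrow> h = k"
  shows "is_relation C X"
proof -
  have "rel_arrow C X \<cdot> h = rel_arrow C X \<cdot> k \<longleftrightarrow> lft X \<cdot> h = lft X \<cdot> k \<and> rgt X \<cdot> h = rgt X \<cdot> k"
    if "h \<in> Ar C" "k \<in> Ar C" "Cod C h = Rel X" "Cod C k = Rel X" "Dom C h = Dom C k" for h k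
    unfolding rel_arrow_def by (subst pairing_comp_eq_pairing_comp_iff) (use that assms(1-6) in auto)
  moreover have "rel_arrow C X \<in> Ar C" "Dom C (rel_arrow C X) = Rel X"
    unfolding rel_arrow_def using assms(1-6) by auto
  moreover have "Car X \<in> Ob C" using Cod_Ob[OF assms(1)] assms(3) by simp
  ultimately show ?thesis
    unfolding is_relation_def is_mono_def using assms by (auto simp: Hom_iff)
qed

lemma in_relI: "h \<in> Ar C \<Longrightarrow> Cod C h = Rel X \<Longrightarrow> in_rel C X (lft X \<cdot> h) (rgt X \<cdot> h)"
  unfolding in_rel_def by auto

lemma in_relE:
  assumes "in_rel C X x y" "is_relation C X"
  obtains h where "h \<in> Ar C" "Dom C h = Dom C x" "Cod C h = Rel X" "lft X \<cdot> h = x" "rgt X \<cdot> h = y"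
  using assms unfolding in_rel_def by auto

lemma in_relD:
  assumes "in_rel C X x y" "is_relation C X"
  shows "x \<in> Ar C" "y \<in> Ar C" "Dom C y = Dom C x" "Cod C x = Car X" "Cod C y = Car X"
  using assms unfolding in_rel_def by auto

lemma in_rel_lft_rgt: "is_relation C X \<Longrightarrow> in_rel C X (lft X) (rgt X)"
  using in_relI[of "Id C (Rel X)" X] by simp

lemma in_rel_comp:
  assumes "in_rel C X x y" "is_relation C X" "c \<in> Ar C" "Cod C c = Dom C x"
  shows "in_rel C X (x \<cdot> c) (y \<cdot> c)"
proof -
  obtain h where h: "h \<in> Ar C" "Dom C h = Dom C x" "Cod C h = Rel X" "lft X \<cdot> h = x" "rgt X \<cdot> h = y"
    by (rule in_relE[OF assms(1,2)])
  have "lft X \<cdot> (h \<cdot> c) = x \<cdot> c" by (rule comp_eq_extend) (use h assms(2-4) in auto)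
  moreover have "rgt X \<cdot> (h \<cdot> c) = y \<cdot> c" by (rule comp_eq_extend) (use h assms(2-4) in auto)
  ultimately show ?thesis using in_relI[of "h \<cdot> c" X] h assms(3,4) by simp
qed

text \<open>A Yoneda argument: the legs \<open>lft X\<close>, \<open>rgt X\<close> form the generic
  related pair, and a witness that it lies in \<open>Y\<close> is precisely the required
  factorization.\<close>

lemma rel_le_iff:
  assumes "is_relation C X" "is_relation C Y" "Car X = Car Y"
  shows "rel_le C X Y \<longleftrightarrow> (\<forall>x y. in_rel C X x y \<longrightarrow> in_rel C Y x y)"
proof -
  have *: "rel_arrow C Y \<cdot> h = rel_arrow C X \<longleftrightarrow> lft Y \<cdot> h = lft X \<and> rgt Y \<cdot> h = rgt X"
    if "h \<in> Hom C (Rel X) (Rel Y)" for h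
    using rel_arrow_comp_eq_iff[of Y X h "Id C (Rel X)"] assms that by (simp add: Hom_iff)
  show ?thesis
  proof
    assume "rel_le C X Y"
    then obtain h where h: "h \<in> Hom C (Rel X) (Rel Y)" "lft Y \<cdot> h = lft X" "rgt Y \<cdot> h = rgt X"
      using * unfolding rel_le_def by blast
    show "\<forall>x y. in_rel C X x y \<longrightarrow> in_rel C Y x y"
    proof (intro allI impI)
      fix x y assume "in_rel C X x y"
      then obtain k where k: "k \<in> Ar C" "Cod C k = Rel X" "lft X \<cdot> k = x" "rgt X \<cdot> k = y"
        using assms by (auto elim: in_relE)
      have "lft Y \<cdot> (h \<cdot> k) = lft X \<cdot> k"
        by (rule comp_eq_extend) (use h k assms in \<open>auto simp: Hom_iff\<close>)
      moreover have "rgt Y \<cdot> (h \<cdot> k) = rgt X \<cdot> k"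
        by (rule comp_eq_extend) (use h k assms in \<open>auto simp: Hom_iff\<close>)
      ultimately show "in_rel C Y x y" using in_relI[of "h \<cdot> k" Y] h(1) k by (auto simp: Hom_iff)
    qed
  next
    assume "\<forall>x y. in_rel C X x y \<longrightarrow> in_rel C Y x y"
    then have "in_rel C Y (lft X) (rgt X)" using in_rel_lft_rgt[OF assms(1)] by blast
    then obtain h where "h \<in> Hom C (Rel X) (Rel Y)" "lft Y \<cdot> h = lft X" "rgt Y \<cdot> h = rgt X"
      by (rule in_relE) (use assms in \<open>auto simp: Hom_iff\<close>)
    then show "rel_le C X Y" using * assms(3) unfolding rel_le_def by blast
  qed
qed

lemma is_relation_op [simp]: "is_relation C X \<Longrightarrow> is_relation C (op_rel X)"
  by (rule relationI) (auto simp: op_rel_def intro: relation_jointly_monic[of X])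

lemma in_rel_op [simp]: "in_rel C (op_rel X) x y \<longleftrightarrow> in_rel C X y x"
  by (auto simp: in_rel_def op_rel_def)

lemma is_relation_diag [simp]: "A \<in> Ob C \<Longrightarrow> is_relation C (diag_rel C A)"
  by (rule relationI) (auto simp: diag_rel_def)

lemma in_rel_diag: "A \<in> Ob C \<Longrightarrow> in_rel C (diag_rel C A) x y \<longleftrightarrow> x = y \<and> x \<in> Ar C \<and> Cod C x = A"
  by (auto simp: in_rel_def diag_rel_def)

text \<open>Membership is local for regular epimorphisms. A witness over \<open>e\<close> takes
  equal values on arrows identified by \<open>e\<close>, because its two components do and the legs
  of \<open>X\<close> are jointly monic; hence it descends.\<close>

lemma in_rel_descend:
  assumes "in_rel C X (x \<cdot> e) (y \<cdot> e)" "is_relation C X" "regular_epi C e"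
    and "x \<in> Ar C" "y \<in> Ar C" "Dom C x = Cod C e" "Dom C y = Cod C e" "Cod C x = Car X" "Cod C y = Car X"
  shows "in_rel C X x y"
proof -
  note e = regular_epi_arrow[OF assms(3)]
  obtain h where h: "h \<in> Ar C" "Dom C h = Dom C e" "Cod C h = Rel X"
    "lft X \<cdot> h = x \<cdot> e" "rgt X \<cdot> h = y \<cdot> e"
    by (rule in_relE[OF assms(1,2)]) (use assms(4-) e in auto)
  have "h \<cdot> u = h \<cdot> v" if uv: "u \<in> Ar C" "v \<in> Ar C" "Dom C u = Dom C v" "Cod C u = Dom C e"
    "Cod C v = Dom C e" "e \<cdot> u = e \<cdot> v" for u v
  proof (rule relation_jointly_monic[OF assms(2)])
    have "lft X \<cdot> (h \<cdot> w) = x \<cdot> (e \<cdot> w)" "rgt X \<cdot> (h \<cdot> w) = y \<cdot> (e \<cdot> w)"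
      if "w \<in> Ar C" "Cod C w = Dom C e" for w
      by (rule square_extend[OF h(4)] square_extend[OF h(5)]; use that assms(2,4-) e h(1-3) in auto)+
    then show "lft X \<cdot> (h \<cdot> u) = lft X \<cdot> (h \<cdot> v)" "rgt X \<cdot> (h \<cdot> u) = rgt X \<cdot> (h \<cdot> v)"
      using uv by auto
  qed (use uv e h in auto)
  then obtain k where k: "k \<in> Ar C" "Dom C k = Cod C e" "Cod C k = Rel X" "k \<cdot> e = h"
    using regular_epi_descend[OF assms(3) h(1,2)] h(3) by metis
  have "lft X \<cdot> k = x" by (rule regular_epi_cancel[OF assms(3)]) (use k h assms(2,4-) e in auto)
  moreover have "rgt X \<cdot> k = y"
    by (rule regular_epi_cancel[OF assms(3)]) (use k h assms(2,4-) e in auto)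
  ultimately show ?thesis using in_relI[of k X] k by simp
qed

lemma op_rel_sel [simp]: "Car (op_rel X) = Car X" "Rel (op_rel X) = Rel X"
  "lft (op_rel X) = rgt X" "rgt (op_rel X) = lft X"
  by (simp_all add: op_rel_def)

lemma diag_rel_sel [simp]: "Car (diag_rel C A) = A" by (simp add: diag_rel_def)

text \<open>The construction keeps only the first leg \<open>p\<close> of the pullback. The second
  leg \<open>q\<close> is controlled by it: its components in \<open>Y\<close> agree with those of
  \<open>p\<close> in \<open>X\<close>, so joint monicity of \<open>Y\<close> determines
  \<open>q \<cdot> h\<close> from \<open>p \<cdot> h\<close>.\<close>

lemma meet_rel:
  assumes "is_relation C X" "is_relation C Y" "Car X = Car Y"
  shows meet_rel_pullback: "is_pullback C (rel_arrow C X) (rel_arrow C Y)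
      (pb1 C (rel_arrow C X) (rel_arrow C Y)) (pb2 C (rel_arrow C X) (rel_arrow C Y))" (is ?pb)
    and Car_meet_rel: "Car (meet_rel C X Y) = Car X"
    and is_relation_meet: "is_relation C (meet_rel C X Y)"
    and in_rel_meet: "in_rel C (meet_rel C X Y) x y \<longleftrightarrow> in_rel C X x y \<and> in_rel C Y x y"
proof -
  define p q where pq: "p = pb1 C (rel_arrow C X) (rel_arrow C Y)"
    "q = pb2 C (rel_arrow C X) (rel_arrow C Y)"
  let ?M = "meet_rel C X Y"
  show ?pb by (rule pb_cone_pullback) (use assms in auto)
  then have pb: "is_pullback C (rel_arrow C X) (rel_arrow C Y) p q" by (simp add: pq)
  note d = pullbackD[OF pb]
  show M: "Car ?M = Car X" by (simp add: meet_rel_def Let_def)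
  have M_sel: "Rel ?M = Dom C p" "lft ?M = lft X \<cdot> p" "rgt ?M = rgt X \<cdot> p"
    by (simp_all add: meet_rel_def Let_def pq)
  have sq: "lft X \<cdot> p = lft Y \<cdot> q" "rgt X \<cdot> p = rgt Y \<cdot> q"
    using rel_arrow_comp_eq_iff[of X Y p q] d assms by auto
  have lq: "lft X \<cdot> (p \<cdot> h) = lft Y \<cdot> (q \<cdot> h)" "rgt X \<cdot> (p \<cdot> h) = rgt Y \<cdot> (q \<cdot> h)"
    if "h \<in> Ar C" "Cod C h = Dom C p" for h
    by (rule square_extend[OF sq(1)] square_extend[OF sq(2)]; use that d assms in auto)+
  show rel: "is_relation C ?M"
  proof (rule relationI)
    fix h k assume hk: "h \<in> Ar C" "k \<in> Ar C" "Cod C h = Rel ?M" "Cod C k = Rel ?M" "Dom C h = Dom C k"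
      "lft ?M \<cdot> h = lft ?M \<cdot> k" "rgt ?M \<cdot> h = rgt ?M \<cdot> k"
    then have hk': "Cod C h = Dom C p" "Cod C k = Dom C p"
      "lft X \<cdot> (p \<cdot> h) = lft X \<cdot> (p \<cdot> k)" "rgt X \<cdot> (p \<cdot> h) = rgt X \<cdot> (p \<cdot> k)"
      using d assms by (auto simp: M_sel)
    show "h = k"
    proof (rule pullback_jointly_monic[OF pb])
      show "p \<cdot> h = p \<cdot> k"
        by (rule relation_jointly_monic[OF assms(1)]) (use hk(1,2,5) hk' d assms in auto)
      show "q \<cdot> h = q \<cdot> k"
      proof (rule relation_jointly_monic[OF assms(2)])
        show "lft Y \<cdot> (q \<cdot> h) = lft Y \<cdot> (q \<cdot> k)" "rgt Y \<cdot> (q \<cdot> h) = rgt Y \<cdot> (q \<cdot> k)"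
          using lq[of h] lq[of k] hk(1,2) hk' by simp_all
      qed (use hk(1,2,5) hk' d assms in auto)
    qed (use hk hk' in auto)
  qed (use d assms M M_sel in auto)
  show "in_rel C ?M x y \<longleftrightarrow> in_rel C X x y \<and> in_rel C Y x y"
  proof
    assume "in_rel C ?M x y"
    then obtain h where h: "h \<in> Ar C" "Cod C h = Dom C p" "lft X \<cdot> p \<cdot> h = x" "rgt X \<cdot> p \<cdot> h = y"
      by (rule in_relE[OF _ rel]) (simp add: M_sel)
    then have x: "x = lft X \<cdot> (p \<cdot> h)" "y = rgt X \<cdot> (p \<cdot> h)" using d assms by auto
    then have "x = lft Y \<cdot> (q \<cdot> h)" "y = rgt Y \<cdot> (q \<cdot> h)" using lq h by auto
    then show "in_rel C X x y \<and> in_rel C Y x y"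
      using in_relI[of "p \<cdot> h" X] in_relI[of "q \<cdot> h" Y] x h d assms by auto
  next
    assume xy: "in_rel C X x y \<and> in_rel C Y x y"
    obtain h where h: "h \<in> Ar C" "Dom C h = Dom C x" "Cod C h = Rel X" "lft X \<cdot> h = x" "rgt X \<cdot> h = y"
      using xy assms by (auto elim: in_relE)
    obtain k where k: "k \<in> Ar C" "Dom C k = Dom C x" "Cod C k = Rel Y" "lft Y \<cdot> k = x" "rgt Y \<cdot> k = y"
      using xy assms by (auto elim: in_relE)
    have eq: "rel_arrow C X \<cdot> h = rel_arrow C Y \<cdot> k"
      by (subst rel_arrow_comp_eq_iff) (use h k assms in auto)
    obtain l where "l \<in> Ar C" "Dom C l = Dom C h" "Cod C l = Dom C p" "p \<cdot> l = h" "q \<cdot> l = k"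
      by (rule pullback_lift[OF pb _ _ _ _ _ eq]) (use h k assms in auto)
    then show "in_rel C ?M x y" using in_relI[of l ?M] h d assms by (auto simp: M_sel)
  qed
qed

text \<open>A map into the pullback is a pair of elements of \<open>Dom C f\<close>, encoded by
  \<open>pairing\<close>, together with a witness that their images lie in \<open>X\<close>. The
  witness is unique since \<open>X\<close> is monic.\<close>

lemma inv_rel:
  assumes "is_relation C X" "f \<in> Ar C" "Cod C f = Car X"
  shows Car_inv_rel: "Car (inv_rel C f X) = Dom C f"
    and is_relation_inv_rel: "is_relation C (inv_rel C f X)"
    and in_rel_inv_rel: "in_rel C (inv_rel C f X) x y \<longleftrightarrow> x \<in> Ar C \<and> y \<in> Ar C \<and> Dom C x = Dom C y \<and>
      Cod C x = Dom C f \<and> Cod C y = Dom C f \<and> in_rel C X (f \<cdot> x) (f \<cdot> y)"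
proof -
  let ?A = "Dom C f" and ?M = "inv_rel C f X"
  define p q where pq: "p = pb1 C (prod_map C f f) (rel_arrow C X)"
    "q = pb2 C (prod_map C f f) (rel_arrow C X)"
  have pb: "is_pullback C (prod_map C f f) (rel_arrow C X) p q"
    unfolding pq by (rule pb_cone_pullback) (use assms in auto)
  note d = pullbackD[OF pb]
  have A: "?A \<in> Ob C" using assms by simp
  have M: "Car ?M = ?A" "Rel ?M = Dom C p" "lft ?M = prod1 C ?A ?A \<cdot> p" "rgt ?M = prod2 C ?A ?A \<cdot> p"
    by (simp_all add: inv_rel_def Let_def pq)
  then show "Car ?M = ?A" by simp
  show rel: "is_relation C ?M"
  proof (rule relationI)
    fix h k assume hk: "h \<in> Ar C" "k \<in> Ar C" "Cod C h = Rel ?M" "Cod C k = Rel ?M" "Dom C h = Dom C k"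
      "lft ?M \<cdot> h = lft ?M \<cdot> k" "rgt ?M \<cdot> h = rgt ?M \<cdot> k"
    then have hk': "Cod C h = Dom C p" "Cod C k = Dom C p"
      "prod1 C ?A ?A \<cdot> (p \<cdot> h) = prod1 C ?A ?A \<cdot> (p \<cdot> k)"
      "prod2 C ?A ?A \<cdot> (p \<cdot> h) = prod2 C ?A ?A \<cdot> (p \<cdot> k)"
      using d assms by (auto simp: M)
    have ph: "p \<cdot> h = p \<cdot> k"
      by (rule product_eqI[of _ _ ?A ?A]) (use hk(1,2,5) hk' d assms in auto)
    show "h = k"
    proof (rule pullback_jointly_monic[OF pb])
      show "q \<cdot> h = q \<cdot> k"
      proof (rule monoD[of "rel_arrow C X"])
        show "is_mono C (rel_arrow C X)" using assms(1) by (simp add: is_relation_def)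
        have "rel_arrow C X \<cdot> (q \<cdot> l) = prod_map C f f \<cdot> (p \<cdot> l)"
          if "l \<in> Ar C" "Cod C l = Dom C p" for l
          by (rule square_extend[OF d(9)[symmetric]]) (use that d assms in auto)
        then show "rel_arrow C X \<cdot> (q \<cdot> h) = rel_arrow C X \<cdot> (q \<cdot> k)" using hk hk' ph by simp
      qed (use hk(1,2,5) hk' d assms in auto)
    qed (use hk hk' ph in auto)
  qed (use d assms M in auto)
  show "in_rel C ?M x y \<longleftrightarrow> x \<in> Ar C \<and> y \<in> Ar C \<and> Dom C x = Dom C y \<and>
      Cod C x = Dom C f \<and> Cod C y = Dom C f \<and> in_rel C X (f \<cdot> x) (f \<cdot> y)"
    (is "_ \<longleftrightarrow> ?R")
  proof
    assume "in_rel C ?M x y"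
    then obtain h where h: "h \<in> Ar C" "Cod C h = Dom C p" "prod1 C ?A ?A \<cdot> p \<cdot> h = x"
      "prod2 C ?A ?A \<cdot> p \<cdot> h = y"
      by (rule in_relE[OF _ rel]) (simp add: M)
    then have x: "x = prod1 C ?A ?A \<cdot> (p \<cdot> h)" "y = prod2 C ?A ?A \<cdot> (p \<cdot> h)" using d assms by auto
    have "prod_map C f f \<cdot> (p \<cdot> h) = rel_arrow C X \<cdot> (q \<cdot> h)"
      by (rule square_extend[OF d(9)]) (use h d assms in auto)
    then have "f \<cdot> x = lft X \<cdot> (q \<cdot> h) \<and> f \<cdot> y = rgt X \<cdot> (q \<cdot> h)"
      unfolding x rel_arrow_def
      by (subst (asm) prod_map_comp_eq_pairing_comp_iff) (use h d assms in auto)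
    then show ?R using in_relI[of "q \<cdot> h" X] x h d assms by auto
  next
    assume R: ?R
    then obtain k where k: "k \<in> Ar C" "Dom C k = Dom C (f \<cdot> x)" "Cod C k = Rel X"
      "lft X \<cdot> k = f \<cdot> x" "rgt X \<cdot> k = f \<cdot> y"
      using assms by (meson in_relE)
    have pr: "prod1 C ?A ?A \<cdot> pairing C x y = x" "prod2 C ?A ?A \<cdot> pairing C x y = y"
      using pairing_arrow(4,5)[of x y] R by auto
    have eq: "prod_map C f f \<cdot> pairing C x y = rel_arrow C X \<cdot> k"
      unfolding rel_arrow_def
      by (subst prod_map_comp_eq_pairing_comp_iff) (use R k pr assms in auto)
    obtain l where "l \<in> Ar C" "Dom C l = Dom C (pairing C x y)" "Cod C l = Dom C p"
      "p \<cdot> l = pairing C x y" "q \<cdot> l = k"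
      by (rule pullback_lift[OF pb _ _ _ _ _ eq]) (use R k assms in auto)
    then show "in_rel C ?M x y" using in_relI[of l ?M] pr d assms by (auto simp: M)
  qed
qed


section \<open>Preorders\<close>

lemma reflexive_iff:
  assumes "is_relation C X"
  shows "reflexive C X \<longleftrightarrow> (\<forall>x \<in> Ar C. Cod C x = Car X \<longrightarrow> in_rel C X x x)"
proof -
  have "reflexive C X \<longleftrightarrow> (\<forall>x y. in_rel C (diag_rel C (Car X)) x y \<longrightarrow> in_rel C X x y)"
    unfolding reflexive_def by (rule rel_le_iff) (use assms in auto)
  then show ?thesis using assms by (auto simp: in_rel_diag)
qed

lemma symmetric_iff:
  assumes "is_relation C X"
  shows "symmetric C X \<longleftrightarrow> (\<forall>x y. in_rel C X x y \<longrightarrow> in_rel C X y x)"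
  unfolding symmetric_def by (subst rel_le_iff) (use assms in auto)

text \<open>The two projections from the object of composable pairs give the generic composable
  pair. Its composite \<open>t\<close>, restricted along the mediating arrow \<open>w\<close>,
  composes any given pair; conversely \<open>t\<close> is the composite of the generic pair.\<close>

lemma transitive_iff:
  assumes "is_relation C X"
  shows "transitive C X \<longleftrightarrow> (\<forall>x y z. in_rel C X x y \<longrightarrow> in_rel C X y z \<longrightarrow> in_rel C X x z)"
proof -
  define p q where pq: "p = pb1 C (rgt X) (lft X)" "q = pb2 C (rgt X) (lft X)"
  have pb: "is_pullback C (rgt X) (lft X) p q"
    unfolding pq by (rule pb_cone_pullback) (use assms in auto)
  note d = pullbackD[OF pb]
  have trans: "transitive C X \<longleftrightarrow>
      (\<exists>t \<in> Hom C (Dom C p) (Rel X). lft X \<cdot> t = lft X \<cdot> p \<and> rgt X \<cdot> t = rgt X \<cdot> q)"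
    by (simp add: transitive_def Let_def pq)
  show ?thesis
  proof
    assume "transitive C X"
    then obtain t where t: "t \<in> Ar C" "Dom C t = Dom C p" "Cod C t = Rel X"
      "lft X \<cdot> t = lft X \<cdot> p" "rgt X \<cdot> t = rgt X \<cdot> q"
      unfolding trans by (auto simp: Hom_iff)
    have "in_rel C X x z" if xy: "in_rel C X x y" and yz: "in_rel C X y z" for x y z
    proof -
      obtain h where h: "h \<in> Ar C" "Dom C h = Dom C x" "Cod C h = Rel X" "lft X \<cdot> h = x" "rgt X \<cdot> h = y"
        by (rule in_relE[OF xy assms])
      obtain k where k: "k \<in> Ar C" "Dom C k = Dom C y" "Cod C k = Rel X" "lft X \<cdot> k = y" "rgt X \<cdot> k = z"
        by (rule in_relE[OF yz assms])
      have eq: "rgt X \<cdot> h = lft X \<cdot> k" using h k by simp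
      obtain w where w: "w \<in> Ar C" "Dom C w = Dom C h" "Cod C w = Dom C p" "p \<cdot> w = h" "q \<cdot> w = k"
        by (rule pullback_lift[OF pb _ _ _ _ _ eq])
          (use h k in_relD[OF xy assms] assms in auto)
      have "lft X \<cdot> (t \<cdot> w) = lft X \<cdot> (p \<cdot> w)"
        by (rule square_extend[OF t(4)]) (use t(1-3) w(1-3) d assms in auto)
      moreover have "rgt X \<cdot> (t \<cdot> w) = rgt X \<cdot> (q \<cdot> w)"
        by (rule square_extend[OF t(5)]) (use t(1-3) w(1-3) d assms in auto)
      ultimately show ?thesis using in_relI[of "t \<cdot> w" X] t(1-3) w h k by auto
    qed
    then show "\<forall>x y z. in_rel C X x y \<longrightarrow> in_rel C X y z \<longrightarrow> in_rel C X x z" by blast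
  next
    assume r: "\<forall>x y z. in_rel C X x y \<longrightarrow> in_rel C X y z \<longrightarrow> in_rel C X x z"
    have "in_rel C X (lft X \<cdot> p) (rgt X \<cdot> p)" "in_rel C X (lft X \<cdot> q) (rgt X \<cdot> q)"
      using in_relI[of p X] in_relI[of q X] d assms by auto
    then have "in_rel C X (lft X \<cdot> p) (rgt X \<cdot> q)" using r d(9) by metis
    then obtain t where "t \<in> Ar C" "Dom C t = Dom C p" "Cod C t = Rel X"
        "lft X \<cdot> t = lft X \<cdot> p" "rgt X \<cdot> t = rgt X \<cdot> q"
      by (rule in_relE) (use assms d in auto)
    then show "transitive C X" unfolding trans by (auto simp: Hom_iff)
  qed
qed

lemma preorder_iff:
  "is_preorder C X \<longleftrightarrow> is_relation C X \<and> (\<forall>x \<in> Ar C. Cod C x = Car X \<longrightarrow> in_rel C X x x) \<and>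
    (\<forall>x y z. in_rel C X x y \<longrightarrow> in_rel C X y z \<longrightarrow> in_rel C X x z)"
  unfolding is_preorder_def using reflexive_iff transitive_iff by blast

lemma preorder_relation [simp]: "is_preorder C X \<Longrightarrow> is_relation C X"
  by (simp add: is_preorder_def)

lemma preorder_refl: "is_preorder C X \<Longrightarrow> x \<in> Ar C \<Longrightarrow> Cod C x = Car X \<Longrightarrow> in_rel C X x x"
  by (simp add: preorder_iff)

lemma preorder_trans: "is_preorder C X \<Longrightarrow> in_rel C X x y \<Longrightarrow> in_rel C X y z \<Longrightarrow> in_rel C X x z"
  unfolding preorder_iff by blast

lemma preorder_diag: "A \<in> Ob C \<Longrightarrow> is_preorder C (diag_rel C A)"
  unfolding preorder_iff by (auto simp: in_rel_diag)

lemma preorder_inv_rel: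
  assumes "is_preorder C X" "f \<in> Ar C" "Cod C f = Car X"
  shows "is_preorder C (inv_rel C f X)"
proof -
  have X: "is_relation C X" using assms by simp
  show ?thesis
    unfolding preorder_iff
    using assms is_relation_inv_rel[OF X assms(2,3)] preorder_refl[OF assms(1)]
      preorder_trans[OF assms(1)]
    by (simp add: in_rel_inv_rel[OF X assms(2,3)] Car_inv_rel[OF X assms(2,3)]) blast
qed

lemma preorder_meet:
  assumes "is_preorder C X" "is_preorder C Y" "Car X = Car Y"
  shows "is_preorder C (meet_rel C X Y)"
proof -
  have XY: "is_relation C X" "is_relation C Y" using assms by auto
  show ?thesis
    unfolding preorder_iff
    using is_relation_meet[OF XY assms(3)] assms(3) preorder_refl[OF assms(1)] preorder_refl[OF assms(2)]
      preorder_trans[OF assms(1)] preorder_trans[OF assms(2)]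
    by (simp add: in_rel_meet[OF XY assms(3)] Car_meet_rel[OF XY assms(3)]) blast
qed

lemma sim:
  assumes "is_relation C X"
  shows is_relation_sim [simp]: "is_relation C (sim C X)"
    and Car_sim [simp]: "Car (sim C X) = Car X"
    and in_rel_sim: "in_rel C (sim C X) x y \<longleftrightarrow> in_rel C X x y \<and> in_rel C X y x"
  using is_relation_meet[of X "op_rel X"] Car_meet_rel[of X "op_rel X"]
    in_rel_meet[of X "op_rel X" x y] assms
  by (simp_all add: sim_def)

lemma sim_equivalence:
  assumes "is_preorder C X"
  shows "is_equivalence_rel C (sim C X)"
proof -
  have X: "is_relation C X" using assms by simp
  then show ?thesis
    unfolding is_equivalence_rel_def
    using preorder_refl[OF assms] preorder_trans[OF assms]
    by (auto simp: reflexive_iff symmetric_iff transitive_iff in_rel_sim[OF X])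
qed

lemma sim_sym: "is_preorder C X \<Longrightarrow> in_rel C (sim C X) x y \<Longrightarrow> in_rel C (sim C X) y x"
  by (simp add: in_rel_sim)

lemma sim_refl: "is_preorder C X \<Longrightarrow> x \<in> Ar C \<Longrightarrow> Cod C x = Car X \<Longrightarrow> in_rel C (sim C X) x x"
  by (simp add: in_rel_sim preorder_refl)

text \<open>Of the two inclusions that make \<open>\<sim>\<close> the diagonal, one is reflexivity;
  the other is antisymmetry.\<close>

lemma partial_order_iff:
  "is_partial_order C X \<longleftrightarrow>
    is_preorder C X \<and> (\<forall>x y. in_rel C X x y \<longrightarrow> in_rel C X y x \<longrightarrow> x = y)"
proof (cases "is_preorder C X")
  case True
  then have X: "is_relation C X" and Ob: "Car X \<in> Ob C" by simp_all
  have "rel_eq C (sim C X) (diag_rel C (Car X)) \<longleftrightarrow>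
      (\<forall>x y. in_rel C (sim C X) x y \<longleftrightarrow> in_rel C (diag_rel C (Car X)) x y)"
    unfolding rel_eq_def
    using rel_le_iff[of "sim C X" "diag_rel C (Car X)"] rel_le_iff[of "diag_rel C (Car X)" "sim C X"]
      is_relation_sim[OF X] Car_sim[OF X] is_relation_diag[OF Ob] diag_rel_sel[of "Car X"]
    by metis
  also have "\<dots> \<longleftrightarrow> (\<forall>x y. in_rel C X x y \<longrightarrow> in_rel C X y x \<longrightarrow> x = y)"
  proof -
    have "\<And>x y. in_rel C X x y \<Longrightarrow> x \<in> Ar C \<and> Cod C x = Car X" using in_relD[OF _ X] by blast
    moreover have "\<And>x. x \<in> Ar C \<Longrightarrow> Cod C x = Car X \<Longrightarrow> in_rel C X x x"
      by (rule preorder_refl[OF True])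
    ultimately show ?thesis unfolding in_rel_sim[OF X] in_rel_diag[OF Ob] by blast
  qed
  finally show ?thesis by (simp add: True is_partial_order_def)
qed (simp add: is_partial_order_def)


section \<open>Morphisms of preorders\<close>

lemma PreOrd_simps [simp]:
  "X \<in> Ob (PreOrd C) \<longleftrightarrow> is_preorder C X"
  "Dom (PreOrd C) = src" "Cod (PreOrd C) = tgt"
  "src (n \<cdot>\<^bsub>PreOrd C\<^esub> m) = src m" "tgt (n \<cdot>\<^bsub>PreOrd C\<^esub> m) = tgt n"
  "base (n \<cdot>\<^bsub>PreOrd C\<^esub> m) = base n \<cdot> base m"
  "src (Id (PreOrd C) X) = X" "tgt (Id (PreOrd C) X) = X" "base (Id (PreOrd C) X) = Id C (Car X)"
  by (simp_all add: PreOrd_def)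

lemma PreOrd_arrD:
  assumes "m \<in> Ar (PreOrd C)"
  shows "is_preorder C (src m)" "is_preorder C (tgt m)"
    "base m \<in> Ar C" "Dom C (base m) = Car (src m)" "Cod C (base m) = Car (tgt m)"
    "relm m \<in> Ar C" "Dom C (relm m) = Rel (src m)" "Cod C (relm m) = Rel (tgt m)"
    "lft (tgt m) \<cdot> relm m = base m \<cdot> lft (src m)" "rgt (tgt m) \<cdot> relm m = base m \<cdot> rgt (src m)"
  using assms by (simp_all add: PreOrd_def Hom_iff)

lemma PreOrd_mono:
  assumes "m \<in> Ar (PreOrd C)" "in_rel C (src m) x y"
  shows "in_rel C (tgt m) (base m \<cdot> x) (base m \<cdot> y)"
proof -
  note m = PreOrd_arrD[OF assms(1)]
  obtain h where h: "h \<in> Ar C" "Dom C h = Dom C x" "Cod C h = Rel (src m)"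
    "lft (src m) \<cdot> h = x" "rgt (src m) \<cdot> h = y"
    by (rule in_relE[OF assms(2)]) (use m in auto)
  have "lft (tgt m) \<cdot> (relm m \<cdot> h) = base m \<cdot> (lft (src m) \<cdot> h)"
    by (rule square_extend[OF m(9)]) (use m(1-8) h(1-3) in auto)
  moreover have "rgt (tgt m) \<cdot> (relm m \<cdot> h) = base m \<cdot> (rgt (src m) \<cdot> h)"
    by (rule square_extend[OF m(10)]) (use m(1-8) h(1-3) in auto)
  ultimately show ?thesis using in_relI[of "relm m \<cdot> h" "tgt m"] m(1-8) h by simp
qed

lemma PreOrd_sim_mono:
  assumes "m \<in> Ar (PreOrd C)" "in_rel C (sim C (src m)) x y"
  shows "in_rel C (sim C (tgt m)) (base m \<cdot> x) (base m \<cdot> y)"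
  using assms PreOrd_mono[OF assms(1)] PreOrd_arrD(1,2)[OF assms(1)] by (simp add: in_rel_sim)

text \<open>The component on relations is determined by \<open>base\<close>, because the target
  relation is monic; equations in \<open>PreOrd C\<close> are therefore checked on underlying
  arrows.\<close>

lemma PreOrd_eqI:
  assumes "m \<in> Ar (PreOrd C)" "n \<in> Ar (PreOrd C)" "src m = src n" "tgt m = tgt n" "base m = base n"
  shows "m = n"
proof -
  note m = PreOrd_arrD[OF assms(1)] and n = PreOrd_arrD[OF assms(2)]
  have "relm m = relm n"
    by (rule relation_jointly_monic[of "tgt m"]) (use m n assms(3-5) in auto)
  then show ?thesis using assms(3-5) by (cases m, cases n) simp
qed

text \<open>Monotonicity at the generic related pair of \<open>X\<close> yields the component on
  relations.\<close>

lemma PreOrd_arrow_ex: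
  assumes "is_preorder C X" "is_preorder C Y" "f \<in> Ar C" "Dom C f = Car X" "Cod C f = Car Y"
    and mono: "\<And>x y. in_rel C X x y \<Longrightarrow> in_rel C Y (f \<cdot> x) (f \<cdot> y)"
  obtains m where "m \<in> Ar (PreOrd C)" "src m = X" "tgt m = Y" "base m = f"
proof -
  have "in_rel C Y (f \<cdot> lft X) (f \<cdot> rgt X)" by (rule mono[OF in_rel_lft_rgt]) (use assms in auto)
  then obtain h where "h \<in> Ar C" "Dom C h = Rel X" "Cod C h = Rel Y"
    "lft Y \<cdot> h = f \<cdot> lft X" "rgt Y \<cdot> h = f \<cdot> rgt X"
    by (rule in_relE) (use assms in auto)
  then have "\<lparr>src = X, tgt = Y, base = f, relm = h\<rparr> \<in> Ar (PreOrd C)"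
    using assms by (simp add: PreOrd_def Hom_iff)
  then show ?thesis by (rule that) simp_all
qed

lemma category_PreOrd: "category (PreOrd C)"
proof -
  have comp: "n \<cdot>\<^bsub>PreOrd C\<^esub> m \<in> Ar (PreOrd C)"
    if "m \<in> Ar (PreOrd C)" "n \<in> Ar (PreOrd C)" "tgt m = src n" for m n
  proof -
    note m = PreOrd_arrD[OF that(1)] and n = PreOrd_arrD[OF that(2)]
    \<comment> \<open>Stated for arbitrary legs so that it covers both \<open>lft\<close> and
      \<open>rgt\<close>.\<close>
    have *: "k \<cdot> (relm n \<cdot> relm m) = base n \<cdot> base m \<cdot> l"
      if kl: "k \<cdot> relm n = base n \<cdot> k'" "k' \<cdot> relm m = base m \<cdot> l"
        "k \<in> Ar C" "Dom C k = Rel (tgt n)" "k' \<in> Ar C" "Dom C k' = Rel (tgt m)" "Cod C k' = Car (tgt m)"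
        "l \<in> Ar C" "Dom C l = Rel (src m)" "Cod C l = Car (src m)" for k k' l
    proof -
      have "k \<cdot> (relm n \<cdot> relm m) = base n \<cdot> (k' \<cdot> relm m)"
        by (rule square_extend[OF kl(1)]) (use kl(3-) m(1-8) n(1-8) that(1) \<open>tgt m = src n\<close> in auto)
      then show ?thesis using kl m(1-8) n(1-8) \<open>tgt m = src n\<close> by simp
    qed
    have "lft (tgt n) \<cdot> (relm n \<cdot> relm m) = base n \<cdot> base m \<cdot> lft (src m)"
      by (rule *[OF n(9)]) (use m n that(3) in auto)
    moreover have "rgt (tgt n) \<cdot> (relm n \<cdot> relm m) = base n \<cdot> base m \<cdot> rgt (src m)"
      by (rule *[OF n(10)]) (use m n that(3) in auto)
    ultimately show ?thesis using m(1-8) n(1-8) that(3) by (simp add: PreOrd_def Hom_iff)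
  qed
  have id: "Id (PreOrd C) X \<in> Ar (PreOrd C)" if "is_preorder C X" for X
    using that by (simp add: PreOrd_def Hom_iff)
  show ?thesis
  proof
    show "Id (PreOrd C) X \<in> Hom (PreOrd C) X X" if "X \<in> Ob (PreOrd C)" for X
      using that by (simp add: Hom_def id)
    show "n \<cdot>\<^bsub>PreOrd C\<^esub> m \<in> Hom (PreOrd C) X Z"
      if "m \<in> Hom (PreOrd C) X Y" "n \<in> Hom (PreOrd C) Y Z" for m n X Y Z
      using that by (auto simp: Hom_def comp)
    show "m \<cdot>\<^bsub>PreOrd C\<^esub> Id (PreOrd C) X = m" if "m \<in> Hom (PreOrd C) X Y" for m X Y
      using that PreOrd_arrD[of m] by (intro PreOrd_eqI) (auto simp: Hom_def intro!: comp id)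
    show "Id (PreOrd C) Y \<cdot>\<^bsub>PreOrd C\<^esub> m = m" if "m \<in> Hom (PreOrd C) X Y" for m X Y
      using that PreOrd_arrD[of m] by (intro PreOrd_eqI) (auto simp: Hom_def intro!: comp id)
    show "k \<cdot>\<^bsub>PreOrd C\<^esub> n \<cdot>\<^bsub>PreOrd C\<^esub> m = k \<cdot>\<^bsub>PreOrd C\<^esub> (n \<cdot>\<^bsub>PreOrd C\<^esub> m)"
      if "m \<in> Hom (PreOrd C) W X" "n \<in> Hom (PreOrd C) X Y" "k \<in> Hom (PreOrd C) Y Z" for m n k W X Y Z
      using that PreOrd_arrD[of m] PreOrd_arrD[of n] PreOrd_arrD[of k]
      by (intro PreOrd_eqI) (auto simp: Hom_def intro!: comp)
  qed (use PreOrd_arrD in auto)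
qed

lemma ParOrd_simps [simp]:
  "X \<in> Ob (ParOrd C) \<longleftrightarrow> is_partial_order C X"
  "m \<in> Ar (ParOrd C) \<longleftrightarrow> m \<in> Ar (PreOrd C) \<and> is_partial_order C (src m) \<and> is_partial_order C (tgt m)"
  "Dom (ParOrd C) = src" "Cod (ParOrd C) = tgt"
  "n \<cdot>\<^bsub>ParOrd C\<^esub> m = n \<cdot>\<^bsub>PreOrd C\<^esub> m" "Id (ParOrd C) X = Id (PreOrd C) X"
proof -
  show "X \<in> Ob (ParOrd C) \<longleftrightarrow> is_partial_order C X"
    by (auto simp: ParOrd_def full_subcategory_def PreOrd_def is_partial_order_def)
qed (simp_all add: ParOrd_def full_subcategory_def PreOrd_def)

lemma category_ParOrd: "category (ParOrd C)"
proof -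
  interpret P: category "PreOrd C" by (rule category_PreOrd)
  have po: "is_partial_order C X \<Longrightarrow> is_preorder C X" for X by (simp add: is_partial_order_def)
  show ?thesis
  proof
    show "k \<cdot>\<^bsub>ParOrd C\<^esub> n \<cdot>\<^bsub>ParOrd C\<^esub> m = k \<cdot>\<^bsub>ParOrd C\<^esub> (n \<cdot>\<^bsub>ParOrd C\<^esub> m)"
      if "m \<in> Hom (ParOrd C) W X" "n \<in> Hom (ParOrd C) X Y" "k \<in> Hom (ParOrd C) Y Z" for m n k W X Y Z
      using that P.comp_assoc[of m n k] by (auto simp: Hom_def)
  qed (use P.id_arrow(1) P.comp_arrow(1) P.comp_id P.id_comp po in \<open>auto simp: Hom_def\<close>)
qed

text \<open>A cone over the cospan amounts to a pair of elements of \<open>Car (src m)\<close>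
  together with a witness that their images are related. A mediating arrow says that the pair is
  itself related, and is unique because the source relation is monic.\<close>

lemma fully_faithful_iff:
  assumes "m \<in> Ar (PreOrd C)"
  shows "fully_faithful C m \<longleftrightarrow>
    (\<forall>x y. x \<in> Ar C \<longrightarrow> y \<in> Ar C \<longrightarrow> Dom C x = Dom C y \<longrightarrow> Cod C x = Car (src m) \<longrightarrow>
      Cod C y = Car (src m) \<longrightarrow> in_rel C (tgt m) (base m \<cdot> x) (base m \<cdot> y) \<longrightarrow> in_rel C (src m) x y)"
    (is "_ \<longleftrightarrow> ?R")
proof -
  note m = PreOrd_arrD[OF assms]
  let ?X = "src m" and ?Y = "tgt m" and ?f = "base m"
  let ?A = "Car ?X"
  have eq_iff: "prod_map C ?f ?f \<cdot> h = rel_arrow C ?Y \<cdot> k \<longleftrightarrow>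
      ?f \<cdot> (prod1 C ?A ?A \<cdot> h) = lft ?Y \<cdot> k \<and> ?f \<cdot> (prod2 C ?A ?A \<cdot> h) = rgt ?Y \<cdot> k"
    if "h \<in> Ar C" "k \<in> Ar C" "Dom C k = Dom C h" "Cod C h = prod_ob C ?A ?A" "Cod C k = Rel ?Y" for h k
    unfolding rel_arrow_def
    by (subst prod_map_comp_eq_pairing_comp_iff) (use that m in auto)
  have pr: "prod1 C ?A ?A \<cdot> (rel_arrow C ?X \<cdot> h) = lft ?X \<cdot> h"
    "prod2 C ?A ?A \<cdot> (rel_arrow C ?X \<cdot> h) = rgt ?X \<cdot> h" if "h \<in> Ar C" "Cod C h = Rel ?X" for h
    using pairing_comp_eq_iff[of "lft ?X" "rgt ?X" h "rel_arrow C ?X \<cdot> h"] that m(1)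
    by (auto simp: rel_arrow_def)
  have pr': "prod1 C ?A ?A \<cdot> rel_arrow C ?X = lft ?X" "prod2 C ?A ?A \<cdot> rel_arrow C ?X = rgt ?X"
    using pairing_arrow(4,5)[of "lft ?X" "rgt ?X"] m(1) by (auto simp: rel_arrow_def)
  show ?thesis
  proof
    assume "fully_faithful C m"
    then have pb: "is_pullback C (prod_map C ?f ?f) (rel_arrow C ?Y) (rel_arrow C ?X) (relm m)"
      by (simp add: fully_faithful_def)
    show ?R
    proof (intro allI impI)
      fix x y assume xy: "x \<in> Ar C" "y \<in> Ar C" "Dom C x = Dom C y" "Cod C x = ?A" "Cod C y = ?A"
        and r: "in_rel C ?Y (?f \<cdot> x) (?f \<cdot> y)"
      obtain k where k: "k \<in> Ar C" "Dom C k = Dom C (?f \<cdot> x)" "Cod C k = Rel ?Y"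
        "lft ?Y \<cdot> k = ?f \<cdot> x" "rgt ?Y \<cdot> k = ?f \<cdot> y"
        by (rule in_relE[OF r]) (use m in auto)
      have p: "prod1 C ?A ?A \<cdot> pairing C x y = x" "prod2 C ?A ?A \<cdot> pairing C x y = y"
        using pairing_arrow(4,5)[of x y] xy by auto
      have eq: "prod_map C ?f ?f \<cdot> pairing C x y = rel_arrow C ?Y \<cdot> k"
        by (subst eq_iff) (use xy k p m(1-8) in auto)
      obtain h where h: "h \<in> Ar C" "Cod C h = Dom C (rel_arrow C ?X)" "rel_arrow C ?X \<cdot> h = pairing C x y"
        by (rule pullback_lift[OF pb _ _ _ _ _ eq]) (use xy k p m(1-8) in auto)
      then have "lft ?X \<cdot> h = x" "rgt ?X \<cdot> h = y" using pr[of h] p m(1) by auto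
      then show "in_rel C ?X x y" using in_relI[of h ?X] h m(1) by simp
    qed
  next
    assume R: ?R
    show "fully_faithful C m"
      unfolding fully_faithful_def
    proof (rule pullbackI)
      show "prod_map C ?f ?f \<cdot> rel_arrow C ?X = rel_arrow C ?Y \<cdot> relm m"
        by (subst eq_iff) (use m pr' in auto)
      fix u v assume uv: "u \<in> Ar C" "v \<in> Ar C" "Dom C u = Dom C v" "Cod C u = Dom C (prod_map C ?f ?f)"
        "Cod C v = Dom C (rel_arrow C ?Y)" "prod_map C ?f ?f \<cdot> u = rel_arrow C ?Y \<cdot> v"
      let ?x = "prod1 C ?A ?A \<cdot> u" and ?y = "prod2 C ?A ?A \<cdot> u"
      have uv': "Cod C u = prod_ob C ?A ?A" "Cod C v = Rel ?Y" "?f \<cdot> ?x = lft ?Y \<cdot> v" "?f \<cdot> ?y = rgt ?Y \<cdot> v"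
        using eq_iff[of u v] uv m by auto
      have "in_rel C ?Y (?f \<cdot> ?x) (?f \<cdot> ?y)" using in_relI[of v ?Y] uv uv' by simp
      then have "in_rel C ?X ?x ?y" using R[rule_format, of ?x ?y] uv(1,2) uv'(1) m(1) by simp
      then obtain h where h: "h \<in> Ar C" "Dom C h = Dom C u" "Cod C h = Rel ?X"
        "lft ?X \<cdot> h = ?x" "rgt ?X \<cdot> h = ?y"
        by (rule in_relE) (use uv uv' m(1) in auto)
      have "rel_arrow C ?X \<cdot> h = u"
        by (rule product_eqI[of _ _ ?A ?A]) (use pr[of h] h uv(1,2) uv'(1) m(1) in auto)
      moreover have "relm m \<cdot> h = v"
      proof (rule relation_jointly_monic[of ?Y])
        have "lft ?Y \<cdot> (relm m \<cdot> h) = ?f \<cdot> (lft ?X \<cdot> h)"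
          by (rule square_extend[OF m(9)]) (use m(1-8) h(1-3) in auto)
        then show "lft ?Y \<cdot> (relm m \<cdot> h) = lft ?Y \<cdot> v" using h(4) uv'(3) by simp
        have "rgt ?Y \<cdot> (relm m \<cdot> h) = ?f \<cdot> (rgt ?X \<cdot> h)"
          by (rule square_extend[OF m(10)]) (use m(1-8) h(1-3) in auto)
        then show "rgt ?Y \<cdot> (relm m \<cdot> h) = rgt ?Y \<cdot> v" using h(5) uv'(4) by simp
      qed (use m(1-8) h(1-3) uv(1-3) uv'(2) in auto)
      ultimately show "\<exists>h\<in>Hom C (Dom C u) (Dom C (rel_arrow C ?X)). rel_arrow C ?X \<cdot> h = u \<and> relm m \<cdot> h = v"
        using h m(1) by (auto simp: Hom_iff)
    next
      fix h k assume "h \<in> Ar C" "k \<in> Ar C" "Dom C h = Dom C k" "Cod C h = Dom C (rel_arrow C ?X)"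
        "Cod C k = Dom C (rel_arrow C ?X)" "rel_arrow C ?X \<cdot> h = rel_arrow C ?X \<cdot> k"
      then show "h = k"
        using monoD[of "rel_arrow C ?X" h k] m(1) by (simp add: is_preorder_def is_relation_def)
    qed (use m(1-8) in auto)
  qed
qed

end

section \<open>Discrete fibrations\<close>

text \<open>The discrete fibration condition at generalized elements, lifting from a given source.
  For symmetric relations, lifting from a given target is the same condition.\<close>

definition unique_lifting :: "('o, 'a) cat \<Rightarrow> ('o, 'a) irel \<Rightarrow> ('o, 'a) irel \<Rightarrow> 'a \<Rightarrow> bool" where
  "unique_lifting C X Y f \<longleftrightarrow> (\<forall>x y. x \<in> Ar C \<longrightarrow> Cod C x = Car X \<longrightarrow> in_rel C Y (f \<cdot>\<^bsub>C\<^esub> x) y \<longrightarrow>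
    (\<exists>!x'. in_rel C X x x' \<and> f \<cdot>\<^bsub>C\<^esub> x' = y))"

context finitely_complete_category
begin

text \<open>A cone over this cospan amounts to an element \<open>x\<close> of \<open>Car X\<close>
  with a related pair of \<open>Y\<close> starting at \<open>f \<cdot> x\<close>, that is, with an
  end \<open>y\<close> to be lifted. A mediating arrow is a related pair of \<open>X\<close>
  starting at \<open>x\<close>; it is determined by its end, which is the lift of
  \<open>y\<close>.\<close>

lemma lft_pullback_iff_unique_lifting:
  assumes X: "is_relation C X" and Y: "is_relation C Y"
    and f: "f \<in> Ar C" "Dom C f = Car X" "Cod C f = Car Y"
    and s: "s \<in> Ar C" "Dom C s = Rel X" "Cod C s = Rel Y"
    and sq: "lft Y \<cdot> s = f \<cdot> lft X" "rgt Y \<cdot> s = f \<cdot> rgt X"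
  shows "is_pullback C f (lft Y) (lft X) s \<longleftrightarrow> unique_lifting C X Y f"
proof -
  have sql: "lft Y \<cdot> (s \<cdot> h) = f \<cdot> (lft X \<cdot> h)" if "h \<in> Ar C" "Cod C h = Rel X" for h
    by (rule square_extend[OF sq(1)]) (use that X Y f s in auto)
  have sqr: "rgt Y \<cdot> (s \<cdot> h) = f \<cdot> (rgt X \<cdot> h)" if "h \<in> Ar C" "Cod C h = Rel X" for h
    by (rule square_extend[OF sq(2)]) (use that X Y f s in auto)
  show ?thesis
  proof
    assume pb: "is_pullback C f (lft Y) (lft X) s"
    show "unique_lifting C X Y f"
      unfolding unique_lifting_def
    proof (intro allI impI)
      fix x y assume x: "x \<in> Ar C" "Cod C x = Car X" and r: "in_rel C Y (f \<cdot> x) y"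
      obtain h where h: "h \<in> Ar C" "Dom C h = Dom C (f \<cdot> x)" "Cod C h = Rel Y"
        "lft Y \<cdot> h = f \<cdot> x" "rgt Y \<cdot> h = y"
        by (rule in_relE[OF r Y])
      obtain k where k: "k \<in> Ar C" "Dom C k = Dom C x" "Cod C k = Dom C (lft X)"
        "lft X \<cdot> k = x" "s \<cdot> k = h"
        by (rule pullback_lift[OF pb _ _ _ _ _ h(4)[symmetric]]) (use x h f Y in auto)
      show "\<exists>!x'. in_rel C X x x' \<and> f \<cdot> x' = y"
      proof (rule ex1I[of _ "rgt X \<cdot> k"])
        show "in_rel C X x (rgt X \<cdot> k) \<and> f \<cdot> (rgt X \<cdot> k) = y"
          using in_relI[of k X] sqr[of k] k h X by simp
        fix x' assume x': "in_rel C X x x' \<and> f \<cdot> x' = y"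
        then obtain l where l: "l \<in> Ar C" "Dom C l = Dom C x" "Cod C l = Rel X"
          "lft X \<cdot> l = x" "rgt X \<cdot> l = x'"
          using X by (meson in_relE)
        have "lft Y \<cdot> (s \<cdot> l) = lft Y \<cdot> h" "rgt Y \<cdot> (s \<cdot> l) = rgt Y \<cdot> h"
          using sql[OF l(1,3)] sqr[OF l(1,3)] l(4,5) h(4,5) x' by simp_all
        then have "s \<cdot> l = h"
          by (rule relation_jointly_monic[OF Y, rotated -2]) (use l(1-3) h(1-3) x s f in auto)
        then have "lft X \<cdot> l = lft X \<cdot> k" "s \<cdot> l = s \<cdot> k" using k(4,5) l(4) by simp_all
        then have "l = k"
          by (rule pullback_jointly_monic[OF pb, rotated -2]) (use k(1-3) l(1-3) X in auto)
        then show "x' = rgt X \<cdot> k" using l by simp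
      qed
    qed
  next
    assume U: "unique_lifting C X Y f"
    show "is_pullback C f (lft Y) (lft X) s"
    proof (rule pullbackI)
      fix x h assume h: "x \<in> Ar C" "h \<in> Ar C" "Dom C x = Dom C h" "Cod C x = Dom C f"
        "Cod C h = Dom C (lft Y)" "f \<cdot> x = lft Y \<cdot> h"
      then have "in_rel C Y (f \<cdot> x) (rgt Y \<cdot> h)" using in_relI[of h Y] Y by simp
      then obtain x' where x': "in_rel C X x x'" "f \<cdot> x' = rgt Y \<cdot> h"
        using U h f unfolding unique_lifting_def by metis
      obtain k where k: "k \<in> Ar C" "Dom C k = Dom C x" "Cod C k = Rel X" "lft X \<cdot> k = x" "rgt X \<cdot> k = x'"
        by (rule in_relE[OF x'(1) X])
      have "lft Y \<cdot> (s \<cdot> k) = lft Y \<cdot> h" "rgt Y \<cdot> (s \<cdot> k) = rgt Y \<cdot> h"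
        using sql[OF k(1,3)] sqr[OF k(1,3)] k(4,5) h(6) x' by simp_all
      then have "s \<cdot> k = h"
        by (rule relation_jointly_monic[OF Y, rotated -2]) (use k(1-3) h(1-5) s Y in auto)
      then show "\<exists>k\<in>Hom C (Dom C x) (Dom C (lft X)). lft X \<cdot> k = x \<and> s \<cdot> k = h"
        using k X by (auto simp: Hom_iff)
    next
      fix h k assume hk: "h \<in> Ar C" "k \<in> Ar C" "Dom C h = Dom C k" "Cod C h = Dom C (lft X)"
        "Cod C k = Dom C (lft X)" "lft X \<cdot> h = lft X \<cdot> k" "s \<cdot> h = s \<cdot> k"
      have hk': "Cod C h = Rel X" "Cod C k = Rel X" using hk X by auto
      \<comment> \<open>The pairs \<open>h\<close> and \<open>k\<close> have the same start, and
        their ends have the same image, so both ends are lifts of one element.\<close>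
      have eq: "f \<cdot> (rgt X \<cdot> h) = f \<cdot> (rgt X \<cdot> k)" using sqr[of h] sqr[of k] hk(1,2,7) hk' by simp
      have "in_rel C Y (f \<cdot> (lft X \<cdot> h)) (f \<cdot> (rgt X \<cdot> h))"
        using in_relI[of "s \<cdot> h" Y] sql[of h] sqr[of h] hk(1) hk' s by simp
      then have "\<exists>!x'. in_rel C X (lft X \<cdot> h) x' \<and> f \<cdot> x' = f \<cdot> (rgt X \<cdot> h)"
        using U hk(1) hk'(1) X unfolding unique_lifting_def by simp
      moreover have "in_rel C X (lft X \<cdot> h) (rgt X \<cdot> h)" "in_rel C X (lft X \<cdot> h) (rgt X \<cdot> k)"
        using in_relI[of h X] in_relI[of k X] hk hk' by auto
      ultimately have "rgt X \<cdot> h = rgt X \<cdot> k" using eq by auto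
      show "h = k" by (rule relation_jointly_monic[OF X]) (use hk hk' \<open>rgt X \<cdot> h = rgt X \<cdot> k\<close> in auto)
    qed (use X Y f s sq in auto)
  qed
qed

lemma sim_map:
  assumes "m \<in> Ar (PreOrd C)"
  shows "sim_map C m \<in> Ar C" "Dom C (sim_map C m) = Rel (sim C (src m))"
    "Cod C (sim_map C m) = Rel (sim C (tgt m))"
    "lft (sim C (tgt m)) \<cdot> sim_map C m = base m \<cdot> lft (sim C (src m))"
    "rgt (sim C (tgt m)) \<cdot> sim_map C m = base m \<cdot> rgt (sim C (src m))"
proof -
  note m = PreOrd_arrD[OF assms]
  let ?X = "src m" and ?Y = "tgt m" and ?f = "base m"
  define p q where pq: "p = pb1 C (rel_arrow C ?X) (rel_arrow C (op_rel ?X))"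
    "q = pb2 C (rel_arrow C ?X) (rel_arrow C (op_rel ?X))"
  define p' q' where pq': "p' = pb1 C (rel_arrow C ?Y) (rel_arrow C (op_rel ?Y))"
    "q' = pb2 C (rel_arrow C ?Y) (rel_arrow C (op_rel ?Y))"
  have pb: "is_pullback C (rel_arrow C ?X) (rel_arrow C (op_rel ?X)) p q"
    unfolding pq by (rule meet_rel_pullback) (use m in auto)
  have pb': "is_pullback C (rel_arrow C ?Y) (rel_arrow C (op_rel ?Y)) p' q'"
    unfolding pq' by (rule meet_rel_pullback) (use m in auto)
  note d = pullbackD[OF pb] and d' = pullbackD[OF pb']
  have sim: "Rel (sim C ?X) = Dom C p" "lft (sim C ?X) = lft ?X \<cdot> p" "rgt (sim C ?X) = rgt ?X \<cdot> p"
    "Rel (sim C ?Y) = Dom C p'" "lft (sim C ?Y) = lft ?Y \<cdot> p'" "rgt (sim C ?Y) = rgt ?Y \<cdot> p'"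
    by (simp_all add: sim_def meet_rel_def Let_def pq pq')
  \<comment> \<open>The second leg comes from the opposite relation, so the projections change
    places.\<close>
  have sq: "lft ?X \<cdot> p = rgt ?X \<cdot> q" "rgt ?X \<cdot> p = lft ?X \<cdot> q"
    using rel_arrow_comp_eq_iff[of ?X "op_rel ?X" p q] d m(1) by auto
  have l: "lft ?Y \<cdot> (relm m \<cdot> h) = ?f \<cdot> (lft ?X \<cdot> h)" if "h \<in> Ar C" "Cod C h = Rel ?X" for h
    by (rule square_extend[OF m(9)]) (use that m(1-8) in auto)
  have r: "rgt ?Y \<cdot> (relm m \<cdot> h) = ?f \<cdot> (rgt ?X \<cdot> h)" if "h \<in> Ar C" "Cod C h = Rel ?X" for h
    by (rule square_extend[OF m(10)]) (use that m(1-8) in auto)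
  have dX: "Cod C p = Rel ?X" "Cod C q = Rel ?X" and dY: "Cod C p' = Rel ?Y" "Cod C q' = Rel ?Y"
    using d d' m(1,2) by auto
  have eq: "rel_arrow C ?Y \<cdot> (relm m \<cdot> p) = rel_arrow C (op_rel ?Y) \<cdot> (relm m \<cdot> q)"
    by (subst rel_arrow_comp_eq_iff) (use l[of p] l[of q] r[of p] r[of q] sq d(3,4,7) dX m(1-8) in auto)
  have "\<exists>!h. h \<in> Hom C (Dom C p) (Dom C p') \<and> p' \<cdot> h = relm m \<cdot> p \<and> q' \<cdot> h = relm m \<cdot> q"
    by (rule pullback_ex1[OF pb' _ _ eq]) (use d(3,4,7) dX m(1-8) in \<open>auto simp: Hom_iff\<close>)
  from theI'[OF this]
  have s: "sim_map C m \<in> Hom C (Dom C p) (Dom C p')" "p' \<cdot> sim_map C m = relm m \<cdot> p"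
    by (simp_all add: sim_map_def Let_def pq pq' sim_def meet_rel_def)
  then show "sim_map C m \<in> Ar C" "Dom C (sim_map C m) = Rel (sim C ?X)"
    "Cod C (sim_map C m) = Rel (sim C ?Y)"
    by (auto simp: sim Hom_iff)
  show "lft (sim C ?Y) \<cdot> sim_map C m = ?f \<cdot> lft (sim C ?X)"
    using s l[of p] d(3) d'(3) dX dY m(1-8) by (simp add: sim Hom_iff)
  show "rgt (sim C ?Y) \<cdot> sim_map C m = ?f \<cdot> rgt (sim C ?X)"
    using s r[of p] d(3) d'(3) dX dY m(1-8) by (simp add: sim Hom_iff)
qed

text \<open>The square of second projections is the square of first projections for the opposite
  relations, and passing to opposites leaves the symmetric \<open>\<sim>\<close> with the same
  related pairs.\<close>

lemma sim_map_pullback_iff: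
  assumes "m \<in> Ar (PreOrd C)"
  shows sim_map_lft_pullback_iff:
    "is_pullback C (base m) (lft (sim C (tgt m))) (lft (sim C (src m))) (sim_map C m) \<longleftrightarrow>
      unique_lifting C (sim C (src m)) (sim C (tgt m)) (base m)"
    and sim_map_rgt_pullback_iff:
    "is_pullback C (base m) (rgt (sim C (tgt m))) (rgt (sim C (src m))) (sim_map C m) \<longleftrightarrow>
      unique_lifting C (sim C (src m)) (sim C (tgt m)) (base m)"
proof -
  let ?X = "sim C (src m)" and ?Y = "sim C (tgt m)"
  note m = PreOrd_arrD[OF assms] and s = sim_map[OF assms]
  show "is_pullback C (base m) (lft ?Y) (lft ?X) (sim_map C m) \<longleftrightarrow> unique_lifting C ?X ?Y (base m)"
    by (rule lft_pullback_iff_unique_lifting) (use m s in auto)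
  have "in_rel C (op_rel ?X) = in_rel C ?X" "in_rel C (op_rel ?Y) = in_rel C ?Y"
    using sim_sym[OF m(1)] sim_sym[OF m(2)] by (auto simp: fun_eq_iff)
  then have "unique_lifting C (op_rel ?X) (op_rel ?Y) (base m) \<longleftrightarrow> unique_lifting C ?X ?Y (base m)"
    by (simp add: unique_lifting_def)
  moreover have "is_pullback C (base m) (lft (op_rel ?Y)) (lft (op_rel ?X)) (sim_map C m) \<longleftrightarrow>
      unique_lifting C (op_rel ?X) (op_rel ?Y) (base m)"
    by (rule lft_pullback_iff_unique_lifting) (use m s in auto)
  ultimately show
    "is_pullback C (base m) (rgt ?Y) (rgt ?X) (sim_map C m) \<longleftrightarrow> unique_lifting C ?X ?Y (base m)"
    by simp
qed


section \<open>Pullbacks of preorders\<close>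

text \<open>Reflexivity makes every arrow into the underlying object monotone out of the discrete
  preorder on its domain, so the universal property in \<open>PreOrd C\<close> applies to arrows of
  \<open>C\<close>. Abstractly, discrete preorders are left adjoint to the underlying-object
  functor, which therefore preserves pullbacks; \<open>PreOrd_pullback_lift\<close> is the existence
  half.\<close>

lemma PreOrd_pullback_jointly_monic:
  assumes pb: "is_pullback (PreOrd C) g n p q"
    and w: "w \<in> Ar C" "w' \<in> Ar C" "Dom C w = Dom C w'" "Cod C w = Car (src p)" "Cod C w' = Car (src p)"
    and eq: "base p \<cdot> w = base p \<cdot> w'" "base q \<cdot> w = base q \<cdot> w'"
  shows "w = w'"
proof -
  interpret P: category "PreOrd C" by (rule category_PreOrd)
  note d = P.pullbackD[OF pb, simplified]
  note p = PreOrd_arrD[OF d(3)]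
  let ?T = "diag_rel C (Dom C w)"
  have T: "is_preorder C ?T" using w by (auto intro: preorder_diag)
  have mono: "in_rel C (src p) (v \<cdot> x) (v \<cdot> y)"
    if "in_rel C ?T x y" "v \<in> Ar C" "Dom C v = Dom C w" "Cod C v = Car (src p)" for v x y
    using that w by (auto simp: in_rel_diag intro!: preorder_refl p)
  obtain h where h: "h \<in> Ar (PreOrd C)" "src h = ?T" "tgt h = src p" "base h = w"
    by (rule PreOrd_arrow_ex[OF T p(1), of w]) (use w mono in auto)
  obtain k where k: "k \<in> Ar (PreOrd C)" "src k = ?T" "tgt k = src p" "base k = w'"
    by (rule PreOrd_arrow_ex[OF T p(1), of w']) (use w mono in auto)
  have "h = k"
  proof (rule P.pullback_jointly_monic[OF pb])
    show "p \<cdot>\<^bsub>PreOrd C\<^esub> h = p \<cdot>\<^bsub>PreOrd C\<^esub> k" "q \<cdot>\<^bsub>PreOrd C\<^esub> h = q \<cdot>\<^bsub>PreOrd C\<^esub> k"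
      using h k d eq by (auto intro!: PreOrd_eqI)
  qed (use h k in auto)
  then show ?thesis using h k by simp
qed

lemma PreOrd_pullback_lift:
  assumes pb: "is_pullback (PreOrd C) g n p q"
    and bd: "b \<in> Ar C" "d \<in> Ar C" "Dom C b = Dom C d" "Cod C b = Car (src g)" "Cod C d = Car (src n)"
    and eq: "base g \<cdot> b = base n \<cdot> d"
  obtains w where "w \<in> Ar C" "Dom C w = Dom C b" "Cod C w = Car (src p)" "base p \<cdot> w = b" "base q \<cdot> w = d"
proof -
  interpret P: category "PreOrd C" by (rule category_PreOrd)
  note pbD = P.pullbackD[OF pb, simplified]
  note g = PreOrd_arrD[OF pbD(1)] and n = PreOrd_arrD[OF pbD(2)]
  let ?T = "diag_rel C (Dom C b)"
  have T: "is_preorder C ?T" using bd by (auto intro: preorder_diag)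
  have mono: "in_rel C X (v \<cdot> x) (v \<cdot> y)"
    if "in_rel C ?T x y" "v \<in> Ar C" "Dom C v = Dom C b" "is_preorder C X" "Cod C v = Car X" for v x y X
    using that bd by (auto simp: in_rel_diag intro!: preorder_refl)
  obtain h where h: "h \<in> Ar (PreOrd C)" "src h = ?T" "tgt h = src g" "base h = b"
    by (rule PreOrd_arrow_ex[OF T g(1), of b]) (use bd g mono in auto)
  obtain k where k: "k \<in> Ar (PreOrd C)" "src k = ?T" "tgt k = src n" "base k = d"
    by (rule PreOrd_arrow_ex[OF T n(1), of d]) (use bd n mono in auto)
  have gh: "g \<cdot>\<^bsub>PreOrd C\<^esub> h = n \<cdot>\<^bsub>PreOrd C\<^esub> k"
    using h k pbD eq by (auto intro!: PreOrd_eqI)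
  obtain l where l: "l \<in> Ar (PreOrd C)" "src l = ?T" "tgt l = src p"
    "p \<cdot>\<^bsub>PreOrd C\<^esub> l = h" "q \<cdot>\<^bsub>PreOrd C\<^esub> l = k"
    by (rule P.pullback_lift[OF pb h(1) k(1) _ _ _ gh]) (use h k in auto)
  have "base p \<cdot> base l = b" "base q \<cdot> base l = d"
    using l(4,5) h(4) k(4) PreOrd_simps(6) by metis+
  then show ?thesis using that[of "base l"] PreOrd_arrD[OF l(1)] l(2,3) by simp
qed

text \<open>The relation on a pullback is compared with the intersection of the two inverse images, which
  is a preorder with the same underlying object and again a cone over the cospan.\<close>

lemma PreOrd_pullback_in_rel:
  assumes pb: "is_pullback (PreOrd C) g n p q"
    and x: "x \<in> Ar C" "y \<in> Ar C" "Dom C x = Dom C y" "Cod C x = Car (src p)" "Cod C y = Car (src p)"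
    and r: "in_rel C (tgt p) (base p \<cdot> x) (base p \<cdot> y)" "in_rel C (tgt q) (base q \<cdot> x) (base q \<cdot> y)"
  shows "in_rel C (src p) x y"
proof -
  interpret P: category "PreOrd C" by (rule category_PreOrd)
  note d = P.pullbackD[OF pb, simplified]
  note p = PreOrd_arrD[OF d(3)] and q = PreOrd_arrD[OF d(4)]
  let ?p = "inv_rel C (base p) (tgt p)" and ?q = "inv_rel C (base q) (tgt q)"
  let ?W = "meet_rel C ?p ?q"
  have pq: "is_preorder C ?p" "is_preorder C ?q" "Car ?p = Car (src p)" "Car ?q = Car (src p)"
    using p(2,3,4,5) q(2,3,4,5) d(7) by (auto intro: preorder_inv_rel simp: Car_inv_rel)
  have W: "is_preorder C ?W" "Car ?W = Car (src p)"
    using pq by (auto intro: preorder_meet simp: Car_meet_rel)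
  have in_W: "in_rel C ?W u v \<longleftrightarrow> in_rel C ?p u v \<and> in_rel C ?q u v" for u v
    by (rule in_rel_meet) (use pq in auto)
  have in_p: "in_rel C ?p u v \<longleftrightarrow> u \<in> Ar C \<and> v \<in> Ar C \<and> Dom C u = Dom C v \<and>
      Cod C u = Car (src p) \<and> Cod C v = Car (src p) \<and> in_rel C (tgt p) (base p \<cdot> u) (base p \<cdot> v)" for u v
    using in_rel_inv_rel[of "tgt p" "base p" u v] p by simp
  have in_q: "in_rel C ?q u v \<longleftrightarrow> u \<in> Ar C \<and> v \<in> Ar C \<and> Dom C u = Dom C v \<and>
      Cod C u = Car (src p) \<and> Cod C v = Car (src p) \<and> in_rel C (tgt q) (base q \<cdot> u) (base q \<cdot> v)" for u v
    using in_rel_inv_rel[of "tgt q" "base q" u v] q d(7) by simp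
  obtain h where h: "h \<in> Ar (PreOrd C)" "src h = ?W" "tgt h = tgt p" "base h = base p"
    by (rule PreOrd_arrow_ex[OF W(1) p(2), of "base p"]) (use W p in_W in_p in auto)
  obtain k where k: "k \<in> Ar (PreOrd C)" "src k = ?W" "tgt k = tgt q" "base k = base q"
    by (rule PreOrd_arrow_ex[OF W(1) q(2), of "base q"]) (use W q d(7) in_W in_q in auto)
  have "base g \<cdot> base p = base n \<cdot> base q" using d(9) PreOrd_simps(6) by metis
  then have gh: "g \<cdot>\<^bsub>PreOrd C\<^esub> h = n \<cdot>\<^bsub>PreOrd C\<^esub> k"
    using h k d by (auto intro!: PreOrd_eqI)
  obtain l where l: "l \<in> Ar (PreOrd C)" "src l = ?W" "tgt l = src p"
    "p \<cdot>\<^bsub>PreOrd C\<^esub> l = h" "q \<cdot>\<^bsub>PreOrd C\<^esub> l = k"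
    by (rule P.pullback_lift[OF pb h(1) k(1) _ _ _ gh]) (use h k d in auto)
  have bl: "base p \<cdot> base l = base p" "base q \<cdot> base l = base q"
    using l(4,5) h(4) k(4) PreOrd_simps(6) by metis+
  \<comment> \<open>\<open>l\<close> lies over the identity, so its monotonicity says that the test
    relation \<open>?W\<close> is contained in the relation of the vertex.\<close>
  have "base l = Id C (Car (src p))"
    by (rule PreOrd_pullback_jointly_monic[OF pb])
      (use PreOrd_arrD[OF l(1)] l(2,3) W bl p q d(7) in auto)
  moreover have "in_rel C ?W x y" using in_W in_p in_q x r by simp
  ultimately show ?thesis using PreOrd_mono[OF l(1), of x y] l(2,3) x by simp
qed

lemma class_M_unique_lifting:
  assumes "m \<in> class_M C"
  shows "m \<in> Ar (PreOrd C) \<and> unique_lifting C (sim C (src m)) (sim C (tgt m)) (base m)"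
  using assms unfolding class_M_def
proof (induction rule: pullback_closure.induct)
  case (incl m)
  then have m: "m \<in> Ar (PreOrd C)" "is_partial_order C (src m)" "is_partial_order C (tgt m)" by simp_all
  note mD = PreOrd_arrD[OF m(1)]
  have eq: "in_rel C (sim C (src m)) x y \<Longrightarrow> x = y" "in_rel C (sim C (tgt m)) x y \<Longrightarrow> x = y" for x y
    using m mD by (auto simp: partial_order_iff in_rel_sim)
  have "unique_lifting C (sim C (src m)) (sim C (tgt m)) (base m)"
    unfolding unique_lifting_def
  proof (intro allI impI)
    fix x y assume "x \<in> Ar C" "Cod C x = Car (sim C (src m))" "in_rel C (sim C (tgt m)) (base m \<cdot> x) y"
    \<comment> \<open>Both relations are equality here, so \<open>x\<close> is the only candidate
      and \<open>y\<close> is its image.\<close>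
    then show "\<exists>!x'. in_rel C (sim C (src m)) x x' \<and> base m \<cdot> x' = y"
      using eq mD by (intro ex1I[of _ x]) (auto intro: sim_refl)
  qed
  then show ?case using m by simp
next
  case (pullback n g p q)
  interpret P: category "PreOrd C" by (rule category_PreOrd)
  note pb = pullback.hyps(2)
  note d = P.pullbackD[OF pb, simplified]
  note p = PreOrd_arrD[OF d(3)] and q = PreOrd_arrD[OF d(4)] and g = PreOrd_arrD[OF d(1)]
    and n = PreOrd_arrD[OF d(2)]
  have sq: "base g \<cdot> base p = base n \<cdot> base q" using d(9) PreOrd_simps(6) by metis
  have sq': "base g \<cdot> (base p \<cdot> x) = base n \<cdot> (base q \<cdot> x)" if "x \<in> Ar C" "Cod C x = Car (src p)" for x
    by (rule square_extend[OF sq]) (use that p(3-5) q(3-5) g(3-5) n(3-5) d(5-8) in auto)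
  have "unique_lifting C (sim C (src p)) (sim C (tgt p)) (base p)"
    unfolding unique_lifting_def
  proof (intro allI impI)
    fix w b assume w: "w \<in> Ar C" "Cod C w = Car (sim C (src p))"
      and r: "in_rel C (sim C (tgt p)) (base p \<cdot> w) b"
    have w': "Cod C w = Car (src p)" using w p by simp
    have b: "b \<in> Ar C" "Dom C b = Dom C w" "Cod C b = Car (tgt p)"
      using in_relD[OF r] p(2-5) w w' by auto
    \<comment> \<open>The pair to be lifted is pushed along \<open>g\<close> and lifted along
      \<open>n\<close> from \<open>base q \<cdot> w\<close>; the resulting \<open>y\<close> and the
      given \<open>b\<close> agree over the cospan and glue to an element \<open>v\<close> of the
      vertex.\<close>
    have "in_rel C (sim C (tgt n)) (base n \<cdot> (base q \<cdot> w)) (base g \<cdot> b)"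
      using PreOrd_sim_mono[OF d(1), of "base p \<cdot> w" b] r sq'[OF w(1) w'] d(5,6) by simp
    then have lift: "\<exists>!y. in_rel C (sim C (src n)) (base q \<cdot> w) y \<and> base n \<cdot> y = base g \<cdot> b"
      using pullback.IH w w' q(3-5) d(5-8) n unfolding unique_lifting_def by simp
    then obtain y where y: "in_rel C (sim C (src n)) (base q \<cdot> w) y" "base n \<cdot> y = base g \<cdot> b"
      by blast
    have yD: "y \<in> Ar C" "Dom C y = Dom C w" "Cod C y = Car (src n)"
      using in_relD[OF y(1)] n(1) q(3-5) w w' d by auto
    obtain v where v: "v \<in> Ar C" "Dom C v = Dom C b" "Cod C v = Car (src p)" "base p \<cdot> v = b" "base q \<cdot> v = y"
      by (rule PreOrd_pullback_lift[OF pb b(1) yD(1) _ _ _ y(2)[symmetric]])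
        (use b yD d in auto)
    show "\<exists>!v. in_rel C (sim C (src p)) w v \<and> base p \<cdot> v = b"
    proof (rule ex1I[of _ v])
      have rp: "in_rel C (tgt p) (base p \<cdot> w) (base p \<cdot> v)" "in_rel C (tgt p) (base p \<cdot> v) (base p \<cdot> w)"
        using r v(4) p by (auto simp: in_rel_sim)
      have rq: "in_rel C (tgt q) (base q \<cdot> w) (base q \<cdot> v)" "in_rel C (tgt q) (base q \<cdot> v) (base q \<cdot> w)"
        using y(1) v(5) n d(8) by (auto simp: in_rel_sim)
      \<comment> \<open>Relatedness in the vertex is tested on the two legs, in both directions for
        \<open>\<sim>\<close>.\<close>
      have "in_rel C (src p) w v"
        by (rule PreOrd_pullback_in_rel[OF pb]) (use w w' v b rp rq in auto)
      moreover have "in_rel C (src p) v w"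
        by (rule PreOrd_pullback_in_rel[OF pb]) (use w w' v b rp rq in auto)
      ultimately show "in_rel C (sim C (src p)) w v \<and> base p \<cdot> v = b"
        using v p by (simp add: in_rel_sim)
      fix v' assume v': "in_rel C (sim C (src p)) w v' \<and> base p \<cdot> v' = b"
      have v'D: "v' \<in> Ar C" "Dom C v' = Dom C w" "Cod C v' = Car (src p)"
        using in_relD[of "sim C (src p)" w v'] v' p(1) by auto
      \<comment> \<open>A competing lift \<open>v'\<close> is sent by \<open>q\<close> to a lift
        along \<open>n\<close> of the same element from the same source, hence to
        \<open>y\<close>.\<close>
      have "in_rel C (sim C (src n)) (base q \<cdot> w) (base q \<cdot> v')"
        using PreOrd_sim_mono[OF d(4), of w v'] v' d(7,8) by simp
      moreover have "base n \<cdot> (base q \<cdot> v') = base g \<cdot> b" using sq'[of v'] v' v'D by simp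
      ultimately have "base q \<cdot> v' = y" using lift y by blast
      then have "base p \<cdot> v' = base p \<cdot> v" "base q \<cdot> v' = base q \<cdot> v" using v v' by simp_all
      then show "v' = v"
        by (rule PreOrd_pullback_jointly_monic[OF pb, rotated -2]) (use v(1-3) v'D b in auto)
    qed
  qed
  then show ?case using d by simp
qed

end

sublocale exact_category \<subseteq> finitely_complete_category
  by unfold_locales (rule complete)

text \<open>The order on the target is pinned down by full faithfulness rather than given as a
  regular image: in an exact category \<open>base n\<close> is a regular epimorphism, so an order
  that it both preserves and reflects is determined. The factorization property is derived from this
  in \<open>reflection_factor\<close>.\<close>

definition is_reflection :: "('o, 'a) cat \<Rightarrow> ('o, 'a) rel_mor \<Rightarrow> bool" where
  "is_reflection C n \<longleftrightarrow> n \<in> Ar (PreOrd C) \<and> is_partial_order C (tgt n) \<and>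
    base n = quot C (src n) \<and> fully_faithful C n"

context exact_category
begin


section \<open>Regular epimorphisms in an exact category\<close>

text \<open>Factor the composite as a monomorphism \<open>i\<close> after a regular epimorphism.
  Filling in against \<open>d\<close> gives \<open>k\<close> with \<open>i \<cdot> k = e\<close>,
  then filling in against \<open>e\<close> gives a section of \<open>i\<close>; a monomorphism with
  a section is invertible.\<close>

lemma regular_epi_comp:
  assumes d: "regular_epi C d" and e: "regular_epi C e" and t: "Cod C d = Dom C e"
  shows "regular_epi C (e \<cdot> d)"
proof -
  note ar = regular_epi_arrow[OF d] regular_epi_arrow[OF e]
  obtain r i where r: "regular_epi C r" and i: "is_mono C i" and ri: "Cod C r = Dom C i" "e \<cdot> d = i \<cdot> r"
    using factorization[of "e \<cdot> d"] ar t by auto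
  have i_ar: "i \<in> Ar C" using i by (simp add: is_mono_def)
  note r_ar = regular_epi_arrow[OF r]
  have dom: "Dom C r = Dom C d" "Cod C i = Cod C e"
    using comp_arrow(2,3)[of r i] comp_arrow(2,3)[of d e] r_ar i_ar ri ar t by simp_all
  obtain k where k: "k \<in> Ar C" "Dom C k = Dom C e" "Cod C k = Dom C i" "i \<cdot> k = e"
    by (rule regular_epi_mono_fill[OF d i r_ar ar(2)]) (use ri dom t in auto)
  obtain s where s: "s \<in> Ar C" "Dom C s = Cod C e" "Cod C s = Dom C i" "i \<cdot> s = Id C (Cod C e)"
    by (rule regular_epi_mono_fill[OF e i k(1), of "Id C (Cod C e)"]) (use k ar dom in auto)
  have si: "s \<cdot> i = Id C (Dom C i)"
  proof (rule monoD[OF i])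
    have "i \<cdot> (s \<cdot> i) = Id C (Cod C e) \<cdot> i" by (rule comp_eq_extend) (use s i_ar dom in auto)
    then show "i \<cdot> (s \<cdot> i) = i \<cdot> Id C (Dom C i)" using i_ar dom by simp
  qed (use s i_ar dom in auto)
  have "is_iso C i" by (rule isoI[of i s]) (use s si i_ar dom in auto)
  then show ?thesis using iso_comp_regular_epi[OF _ r ri(1)] ri(2) by simp
qed

text \<open>The cover is the pullback of \<open>e\<close> along \<open>u\<close>, a regular
  epimorphism by stability; the other leg is the lift.\<close>

lemma regular_epi_lift:
  assumes "regular_epi C e" "u \<in> Ar C" "Cod C u = Cod C e"
  obtains c x where "regular_epi C c" "c \<in> Ar C" "Cod C c = Dom C u"
    "x \<in> Ar C" "Dom C x = Dom C c" "Cod C x = Dom C e" "e \<cdot> x = u \<cdot> c"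
proof -
  have pb: "is_pullback C u e (pb1 C u e) (pb2 C u e)"
    by (rule pb_cone_pullback) (use assms regular_epi_arrow in auto)
  note d = pullbackD[OF pb]
  show thesis
    by (rule that[of "pb1 C u e" "pb2 C u e"]) (use regular_epi_stable[OF pb assms(1)] d in auto)
qed

text \<open>The second element is lifted over a refinement of the cover used for the first, so the
  common cover is a composite of two regular epimorphisms.\<close>

lemma regular_epi_lift2:
  assumes e: "regular_epi C e" and u: "u \<in> Ar C" "Cod C u = Cod C e"
    and v: "v \<in> Ar C" "Cod C v = Cod C e" "Dom C v = Dom C u"
  obtains c x y where "regular_epi C c" "c \<in> Ar C" "Cod C c = Dom C u"
    "x \<in> Ar C" "Dom C x = Dom C c" "Cod C x = Dom C e" "e \<cdot> x = u \<cdot> c"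
    "y \<in> Ar C" "Dom C y = Dom C c" "Cod C y = Dom C e" "e \<cdot> y = v \<cdot> c"
proof -
  obtain c x where c: "regular_epi C c" "c \<in> Ar C" "Cod C c = Dom C u"
    "x \<in> Ar C" "Dom C x = Dom C c" "Cod C x = Dom C e" "e \<cdot> x = u \<cdot> c"
    by (rule regular_epi_lift[OF e u])
  obtain d y where d: "regular_epi C d" "d \<in> Ar C" "Cod C d = Dom C (v \<cdot> c)"
    "y \<in> Ar C" "Dom C y = Dom C d" "Cod C y = Dom C e" "e \<cdot> y = v \<cdot> c \<cdot> d"
    by (rule regular_epi_lift[OF e, of "v \<cdot> c"]) (use c v in auto)
  have dc: "Cod C d = Dom C c" using d c v by simp
  show thesis
  proof (rule that)
    show "regular_epi C (c \<cdot> d)" by (rule regular_epi_comp[OF d(1) c(1) dc])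
    have "e \<cdot> (x \<cdot> d) = u \<cdot> (c \<cdot> d)"
      by (rule square_extend[OF c(7)]) (use c(1-6) d(2) dc u regular_epi_arrow[OF e] in auto)
    then show "e \<cdot> (x \<cdot> d) = u \<cdot> (c \<cdot> d)" .
    show "e \<cdot> y = v \<cdot> (c \<cdot> d)" using d(2,7) dc c(2,3) v by simp
  qed (use c(2-6) d(2-6) dc in auto)
qed


section \<open>The quotient and the reflection of a preorder\<close>

text \<open>Effectiveness yields only some arrow \<open>k\<close> with kernel pair
  \<open>\<sim>\<close>. Its regular epimorphic part \<open>e\<close> identifies the two projections
  of \<open>\<sim>\<close> because \<open>i\<close> is monic, and any arrow respecting
  \<open>\<sim>\<close> respects the pair that \<open>e\<close> coequalizes; so \<open>e\<close>
  shows that the choice in \<open>quot\<close> is possible.\<close>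

lemma quot_kernel:
  assumes X: "is_preorder C X"
  shows quot_coequalizer: "is_coequalizer C (lft (sim C X)) (rgt (sim C X)) (quot C X)"
    and quot_eq_iff: "x \<in> Ar C \<Longrightarrow> y \<in> Ar C \<Longrightarrow> Dom C x = Dom C y \<Longrightarrow> Cod C x = Car X \<Longrightarrow>
      Cod C y = Car X \<Longrightarrow> quot C X \<cdot> x = quot C X \<cdot> y \<longleftrightarrow> in_rel C (sim C X) x y"
proof -
  let ?S = "sim C X"
  have S: "is_relation C ?S" "Car ?S = Car X" using X by auto
  obtain k where k: "k \<in> Ar C" "Dom C k = Car X" and pb: "is_pullback C k k (lft ?S) (rgt ?S)"
    using effective[OF sim_equivalence[OF X]] S unfolding is_kernel_pair_def by auto
  obtain e i where e: "regular_epi C e" and i: "is_mono C i" and ei: "Cod C e = Dom C i" "k = i \<cdot> e"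
    using factorization[OF k(1)] by auto
  have ar: "e \<in> Ar C" "i \<in> Ar C" using regular_epi_arrow[OF e] i by (auto simp: is_mono_def)
  have e_dom: "Dom C e = Car X" using k(2) ei ar by simp
  have el: "e \<cdot> lft ?S = e \<cdot> rgt ?S"
    by (rule monoD[OF i]) (use pullbackD(9)[OF pb] S ei ar e_dom in auto)
  obtain u v where uv: "is_coequalizer C u v e" using e unfolding regular_epi_def by blast
  note d = coequalizerD[OF uv]
  have "k \<cdot> u = i \<cdot> (e \<cdot> u)" "k \<cdot> v = i \<cdot> (e \<cdot> v)" using ei ar d by auto
  then have kuv: "k \<cdot> u = k \<cdot> v" using d(7) by simp
  \<comment> \<open>The pair coequalized by \<open>e\<close> is identified by \<open>k\<close>, that
    is, factors through \<open>\<sim>\<close>.\<close>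
  obtain h where h: "h \<in> Ar C" "Dom C h = Dom C u" "Cod C h = Dom C (lft ?S)" "lft ?S \<cdot> h = u" "rgt ?S \<cdot> h = v"
    by (rule pullback_lift[OF pb _ _ _ _ _ kuv]) (use d(1-6) e_dom k in auto)
  have "\<exists>!l. l \<in> Hom C (Cod C e) Z \<and> l \<cdot> e = g"
    if g: "g \<in> Hom C (Car X) Z" "g \<cdot> lft ?S = g \<cdot> rgt ?S" for g Z
  proof (rule coequalizer_ex1[OF uv])
    show "g \<in> Hom C (Cod C u) Z" using g(1) d(6) e_dom by simp
    have "g \<cdot> (lft ?S \<cdot> h) = g \<cdot> (rgt ?S \<cdot> h)"
      by (rule square_extend[OF g(2)]) (use g(1) h(1-3) S in \<open>auto simp: Hom_iff\<close>)
    then show "g \<cdot> u = g \<cdot> v" using h by simp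
  qed
  then have "is_coequalizer C (lft ?S) (rgt ?S) e"
    unfolding is_coequalizer_def using S ar e_dom el by (auto simp: Hom_iff)
  then show co: "is_coequalizer C (lft ?S) (rgt ?S) (quot C X)"
    unfolding quot_def by (rule someI)
  note q = coequalizerD[OF co]
  \<comment> \<open>Since \<open>k\<close> factors through the quotient map, the latter identifies
    no more than \<open>k\<close> does, which is \<open>\<sim>\<close>.\<close>
  obtain l where l: "l \<in> Ar C" "Dom C l = Cod C (quot C X)" "l \<cdot> quot C X = k"
    using coequalizer_factor[OF co k(1)] pullbackD(9)[OF pb] k S by auto
  assume xy: "x \<in> Ar C" "y \<in> Ar C" "Dom C x = Dom C y" "Cod C x = Car X" "Cod C y = Car X"
  have q_dom: "Dom C (quot C X) = Car X" using q(6) S by simp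
  show "quot C X \<cdot> x = quot C X \<cdot> y \<longleftrightarrow> in_rel C ?S x y"
  proof
    assume eq: "quot C X \<cdot> x = quot C X \<cdot> y"
    have "l \<cdot> (quot C X \<cdot> x) = k \<cdot> x" "l \<cdot> (quot C X \<cdot> y) = k \<cdot> y"
      by (rule comp_eq_extend; use l xy q(3) q_dom in auto)+
    then have kxy: "k \<cdot> x = k \<cdot> y" using eq by simp
    obtain w where "w \<in> Ar C" "Dom C w = Dom C x" "Cod C w = Dom C (lft ?S)" "lft ?S \<cdot> w = x" "rgt ?S \<cdot> w = y"
      by (rule pullback_lift[OF pb _ _ _ _ _ kxy]) (use xy k in auto)
    then show "in_rel C ?S x y" using in_relI[of w ?S] S by auto
  next
    assume "in_rel C ?S x y"
    then obtain w where w: "w \<in> Ar C" "Cod C w = Rel ?S" "lft ?S \<cdot> w = x" "rgt ?S \<cdot> w = y"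
      using in_relE[OF _ S(1)] by metis
    have "quot C X \<cdot> (lft ?S \<cdot> w) = quot C X \<cdot> (rgt ?S \<cdot> w)"
      by (rule square_extend[OF q(7)]) (use w(1,2) q(1-6) S in auto)
    then show "quot C X \<cdot> x = quot C X \<cdot> y" using w by simp
  qed
qed

lemma quot_arrow:
  assumes "is_preorder C X"
  shows "regular_epi C (quot C X)" "quot C X \<in> Ar C" "Dom C (quot C X) = Car X" "Cod C (quot C X) \<in> Ob C"
proof -
  have S: "is_relation C (sim C X)" "Car (sim C X) = Car X" using assms by auto
  show "regular_epi C (quot C X)"
    unfolding regular_epi_def using quot_coequalizer[OF assms] by blast
  then show "quot C X \<in> Ar C" by (rule regular_epi_arrow)
  then show "Cod C (quot C X) \<in> Ob C" by simp
  show "Dom C (quot C X) = Car X" using coequalizerD(6)[OF quot_coequalizer[OF assms]] S by simp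
qed

text \<open>The order \<open>P\<close> on the quotient is the image of \<open>X\<close>, taken from
  the factorization of \<open>f\<close>. Transitivity and antisymmetry of \<open>P\<close> rest on
  the fact, proved as \<open>reflect\<close>, that the quotient map reflects the order.\<close>

lemma reflection_ex:
  assumes X: "is_preorder C X"
  obtains n where "is_reflection C n" "src n = X"
proof -
  let ?q = "quot C X"
  let ?Q = "Cod C ?q"
  note q = quot_arrow[OF X]
  have rel: "is_relation C X" using X by simp
  define f where "f = pairing C (?q \<cdot> lft X) (?q \<cdot> rgt X)"
  have f: "f \<in> Ar C" "Dom C f = Rel X" "Cod C f = prod_ob C ?Q ?Q"
    "prod1 C ?Q ?Q \<cdot> f = ?q \<cdot> lft X" "prod2 C ?Q ?Q \<cdot> f = ?q \<cdot> rgt X"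
    using pairing_arrow[of "?q \<cdot> lft X" "?q \<cdot> rgt X"] rel q by (auto simp: f_def)
  obtain e i where e: "regular_epi C e" and i: "is_mono C i" and ei: "Cod C e = Dom C i" "f = i \<cdot> e"
    using factorization[OF f(1)] by auto
  have ar: "e \<in> Ar C" "i \<in> Ar C" using regular_epi_arrow[OF e] i by (auto simp: is_mono_def)
  have dom: "Dom C e = Rel X" "Cod C i = prod_ob C ?Q ?Q" using f(2,3) ei ar by auto
  define P where "P = \<lparr>Car = ?Q, Rel = Dom C i, lft = prod1 C ?Q ?Q \<cdot> i, rgt = prod2 C ?Q ?Q \<cdot> i\<rparr>"
  have P: "Car P = ?Q" "Rel P = Dom C i" "lft P = prod1 C ?Q ?Q \<cdot> i" "rgt P = prod2 C ?Q ?Q \<cdot> i"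
    by (simp_all add: P_def)
  have Pe: "lft P \<cdot> e = ?q \<cdot> lft X" "rgt P \<cdot> e = ?q \<cdot> rgt X"
    using f(4,5) ei ar dom q(4) by (auto simp: P)
  have relP: "is_relation C P"
  proof (rule relationI)
    fix h k assume hk: "h \<in> Ar C" "k \<in> Ar C" "Cod C h = Rel P" "Cod C k = Rel P" "Dom C h = Dom C k"
      and eq: "lft P \<cdot> h = lft P \<cdot> k" "rgt P \<cdot> h = rgt P \<cdot> k"
    show "h = k"
    proof (rule monoD[OF i])
      show "i \<cdot> h = i \<cdot> k"
        by (rule product_eqI[of _ _ ?Q ?Q]) (use hk eq ar dom q(4) in \<open>auto simp: P\<close>)
    qed (use hk in \<open>auto simp: P\<close>)
  qed (use ar dom q(4) in \<open>auto simp: P\<close>)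
  have in_P: "in_rel C P (?q \<cdot> x) (?q \<cdot> y)" if xy: "in_rel C X x y" for x y
  proof -
    obtain h where h: "h \<in> Ar C" "Dom C h = Dom C x" "Cod C h = Rel X" "lft X \<cdot> h = x" "rgt X \<cdot> h = y"
      by (rule in_relE[OF xy rel])
    have "lft P \<cdot> (e \<cdot> h) = ?q \<cdot> (lft X \<cdot> h)"
      by (rule square_extend[OF Pe(1)]) (use h(1,3) ar ei dom q rel relP P(2) in auto)
    moreover have "rgt P \<cdot> (e \<cdot> h) = ?q \<cdot> (rgt X \<cdot> h)"
      by (rule square_extend[OF Pe(2)]) (use h(1,3) ar ei dom q rel relP P(2) in auto)
    ultimately show ?thesis using in_relI[of "e \<cdot> h" P] h ar ei dom P(2) by simp
  qed
  \<comment> \<open>A witness for the images lifts, over a cover, to a related pair of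
    \<open>X\<close>. Its ends have the same classes as \<open>x\<close> and \<open>y\<close>, so
    they are equivalent to them under \<open>\<sim>\<close>; transitivity relates \<open>x\<close>
    to \<open>y\<close> over the cover, and membership descends.\<close>
  have reflect: "in_rel C X x y"
    if xy: "x \<in> Ar C" "y \<in> Ar C" "Dom C x = Dom C y" "Cod C x = Car X" "Cod C y = Car X"
      and r: "in_rel C P (?q \<cdot> x) (?q \<cdot> y)" for x y
  proof -
    obtain h where h: "h \<in> Ar C" "Dom C h = Dom C (?q \<cdot> x)" "Cod C h = Rel P"
      "lft P \<cdot> h = ?q \<cdot> x" "rgt P \<cdot> h = ?q \<cdot> y"
      by (rule in_relE[OF r relP])
    have h_dom: "Dom C h = Dom C x" using h(2) xy q by simp
    obtain c w where c: "regular_epi C c" "c \<in> Ar C" "Cod C c = Dom C h"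
      "w \<in> Ar C" "Dom C w = Dom C c" "Cod C w = Dom C e" "e \<cdot> w = h \<cdot> c"
      by (rule regular_epi_lift[OF e h(1)]) (use h(3) P(2) ei in auto)
    have wX: "Cod C w = Rel X" using c(6) dom by simp
    have "?q \<cdot> (lft X \<cdot> w) = lft P \<cdot> (e \<cdot> w)" "?q \<cdot> (rgt X \<cdot> w) = rgt P \<cdot> (e \<cdot> w)"
      by (rule square_extend[OF Pe(1)[symmetric]] square_extend[OF Pe(2)[symmetric]];
          use c(4) wX ar ei dom q rel relP P(2) in auto)+
    moreover have "lft P \<cdot> (h \<cdot> c) = ?q \<cdot> (x \<cdot> c)" "rgt P \<cdot> (h \<cdot> c) = ?q \<cdot> (y \<cdot> c)"
      by (rule square_extend[OF h(4)] square_extend[OF h(5)];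
          use c(2,3) h(1,3) h_dom xy q relP in auto)+
    ultimately have eq: "?q \<cdot> (lft X \<cdot> w) = ?q \<cdot> (x \<cdot> c)" "?q \<cdot> (rgt X \<cdot> w) = ?q \<cdot> (y \<cdot> c)"
      using c(7) by simp_all
    have "in_rel C (sim C X) (lft X \<cdot> w) (x \<cdot> c)" "in_rel C (sim C X) (rgt X \<cdot> w) (y \<cdot> c)"
      using eq by (subst (asm) quot_eq_iff[OF X]; use c(2-5) wX h_dom xy rel in auto)+
    moreover have "in_rel C X (lft X \<cdot> w) (rgt X \<cdot> w)" by (rule in_relI[OF c(4) wX])
    ultimately have "in_rel C X (x \<cdot> c) (y \<cdot> c)"
      using preorder_trans[OF X] unfolding in_rel_sim[OF rel] by blast
    then show ?thesis
      by (rule in_rel_descend[OF _ rel c(1)]) (use xy c(3) h_dom in auto)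
  qed
  have "is_preorder C P"
    unfolding preorder_iff
  proof (intro conjI ballI impI allI relP)
    fix u assume u: "u \<in> Ar C" "Cod C u = Car P"
    obtain c x where c: "regular_epi C c" "c \<in> Ar C" "Cod C c = Dom C u"
      "x \<in> Ar C" "Dom C x = Dom C c" "Cod C x = Dom C ?q" "?q \<cdot> x = u \<cdot> c"
      by (rule regular_epi_lift[OF q(1) u(1)]) (use u P(1) in auto)
    have "in_rel C P (u \<cdot> c) (u \<cdot> c)"
      using in_P[OF preorder_refl[OF X c(4)]] c(6,7) q(3) by simp
    then show "in_rel C P u u" by (rule in_rel_descend[OF _ relP c(1)]) (use u c(3) in auto)
  next
    fix u v w assume uv: "in_rel C P u v" and vw: "in_rel C P v w"
    note uvD = in_relD[OF uv relP] and vwD = in_relD[OF vw relP]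
    \<comment> \<open>The middle element gets a single representative \<open>y\<close>, so that the
      two related pairs upstairs can be composed; \<open>w\<close> is represented over the further
      cover \<open>d\<close>.\<close>
    obtain c x y where c: "regular_epi C c" "c \<in> Ar C" "Cod C c = Dom C u"
      "x \<in> Ar C" "Dom C x = Dom C c" "Cod C x = Dom C ?q" "?q \<cdot> x = u \<cdot> c"
      "y \<in> Ar C" "Dom C y = Dom C c" "Cod C y = Dom C ?q" "?q \<cdot> y = v \<cdot> c"
      by (rule regular_epi_lift2[OF q(1) uvD(1) _ uvD(2)]) (use uvD P(1) in auto)
    obtain d z where d: "regular_epi C d" "d \<in> Ar C" "Cod C d = Dom C (w \<cdot> c)"
      "z \<in> Ar C" "Dom C z = Dom C d" "Cod C z = Dom C ?q" "?q \<cdot> z = w \<cdot> c \<cdot> d"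
      by (rule regular_epi_lift[OF q(1), of "w \<cdot> c"]) (use uvD vwD c(2,3) P(1) in auto)
    have dc: "Cod C d = Dom C c" using d(3) c(2,3) uvD vwD by simp
    have qx: "?q \<cdot> (x \<cdot> d) = u \<cdot> (c \<cdot> d)" "?q \<cdot> (y \<cdot> d) = v \<cdot> (c \<cdot> d)"
      by (rule square_extend[OF c(7)] square_extend[OF c(11)];
          use c(2-6,8-10) d(2) dc uvD q in auto)+
    have qz: "?q \<cdot> z = w \<cdot> (c \<cdot> d)" using d(2,7) dc c(2,3) uvD vwD by simp
    have "in_rel C P (u \<cdot> (c \<cdot> d)) (v \<cdot> (c \<cdot> d))" "in_rel C P (v \<cdot> (c \<cdot> d)) (w \<cdot> (c \<cdot> d))"
      using in_rel_comp[OF uv relP, of "c \<cdot> d"] in_rel_comp[OF vw relP, of "c \<cdot> d"] c(2,3) d(2) dc uvD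
      by simp_all
    then have r: "in_rel C P (?q \<cdot> (x \<cdot> d)) (?q \<cdot> (y \<cdot> d))" "in_rel C P (?q \<cdot> (y \<cdot> d)) (?q \<cdot> z)"
      using qx qz by simp_all
    have "in_rel C X (x \<cdot> d) (y \<cdot> d)" "in_rel C X (y \<cdot> d) z"
      by (rule reflect[OF _ _ _ _ _ r(1)] reflect[OF _ _ _ _ _ r(2)];
          use c(2-6,8-10) d(2-6) dc q in auto)+
    then have "in_rel C P (u \<cdot> (c \<cdot> d)) (w \<cdot> (c \<cdot> d))"
      using in_P[OF preorder_trans[OF X]] qx(1) qz by metis
    then show "in_rel C P u w"
      by (rule in_rel_descend[OF _ relP regular_epi_comp[OF d(1) c(1) dc]])
        (use uvD vwD c(2,3) d(2) dc in auto)
  qed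
  moreover have "u = v" if uv: "in_rel C P u v" and vu: "in_rel C P v u" for u v
  proof -
    note uvD = in_relD[OF uv relP]
    obtain c x y where c: "regular_epi C c" "c \<in> Ar C" "Cod C c = Dom C u"
      "x \<in> Ar C" "Dom C x = Dom C c" "Cod C x = Dom C ?q" "?q \<cdot> x = u \<cdot> c"
      "y \<in> Ar C" "Dom C y = Dom C c" "Cod C y = Dom C ?q" "?q \<cdot> y = v \<cdot> c"
      by (rule regular_epi_lift2[OF q(1) uvD(1) _ uvD(2)]) (use uvD P(1) in auto)
    have "in_rel C P (?q \<cdot> x) (?q \<cdot> y)" "in_rel C P (?q \<cdot> y) (?q \<cdot> x)"
      using in_rel_comp[OF uv relP, of c] in_rel_comp[OF vu relP, of c] c uvD by simp_all
    \<comment> \<open>Order in both directions is reflected to \<open>\<sim>\<close>, which the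
      quotient map turns into equality.\<close>
    then have "in_rel C (sim C X) x y"
      using reflect[of x y] reflect[of y x] c(4-6,8-10) q(3) by (simp add: in_rel_sim[OF rel])
    then have "?q \<cdot> x = ?q \<cdot> y"
      by (subst quot_eq_iff[OF X]) (use c(4-6,8-10) q(3) in auto)
    then have "u \<cdot> c = v \<cdot> c" using c(7,11) by simp
    then show "u = v"
      by (rule regular_epi_cancel[OF c(1), rotated -1]) (use c(3) uvD in auto)
  qed
  ultimately have po: "is_partial_order C P" by (simp add: partial_order_iff)
  obtain n where n: "n \<in> Ar (PreOrd C)" "src n = X" "tgt n = P" "base n = ?q"
    by (rule PreOrd_arrow_ex[OF X \<open>is_preorder C P\<close> q(2,3)]) (use P(1) in_P in auto)
  have "fully_faithful C n" unfolding fully_faithful_iff[OF n(1)] using n reflect by simp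
  then show thesis using that[of n] n po by (simp add: is_reflection_def)
qed

lemma reflectionD:
  assumes "is_reflection C n"
  shows "n \<in> Ar (PreOrd C)" "is_partial_order C (tgt n)" "base n = quot C (src n)" "fully_faithful C n"
    "is_preorder C (src n)" "is_preorder C (tgt n)" "Cod C (quot C (src n)) = Car (tgt n)"
proof -
  show n: "n \<in> Ar (PreOrd C)" "is_partial_order C (tgt n)" "base n = quot C (src n)" "fully_faithful C n"
    using assms by (auto simp: is_reflection_def)
  show "is_preorder C (src n)" "is_preorder C (tgt n)" "Cod C (quot C (src n)) = Car (tgt n)"
    using PreOrd_arrD[OF n(1)] n(3) by auto
qed

lemma fully_faithfulD:
  assumes "fully_faithful C m" "m \<in> Ar (PreOrd C)" "x \<in> Ar C" "y \<in> Ar C" "Dom C x = Dom C y"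
    "Cod C x = Car (src m)" "Cod C y = Car (src m)" "in_rel C (tgt m) (base m \<cdot> x) (base m \<cdot> y)"
  shows "in_rel C (src m) x y"
  using assms fully_faithful_iff[OF assms(2)] by blast

text \<open>An arrow to a partial order is constant on \<open>\<sim>\<close> by antisymmetry, so its
  base descends to the quotient. The descended arrow is monotone because related elements of the
  quotient have, over a cover, related representatives by full faithfulness of
  \<open>n\<close>.\<close>

lemma reflection_factor:
  assumes n: "is_reflection C n" and g: "g \<in> Ar (PreOrd C)" "src g = src n" "is_partial_order C (tgt g)"
  obtains h where "h \<in> Ar (PreOrd C)" "src h = tgt n" "tgt h = tgt g" "h \<cdot>\<^bsub>PreOrd C\<^esub> n = g"
    "base h \<cdot> quot C (src n) = base g"
proof -
  interpret P: category "PreOrd C" by (rule category_PreOrd)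
  note nD = reflectionD[OF n] and gD = PreOrd_arrD[OF g(1)]
  let ?X = "src n" and ?q = "quot C (src n)"
  note q = quot_arrow[OF nD(5)]
  have rel: "is_relation C (sim C ?X)" using nD(5) by simp
  have "in_rel C (sim C (tgt g)) (base g \<cdot> lft (sim C ?X)) (base g \<cdot> rgt (sim C ?X))"
    using PreOrd_sim_mono[OF g(1)] in_rel_lft_rgt[OF rel] g(2) by simp
  then have eq: "base g \<cdot> lft (sim C ?X) = base g \<cdot> rgt (sim C ?X)"
    using g(3) gD(2) by (simp add: partial_order_iff in_rel_sim)
  obtain k where k: "k \<in> Ar C" "Dom C k = Cod C ?q" "Cod C k = Cod C (base g)" "k \<cdot> ?q = base g"
    by (rule coequalizer_factor[OF quot_coequalizer[OF nD(5)] _ _ eq])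
      (use rel nD(5) gD g in auto)
  have k_cod: "Cod C k = Car (tgt g)" "Dom C k = Car (tgt n)" using k(2,3) gD nD(7) by auto
  have mono: "in_rel C (tgt g) (k \<cdot> u) (k \<cdot> v)" if uv: "in_rel C (tgt n) u v" for u v
  proof -
    have relP: "is_relation C (tgt n)" using nD(6) by simp
    note uvD = in_relD[OF uv relP]
    obtain c x y where c: "regular_epi C c" "c \<in> Ar C" "Cod C c = Dom C u"
      "x \<in> Ar C" "Dom C x = Dom C c" "Cod C x = Dom C ?q" "?q \<cdot> x = u \<cdot> c"
      "y \<in> Ar C" "Dom C y = Dom C c" "Cod C y = Dom C ?q" "?q \<cdot> y = v \<cdot> c"
      by (rule regular_epi_lift2[OF q(1) uvD(1) _ uvD(2)]) (use uvD nD(7) in auto)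
    have "in_rel C (tgt n) (base n \<cdot> x) (base n \<cdot> y)"
      using in_rel_comp[OF uv relP, of c] c(2,3,7,11) nD(3) by simp
    then have "in_rel C ?X x y"
      by (rule fully_faithfulD[OF nD(4,1), rotated -1]) (use c(4-6,8-10) q(3) in auto)
    then have "in_rel C (tgt g) (base g \<cdot> x) (base g \<cdot> y)" using PreOrd_mono[OF g(1)] g(2) by simp
    moreover have "k \<cdot> (?q \<cdot> x) = base g \<cdot> x" "k \<cdot> (?q \<cdot> y) = base g \<cdot> y"
      by (rule comp_eq_extend[OF k(4)]; use k(1,2) c(4-6,8-10) q in auto)+
    ultimately have "in_rel C (tgt g) (k \<cdot> (u \<cdot> c)) (k \<cdot> (v \<cdot> c))" using c(7,11) by simp
    then have "in_rel C (tgt g) (k \<cdot> u \<cdot> c) (k \<cdot> v \<cdot> c)" using k(1) k_cod uvD c(2,3) by simp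
    then show ?thesis
      by (rule in_rel_descend[OF _ _ c(1)]) (use gD(2) k(1) k_cod uvD c(3) in auto)
  qed
  obtain h where h: "h \<in> Ar (PreOrd C)" "src h = tgt n" "tgt h = tgt g" "base h = k"
    by (rule PreOrd_arrow_ex[OF nD(6) gD(2) k(1)]) (use k_cod mono in auto)
  have "h \<cdot>\<^bsub>PreOrd C\<^esub> n = g"
    by (rule PreOrd_eqI) (use h nD(1,3) g k(4) in auto)
  then show thesis using that[of h] h k(4) by simp
qed

text \<open>Monotone arrows preserve \<open>\<sim>\<close>, so
  \<open>quot C (tgt m) \<cdot> base m\<close> is constant on it and the description in
  \<open>quot_map\<close> determines an arrow.\<close>

lemma quot_map:
  assumes "m \<in> Ar (PreOrd C)"
  shows "quot_map C m \<in> Ar C" "Dom C (quot_map C m) = Cod C (quot C (src m))"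
    "Cod C (quot_map C m) = Cod C (quot C (tgt m))"
    "quot_map C m \<cdot> quot C (src m) = quot C (tgt m) \<cdot> base m"
proof -
  note m = PreOrd_arrD[OF assms]
  let ?X = "src m" and ?Y = "tgt m"
  note qX = quot_arrow[OF m(1)] and qY = quot_arrow[OF m(2)]
  have rel: "is_relation C (sim C ?X)" "Car (sim C ?X) = Car ?X" using m(1) by auto
  have "in_rel C (sim C ?Y) (base m \<cdot> lft (sim C ?X)) (base m \<cdot> rgt (sim C ?X))"
    by (rule PreOrd_sim_mono[OF assms in_rel_lft_rgt[OF rel(1)]])
  then have "quot C ?Y \<cdot> (base m \<cdot> lft (sim C ?X)) = quot C ?Y \<cdot> (base m \<cdot> rgt (sim C ?X))"
    by (subst quot_eq_iff[OF m(2)]) (use rel m in auto)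
  then have "\<exists>!h. h \<in> Hom C (Cod C (quot C ?X)) (Cod C (quot C ?Y)) \<and>
      h \<cdot> quot C ?X = quot C ?Y \<cdot> base m"
    by (intro coequalizer_ex1[OF quot_coequalizer[OF m(1)]]) (use rel m qY in \<open>auto simp: Hom_iff\<close>)
  from theI'[OF this] show "quot_map C m \<in> Ar C" "Dom C (quot_map C m) = Cod C (quot C (src m))"
    "Cod C (quot_map C m) = Cod C (quot C (tgt m))"
    "quot_map C m \<cdot> quot C (src m) = quot C (tgt m) \<cdot> base m"
    by (auto simp: quot_map_def Hom_iff)
qed


section \<open>The factorization system\<close>

text \<open>The reflections of source and target with the induced arrow \<open>r\<close> exhibit
  \<open>m\<close> as a pullback of \<open>r\<close>, which lies in \<open>ParOrd C\<close>, so a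
  single pullback step suffices. The facts \<open>uniq\<close> and \<open>lift\<close> settle the
  underlying square in \<open>C\<close>; the order is then recovered from the unit.\<close>

lemma unique_lifting_class_M:
  assumes m: "m \<in> Ar (PreOrd C)" and U: "unique_lifting C (sim C (src m)) (sim C (tgt m)) (base m)"
  shows "m \<in> class_M C"
proof -
  interpret P: category "PreOrd C" by (rule category_PreOrd)
  note mD = PreOrd_arrD[OF m]
  let ?f = "base m" and ?X = "src m" and ?Y = "tgt m"
  let ?p = "quot C ?X" and ?q = "quot C ?Y"
  note p = quot_arrow[OF mD(1)] and q = quot_arrow[OF mD(2)]
  have rel: "is_relation C ?X" "is_relation C ?Y" "is_relation C (sim C ?X)" "is_relation C (sim C ?Y)"
    using mD(1,2) by auto
  obtain nX where nX: "is_reflection C nX" "src nX = ?X" by (rule reflection_ex[OF mD(1)])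
  obtain nY where nY: "is_reflection C nY" "src nY = ?Y" by (rule reflection_ex[OF mD(2)])
  note nXD = reflectionD[OF nX(1), unfolded nX(2)] and nYD = reflectionD[OF nY(1), unfolded nY(2)]
  obtain r where r: "r \<in> Ar (PreOrd C)" "src r = tgt nX" "tgt r = tgt nY"
    "r \<cdot>\<^bsub>PreOrd C\<^esub> nX = nY \<cdot>\<^bsub>PreOrd C\<^esub> m" "base r \<cdot> ?p = ?q \<cdot> ?f"
  proof (rule reflection_factor[OF nX(1)])
    show "nY \<cdot>\<^bsub>PreOrd C\<^esub> m \<in> Ar (PreOrd C)" using nYD(1) m nY(2) by simp
  qed (use nX nY nYD in auto)
  note rD = PreOrd_arrD[OF r(1)]
  have rp: "base r \<cdot> (?p \<cdot> x) = ?q \<cdot> (?f \<cdot> x)" if "x \<in> Ar C" "Cod C x = Car ?X" for x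
    by (rule square_extend[OF r(5)]) (use that rD(3-5) r(2,3) nXD(7) nYD(7) p q mD(3-5) in auto)
  \<comment> \<open>Equal classes mean \<open>x \<sim> x'\<close>, so \<open>x\<close> and
    \<open>x'\<close> both lift \<open>?f \<cdot> x\<close> from \<open>x\<close>.\<close>
  have uniq: "x = x'"
    if x: "x \<in> Ar C" "x' \<in> Ar C" "Dom C x = Dom C x'" "Cod C x = Car ?X" "Cod C x' = Car ?X"
      and eq: "?f \<cdot> x = ?f \<cdot> x'" "?p \<cdot> x = ?p \<cdot> x'" for x x'
  proof -
    have "in_rel C (sim C ?X) x x'" using eq(2) quot_eq_iff[OF mD(1) x] by simp
    moreover have "in_rel C (sim C ?X) x x" using sim_refl[OF mD(1)] x by simp
    moreover have "in_rel C (sim C ?Y) (?f \<cdot> x) (?f \<cdot> x)" by (rule sim_refl[OF mD(2)]) (use x mD in auto)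
    moreover have "Cod C x = Car (sim C ?X)" using x(4) rel by simp
    ultimately show ?thesis using U[unfolded unique_lifting_def] x(1) eq(1) by metis
  qed
  have lift: "\<exists>x \<in> Ar C. Dom C x = Dom C y \<and> Cod C x = Car ?X \<and> ?f \<cdot> x = y \<and> ?p \<cdot> x = u"
    if y: "y \<in> Ar C" "u \<in> Ar C" "Dom C y = Dom C u" "Cod C y = Car ?Y" "Cod C u = Car (tgt nX)"
      and eq: "?q \<cdot> y = base r \<cdot> u" for y u
  proof -
    \<comment> \<open>Over a cover the class \<open>u\<close> has a representative \<open>x\<close>,
      whose image is equivalent but perhaps not equal to \<open>y\<close>. Lifting that equivalence
      moves \<open>x\<close> within its class to some \<open>z\<close> with the right image.\<close>
    obtain c x where c: "regular_epi C c" "c \<in> Ar C" "Cod C c = Dom C u"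
      "x \<in> Ar C" "Dom C x = Dom C c" "Cod C x = Dom C ?p" "?p \<cdot> x = u \<cdot> c"
      by (rule regular_epi_lift[OF p(1) y(2)]) (use y nXD(7) in auto)
    have xX: "Cod C x = Car ?X" using c(6) p by simp
    have "?q \<cdot> (y \<cdot> c) = base r \<cdot> (u \<cdot> c)"
      by (rule square_extend[OF eq]) (use y c(2,3) rD(3-5) r(2) q in auto)
    then have "?q \<cdot> (?f \<cdot> x) = ?q \<cdot> (y \<cdot> c)" using rp[OF c(4) xX] c(7) by simp
    then have "in_rel C (sim C ?Y) (?f \<cdot> x) (y \<cdot> c)"
      by (subst quot_eq_iff[OF mD(2), symmetric]) (use c(2-5) xX y mD in auto)
    then obtain z where z: "in_rel C (sim C ?X) x z" "?f \<cdot> z = y \<cdot> c"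
      using U c(4) xX rel unfolding unique_lifting_def by (metis Car_sim)
    have zD: "z \<in> Ar C" "Dom C z = Dom C c" "Cod C z = Car ?X"
      using in_relD[OF z(1) rel(3)] c(5) rel by auto
    have pz: "?p \<cdot> z = u \<cdot> c"
      using quot_eq_iff[OF mD(1) c(4) zD(1)] z(1) zD c(5,7) xX by simp
    \<comment> \<open>The image and the class of \<open>z\<close> both factor through the cover
      \<open>c\<close>, and \<open>uniq\<close> says that they determine \<open>z\<close>.\<close>
    have "z \<cdot> a = z \<cdot> b" if ab: "a \<in> Ar C" "b \<in> Ar C" "Dom C a = Dom C b" "Cod C a = Dom C c"
      "Cod C b = Dom C c" "c \<cdot> a = c \<cdot> b" for a b
    proof (rule uniq)
      have "?f \<cdot> (z \<cdot> d) = y \<cdot> (c \<cdot> d)" "?p \<cdot> (z \<cdot> d) = u \<cdot> (c \<cdot> d)" if "d \<in> Ar C" "Cod C d = Dom C c" for d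
        by (rule square_extend[OF z(2)] square_extend[OF pz];
            use that zD c(2,3) y mD(3-5) p in auto)+
      then show "?f \<cdot> (z \<cdot> a) = ?f \<cdot> (z \<cdot> b)" "?p \<cdot> (z \<cdot> a) = ?p \<cdot> (z \<cdot> b)" using ab by simp_all
    qed (use ab zD in auto)
    then obtain w where w: "w \<in> Ar C" "Dom C w = Cod C c" "Cod C w = Cod C z" "w \<cdot> c = z"
      using regular_epi_descend[OF c(1) zD(1,2)] by metis
    have w': "Dom C w = Dom C y" "Cod C w = Car ?X" using w zD c(3) y by auto
    have fw: "?f \<cdot> w \<cdot> c = y \<cdot> c" and pw: "?p \<cdot> w \<cdot> c = u \<cdot> c"
      using w zD c(2,3) mD(3-5) p z(2) pz by simp_all
    have "?f \<cdot> w = y"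
      by (rule regular_epi_cancel[OF c(1) _ _ _ _ fw]) (use w(1) w' y c(3) mD(3-5) in auto)
    moreover have "?p \<cdot> w = u"
      by (rule regular_epi_cancel[OF c(1) _ _ _ _ pw]) (use w(1) w' y c(3) p in auto)
    ultimately show ?thesis using w(1) w' by blast
  qed
  have "is_pullback (PreOrd C) nY r m nX"
  proof (rule P.pullbackI)
    fix a b assume ab: "a \<in> Ar (PreOrd C)" "b \<in> Ar (PreOrd C)" "Dom (PreOrd C) a = Dom (PreOrd C) b"
      "Cod (PreOrd C) a = Dom (PreOrd C) nY" "Cod (PreOrd C) b = Dom (PreOrd C) r"
      "nY \<cdot>\<^bsub>PreOrd C\<^esub> a = r \<cdot>\<^bsub>PreOrd C\<^esub> b"
    then have ab': "src a = src b" "tgt a = ?Y" "tgt b = tgt nX" using nY r by auto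
    note aD = PreOrd_arrD[OF ab(1)] and bD = PreOrd_arrD[OF ab(2)]
    have "?q \<cdot> base a = base r \<cdot> base b" using ab(6) nYD(3) PreOrd_simps(6) by metis
    then obtain h where h: "h \<in> Ar C" "Dom C h = Car (src a)" "Cod C h = Car ?X"
      "?f \<cdot> h = base a" "?p \<cdot> h = base b"
      using lift[of "base a" "base b"] aD(3-5) bD(3-5) ab' by auto
    \<comment> \<open>\<open>?p \<cdot> h\<close> underlies the monotone arrow \<open>b\<close>, and
      the unit reflects the order.\<close>
    have mono: "in_rel C ?X (h \<cdot> x) (h \<cdot> y)" if xy: "in_rel C (src a) x y" for x y
    proof -
      have "is_relation C (src a)" using aD(1) by simp
      note xyD = in_relD[OF xy this]
      have "?p \<cdot> (h \<cdot> x) = base b \<cdot> x" "?p \<cdot> (h \<cdot> y) = base b \<cdot> y"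
        by (rule comp_eq_extend[OF h(5)]; use xyD h(1-3) p in auto)+
      then have "in_rel C (tgt nX) (base nX \<cdot> (h \<cdot> x)) (base nX \<cdot> (h \<cdot> y))"
        using PreOrd_mono[OF ab(2), of x y] xy ab' nXD(3) by simp
      then show ?thesis
        using fully_faithfulD[OF nXD(4,1), of "h \<cdot> x" "h \<cdot> y"] xyD h(1-3) nX(2) by simp
    qed
    obtain k where k: "k \<in> Ar (PreOrd C)" "src k = src a" "tgt k = ?X" "base k = h"
      by (rule PreOrd_arrow_ex[OF aD(1) mD(1) h(1)]) (use h mono in auto)
    have "m \<cdot>\<^bsub>PreOrd C\<^esub> k = a" "nX \<cdot>\<^bsub>PreOrd C\<^esub> k = b"
      using k m ab(1,2) ab' h nX(2) nXD(1,3) by (auto intro!: PreOrd_eqI)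
    then show "\<exists>k\<in>Hom (PreOrd C) (Dom (PreOrd C) a) (Dom (PreOrd C) m).
        m \<cdot>\<^bsub>PreOrd C\<^esub> k = a \<and> nX \<cdot>\<^bsub>PreOrd C\<^esub> k = b"
      using k by (auto simp: P.Hom_iff)
  next
    fix h k assume hk: "h \<in> Ar (PreOrd C)" "k \<in> Ar (PreOrd C)" "Dom (PreOrd C) h = Dom (PreOrd C) k"
      "Cod (PreOrd C) h = Dom (PreOrd C) m" "Cod (PreOrd C) k = Dom (PreOrd C) m"
      "m \<cdot>\<^bsub>PreOrd C\<^esub> h = m \<cdot>\<^bsub>PreOrd C\<^esub> k" "nX \<cdot>\<^bsub>PreOrd C\<^esub> h = nX \<cdot>\<^bsub>PreOrd C\<^esub> k"
    have "?f \<cdot> base h = ?f \<cdot> base k" "?p \<cdot> base h = ?p \<cdot> base k"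
      using hk(6,7) nXD(3) PreOrd_simps(6) by metis+
    then have "base h = base k"
      using uniq[of "base h" "base k"] PreOrd_arrD(3-5)[OF hk(1)] PreOrd_arrD(3-5)[OF hk(2)] hk(3-5)
      by simp
    then show "h = k" using hk by (intro PreOrd_eqI) auto
  qed (use nX nY nXD(1) nYD(1) r m in auto)
  moreover have "r \<in> Ar (ParOrd C)" using r nXD(2) nYD(2) by simp
  ultimately show ?thesis
    unfolding class_M_def by (blast intro: pullback_closure.intros)
qed

text \<open>Compares an abstract universal arrow with the constructed reflection \<open>n\<close>.
  Comparison arrows exist in both directions; one composite is the identity by universality of
  \<open>\<eta>\<close>, the other because the quotient map is an epimorphism. Full faithfulness
  passes from \<open>n\<close> to \<open>\<eta>\<close> since \<open>n\<close> is
  \<open>\<eta>\<close> followed by the monotone \<open>i\<close>.\<close>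

lemma universal_arrow_reflection:
  assumes X: "is_preorder C X" and \<eta>: "\<eta> \<in> Ar (PreOrd C)" "src \<eta> = X" "is_partial_order C (tgt \<eta>)"
    and univ: "\<And>P g. is_partial_order C P \<Longrightarrow> g \<in> Hom (PreOrd C) X P \<Longrightarrow>
      \<exists>!h. h \<in> Hom (ParOrd C) (tgt \<eta>) P \<and> h \<cdot>\<^bsub>PreOrd C\<^esub> \<eta> = g"
  obtains k where "is_iso C k" "k \<in> Ar C" "Dom C k = Cod C (quot C X)" "Cod C k = Car (tgt \<eta>)"
    "k \<cdot> quot C X = base \<eta>" "fully_faithful C \<eta>"
proof -
  interpret P: category "PreOrd C" by (rule category_PreOrd)
  obtain n where n: "is_reflection C n" "src n = X" by (rule reflection_ex[OF X])
  note nD = reflectionD[OF n(1), unfolded n(2)] and q = quot_arrow[OF X] and \<eta>D = PreOrd_arrD[OF \<eta>(1)]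
  obtain i where i: "i \<in> Ar (PreOrd C)" "src i = tgt \<eta>" "tgt i = tgt n" "i \<cdot>\<^bsub>PreOrd C\<^esub> \<eta> = n"
    using univ[OF nD(2), of n] nD(1) n(2) by (auto simp: Hom_def)
  obtain j where j: "j \<in> Ar (PreOrd C)" "src j = tgt n" "tgt j = tgt \<eta>" "j \<cdot>\<^bsub>PreOrd C\<^esub> n = \<eta>"
    "base j \<cdot> quot C X = base \<eta>"
    using reflection_factor[OF n(1) \<eta>(1)] \<eta> n(2) by metis
  note iD = PreOrd_arrD[OF i(1)] and jD = PreOrd_arrD[OF j(1)]
  have i\<eta>: "base i \<cdot> base \<eta> = quot C X" using i(4) nD(3) PreOrd_simps(6) by metis
  have "j \<cdot>\<^bsub>PreOrd C\<^esub> i = Id (PreOrd C) (tgt \<eta>)"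
  proof -
    have "\<eta> \<in> Hom (PreOrd C) X (tgt \<eta>)" using \<eta> by (simp add: Hom_def)
    note ex1 = univ[OF \<eta>(3) this]
    have "j \<cdot>\<^bsub>PreOrd C\<^esub> i \<in> Hom (ParOrd C) (tgt \<eta>) (tgt \<eta>)"
      using i j \<eta>(3) by (simp add: Hom_def)
    moreover have "j \<cdot>\<^bsub>PreOrd C\<^esub> i \<cdot>\<^bsub>PreOrd C\<^esub> \<eta> = \<eta>" using i j \<eta> by simp
    moreover have "Id (PreOrd C) (tgt \<eta>) \<in> Hom (ParOrd C) (tgt \<eta>) (tgt \<eta>)"
      using \<eta>(3) \<eta>D(2) by (simp add: Hom_def)
    moreover have "Id (PreOrd C) (tgt \<eta>) \<cdot>\<^bsub>PreOrd C\<^esub> \<eta> = \<eta>" using \<eta>(1) by simp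
    ultimately show ?thesis using ex1 by blast
  qed
  then have ji: "base j \<cdot> base i = Id C (Car (tgt \<eta>))" using PreOrd_simps(6,9) by metis
  have ij: "base i \<cdot> base j = Id C (Car (tgt n))"
  proof (rule regular_epi_cancel[OF q(1)])
    show "base i \<cdot> base j \<cdot> quot C X = Id C (Car (tgt n)) \<cdot> quot C X"
      using i\<eta> j iD(3-5) jD(3-5) i(2,3) q nD(7) by simp
  qed (use iD(3-5) jD(3-5) i(2,3) j(2,3) nD(6,7) q in auto)
  have iso: "is_iso C (base j)"
    by (rule isoI[of "base j" "base i"]) (use iD(3-5) jD(3-5) i(2,3) j(2,3) ij ji in auto)
  have "fully_faithful C \<eta>"
    unfolding fully_faithful_iff[OF \<eta>(1)]
  proof (intro allI impI)
    fix x y assume xy: "x \<in> Ar C" "y \<in> Ar C" "Dom C x = Dom C y" "Cod C x = Car (src \<eta>)"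
      "Cod C y = Car (src \<eta>)" "in_rel C (tgt \<eta>) (base \<eta> \<cdot> x) (base \<eta> \<cdot> y)"
    have "base i \<cdot> (base \<eta> \<cdot> x) = quot C X \<cdot> x" "base i \<cdot> (base \<eta> \<cdot> y) = quot C X \<cdot> y"
      by (rule comp_eq_extend[OF i\<eta>]; use xy iD(3-5) \<eta>D(3-5) i(2) in auto)+
    then have "in_rel C (tgt n) (base n \<cdot> x) (base n \<cdot> y)"
      using PreOrd_mono[OF i(1)] xy(6) i(2,3) nD(3) by metis
    then show "in_rel C (src \<eta>) x y"
      using fully_faithfulD[OF nD(4,1) xy(1-3)] xy(4,5) \<eta>(2) n(2) by simp
  qed
  then show thesis
    using that[OF iso] jD(3-5) j(2,3,5) nD(7) by simp
qed

text \<open>Up to the comparison isomorphisms \<open>k\<close> and \<open>l\<close>, the underlying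
  arrow of \<open>on_ar F m\<close> is \<open>quot_map C m\<close>, so the latter decides
  invertibility in \<open>C\<close>. Invertibility in \<open>ParOrd C\<close> asks in addition for a
  monotone inverse, which full faithfulness of \<open>m\<close> supplies.\<close>

lemma class_E_iff:
  assumes adj: "is_left_adjoint (PreOrd C) (ParOrd C) F incl" and m: "m \<in> Ar (PreOrd C)"
  shows "m \<in> class_E C F \<longleftrightarrow> fully_faithful C m \<and> regular_epi C (quot_map C m)"
proof -
  interpret P: category "PreOrd C" by (rule category_PreOrd)
  obtain \<eta> where
    F_ob: "\<And>A. is_preorder C A \<Longrightarrow> is_partial_order C (on_ob F A)" and
    \<eta>: "\<And>A. is_preorder C A \<Longrightarrow> \<eta> A \<in> Hom (PreOrd C) A (on_ob F A)" and
    F_ar: "\<And>f A B. f \<in> Hom (PreOrd C) A B \<Longrightarrow> on_ar F f \<in> Hom (ParOrd C) (on_ob F A) (on_ob F B)" and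
    nat: "\<And>f A B. f \<in> Hom (PreOrd C) A B \<Longrightarrow>
      on_ar F f \<cdot>\<^bsub>PreOrd C\<^esub> \<eta> A = \<eta> B \<cdot>\<^bsub>PreOrd C\<^esub> f" and
    univ: "\<And>A B g. is_preorder C A \<Longrightarrow> is_partial_order C B \<Longrightarrow> g \<in> Hom (PreOrd C) A B \<Longrightarrow>
      \<exists>!h. h \<in> Hom (ParOrd C) (on_ob F A) B \<and> h \<cdot>\<^bsub>PreOrd C\<^esub> \<eta> A = g"
    by (rule adjoint_universal[OF category_PreOrd category_ParOrd adj,
          unfolded incl_def fctr.simps PreOrd_simps(1) ParOrd_simps(1)]) (rule that; blast)
  note mD = PreOrd_arrD[OF m]
  let ?X = "src m" and ?Y = "tgt m" and ?f = "base m"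
  let ?h = "on_ar F m"
  have unit: "\<eta> A \<in> Ar (PreOrd C)" "src (\<eta> A) = A" "tgt (\<eta> A) = on_ob F A" if "is_preorder C A" for A
    using \<eta>[OF that] by (auto simp: Hom_def)
  have mHom: "m \<in> Hom (PreOrd C) ?X ?Y" using m by (simp add: Hom_def)
  have h: "?h \<in> Ar (PreOrd C)" "src ?h = on_ob F ?X" "tgt ?h = on_ob F ?Y"
    using F_ar[OF mHom] by (auto simp: Hom_def)
  note hD = PreOrd_arrD[OF h(1), unfolded h(2,3)]
  note \<eta>X = unit[OF mD(1)] and \<eta>Y = unit[OF mD(2)]
  note \<eta>XD = PreOrd_arrD[OF \<eta>X(1), unfolded \<eta>X(2,3)] and \<eta>YD = PreOrd_arrD[OF \<eta>Y(1), unfolded \<eta>Y(2,3)]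
  obtain k where k: "is_iso C k" "k \<in> Ar C" "Dom C k = Cod C (quot C ?X)" "Cod C k = Car (on_ob F ?X)"
    "k \<cdot> quot C ?X = base (\<eta> ?X)" "fully_faithful C (\<eta> ?X)"
    by (rule universal_arrow_reflection[OF mD(1) \<eta>X(1,2)])
      (use univ[OF mD(1)] F_ob[OF mD(1)] \<eta>X(3) in auto)
  obtain l where l: "is_iso C l" "l \<in> Ar C" "Dom C l = Cod C (quot C ?Y)" "Cod C l = Car (on_ob F ?Y)"
    "l \<cdot> quot C ?Y = base (\<eta> ?Y)" "fully_faithful C (\<eta> ?Y)"
    by (rule universal_arrow_reflection[OF mD(2) \<eta>Y(1,2)])
      (use univ[OF mD(2)] F_ob[OF mD(2)] \<eta>Y(3) in auto)
  note qX = quot_arrow[OF mD(1)] and qY = quot_arrow[OF mD(2)] and qm = quot_map[OF m]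
  have h\<eta>: "base ?h \<cdot> base (\<eta> ?X) = base (\<eta> ?Y) \<cdot> ?f"
    using nat[OF mHom] PreOrd_simps(6) by metis
  have h\<eta>': "base ?h \<cdot> (base (\<eta> ?X) \<cdot> x) = base (\<eta> ?Y) \<cdot> (?f \<cdot> x)" if "x \<in> Ar C" "Cod C x = Car ?X" for x
    by (rule square_extend[OF h\<eta>]) (use that hD(3-5) \<eta>XD(3-5) \<eta>YD(3-5) mD(3-5) in auto)
  \<comment> \<open>After precomposition with the epimorphism \<open>quot C ?X\<close>, both sides
    become \<open>base (\<eta> ?Y) \<cdot> ?f\<close>.\<close>
  have hk: "base ?h \<cdot> k = l \<cdot> quot_map C m"
  proof (rule regular_epi_cancel[OF qX(1)])
    have "l \<cdot> (quot C ?Y \<cdot> ?f) = base (\<eta> ?Y) \<cdot> ?f"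
      by (rule comp_eq_extend[OF l(5)]) (use l(2,3) qY mD(3-5) in auto)
    then show "base ?h \<cdot> k \<cdot> quot C ?X = l \<cdot> quot_map C m \<cdot> quot C ?X"
      using h\<eta> hD(3-5) k(2-5) l(2,3) qX qm by simp
  qed (use hD(3-5) k(2-4) l(2-4) qm in auto)
  show ?thesis
  proof
    assume "m \<in> class_E C F"
    then obtain g where g: "g \<in> Ar (PreOrd C)" "src g = on_ob F ?Y" "tgt g = on_ob F ?X"
      "g \<cdot>\<^bsub>PreOrd C\<^esub> ?h = Id (PreOrd C) (on_ob F ?X)" "?h \<cdot>\<^bsub>PreOrd C\<^esub> g = Id (PreOrd C) (on_ob F ?Y)"
      using h unfolding class_E_def is_iso_def by (auto simp: Hom_def)
    note gD = PreOrd_arrD[OF g(1), unfolded g(2,3)]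
    have gh: "base g \<cdot> base ?h = Id C (Car (on_ob F ?X))" "base ?h \<cdot> base g = Id C (Car (on_ob F ?Y))"
      using g(4,5) PreOrd_simps(6,9) by metis+
    have "is_iso C (base ?h)" by (rule isoI[of "base ?h" "base g"]) (use gD(3-5) hD(3-5) gh in auto)
    then have "is_iso C (base ?h \<cdot> k)" by (rule iso_comp[OF _ k(1)]) (use k hD in auto)
    then have "is_iso C (quot_map C m)"
      unfolding hk by (rule iso_cancel_left[OF l(1)]) (use qm l in auto)
    then have "regular_epi C (quot_map C m)" by (rule iso_regular_epi)
    moreover have "fully_faithful C m"
      unfolding fully_faithful_iff[OF m]
    proof (intro allI impI)
      fix x y assume xy: "x \<in> Ar C" "y \<in> Ar C" "Dom C x = Dom C y" "Cod C x = Car ?X" "Cod C y = Car ?X"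
        "in_rel C ?Y (?f \<cdot> x) (?f \<cdot> y)"
      \<comment> \<open>Apply the unit at \<open>?Y\<close>, rewrite by naturality, cancel
        \<open>?h\<close> with its monotone inverse, and reflect along the fully faithful unit at
        \<open>?X\<close>.\<close>
      have "in_rel C (on_ob F ?Y) (base ?h \<cdot> (base (\<eta> ?X) \<cdot> x)) (base ?h \<cdot> (base (\<eta> ?X) \<cdot> y))"
        using PreOrd_mono[OF \<eta>Y(1), unfolded \<eta>Y(2,3), OF xy(6)] h\<eta>' xy by simp
      then have "in_rel C (on_ob F ?X) (base g \<cdot> (base ?h \<cdot> (base (\<eta> ?X) \<cdot> x)))
          (base g \<cdot> (base ?h \<cdot> (base (\<eta> ?X) \<cdot> y)))"
        by (rule PreOrd_mono[OF g(1), unfolded g(2,3)])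
      moreover have "base g \<cdot> (base ?h \<cdot> z) = z" if "z \<in> Ar C" "Cod C z = Car (on_ob F ?X)" for z
        using comp_eq_extend[OF gh(1) that(1)] that gD(3-5) hD(3-5) by simp
      ultimately have "in_rel C (on_ob F ?X) (base (\<eta> ?X) \<cdot> x) (base (\<eta> ?X) \<cdot> y)"
        using xy(1-5) \<eta>XD(3-5) by simp
      then show "in_rel C ?X x y"
        using fully_faithfulD[OF k(6) \<eta>X(1) xy(1-3)] xy(4,5) \<eta>X(2,3) by simp
    qed
    ultimately show "fully_faithful C m \<and> regular_epi C (quot_map C m)" by simp
  next
    assume asm: "fully_faithful C m \<and> regular_epi C (quot_map C m)"
    then have ff: "fully_faithful C m" and re: "regular_epi C (quot_map C m)" by auto
    \<comment> \<open>Monicity: over a cover, \<open>u\<close> and \<open>v\<close> have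
      representatives whose images in \<open>?Y\<close> are equivalent. Full faithfulness reflects
      both directions, so the representatives are equivalent and their classes equal.\<close>
    have "u = v" if uv: "u \<in> Ar C" "v \<in> Ar C" "Dom C v = Dom C u" "Cod C u = Cod C (quot C ?X)"
      "Cod C v = Cod C (quot C ?X)" "quot_map C m \<cdot> u = quot_map C m \<cdot> v" for u v
    proof -
      obtain c x y where c: "regular_epi C c" "c \<in> Ar C" "Cod C c = Dom C u"
        "x \<in> Ar C" "Dom C x = Dom C c" "Cod C x = Dom C (quot C ?X)" "quot C ?X \<cdot> x = u \<cdot> c"
        "y \<in> Ar C" "Dom C y = Dom C c" "Cod C y = Dom C (quot C ?X)" "quot C ?X \<cdot> y = v \<cdot> c"
        by (rule regular_epi_lift2[OF qX(1) uv(1,4,2,5,3)])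
      have xX: "Cod C x = Car ?X" "Cod C y = Car ?X" using c(6,10) qX by auto
      have "quot C ?Y \<cdot> (?f \<cdot> z) = quot_map C m \<cdot> (quot C ?X \<cdot> z)" if "z \<in> Ar C" "Cod C z = Car ?X" for z
        by (rule square_extend[OF qm(4)[symmetric]]) (use that qX qY qm(1-3) mD(3-5) in auto)
      moreover have "quot_map C m \<cdot> (u \<cdot> c) = quot_map C m \<cdot> (v \<cdot> c)"
        by (rule square_extend[OF uv(6)]) (use uv(1-5) c(2,3) qm in auto)
      ultimately have "quot C ?Y \<cdot> (?f \<cdot> x) = quot C ?Y \<cdot> (?f \<cdot> y)" using c(4,7,8,11) xX by simp
      then have "in_rel C (sim C ?Y) (?f \<cdot> x) (?f \<cdot> y)"
        by (subst quot_eq_iff[OF mD(2), symmetric]) (use c(4,5,8,9) xX mD in auto)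
      then have "in_rel C (sim C ?X) x y"
        using fully_faithfulD[OF ff m c(4,8)] fully_faithfulD[OF ff m c(8,4)] c(5,9) xX mD(1,2)
        by (simp add: in_rel_sim)
      then have "quot C ?X \<cdot> x = quot C ?X \<cdot> y"
        by (subst quot_eq_iff[OF mD(1)]) (use c(4,5,8,9) xX in auto)
      then have "u \<cdot> c = v \<cdot> c" using c(7,11) by simp
      then show "u = v" by (rule regular_epi_cancel[OF c(1), rotated -1]) (use uv(1-3) c(3) in auto)
    qed
    then have "is_mono C (quot_map C m)" using qm by (auto simp: is_mono_def Hom_iff)
    then have "is_iso C (quot_map C m)" by (rule regular_epi_mono_iso[OF re])
    then have "is_iso C (base ?h \<cdot> k)" unfolding hk by (rule iso_comp[OF l(1)]) (use qm l in auto)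
    then have "is_iso C (base ?h)" by (rule iso_cancel_right[OF k(1)]) (use k hD in auto)
    then obtain b where b: "b \<in> Ar C" "Dom C b = Car (on_ob F ?Y)" "Cod C b = Car (on_ob F ?X)"
      "b \<cdot> base ?h = Id C (Car (on_ob F ?X))" "base ?h \<cdot> b = Id C (Car (on_ob F ?Y))"
      by (rule isoE) (use hD in auto)
    \<comment> \<open>The unit inherits regularity from the quotient map, so elements of
      \<open>on_ob F ?X\<close> have representatives in \<open>?X\<close> over a cover.\<close>
    have \<eta>_epi: "regular_epi C (base (\<eta> ?X))"
      using iso_comp_regular_epi[OF k(1) qX(1)] k(3,5) by simp
    \<comment> \<open>Representatives of \<open>b \<cdot> u\<close> and \<open>b \<cdot> v\<close>
      have images in \<open>?Y\<close> whose classes are \<open>u\<close> and \<open>v\<close> over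
      the cover. The order is reflected along the unit at \<open>?Y\<close>, then along
      \<open>m\<close>, and pushed forward along the unit at \<open>?X\<close>.\<close>
    have mono: "in_rel C (on_ob F ?X) (b \<cdot> u) (b \<cdot> v)" if uv: "in_rel C (on_ob F ?Y) u v" for u v
    proof -
      have rel: "is_relation C (on_ob F ?Y)" "is_relation C (on_ob F ?X)" using \<eta>XD(2) \<eta>YD(2) by auto
      note uvD = in_relD[OF uv rel(1)]
      obtain c x y where c: "regular_epi C c" "c \<in> Ar C" "Cod C c = Dom C (b \<cdot> u)"
        "x \<in> Ar C" "Dom C x = Dom C c" "Cod C x = Dom C (base (\<eta> ?X))" "base (\<eta> ?X) \<cdot> x = b \<cdot> u \<cdot> c"
        "y \<in> Ar C" "Dom C y = Dom C c" "Cod C y = Dom C (base (\<eta> ?X))" "base (\<eta> ?X) \<cdot> y = b \<cdot> v \<cdot> c"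
        by (rule regular_epi_lift2[OF \<eta>_epi, of "b \<cdot> u" "b \<cdot> v"]) (use uvD b(1-3) \<eta>XD(3-5) in auto)
      have cu: "Cod C c = Dom C u" using c(3) b uvD by simp
      have xX: "Cod C x = Car ?X" "Cod C y = Car ?X" using c(6,10) \<eta>XD by auto
      have hb: "base ?h \<cdot> (b \<cdot> (w \<cdot> c)) = w \<cdot> c" if "w \<in> Ar C" "Dom C w = Dom C u" "Cod C w = Car (on_ob F ?Y)" for w
        using comp_eq_extend[OF b(5), of "w \<cdot> c"] that b(1-3) c(2) cu hD(3-5) by simp
      have "base (\<eta> ?Y) \<cdot> (?f \<cdot> x) = u \<cdot> c" "base (\<eta> ?Y) \<cdot> (?f \<cdot> y) = v \<cdot> c"
        using h\<eta>'[OF c(4) xX(1)] h\<eta>'[OF c(8) xX(2)] c(7,11) hb[of u] hb[of v] uvD b(1-3) c(2) cu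
        by simp_all
      then have "in_rel C (on_ob F ?Y) (base (\<eta> ?Y) \<cdot> (?f \<cdot> x)) (base (\<eta> ?Y) \<cdot> (?f \<cdot> y))"
        using in_rel_comp[OF uv rel(1) c(2) cu] by simp
      then have "in_rel C ?Y (?f \<cdot> x) (?f \<cdot> y)"
        using fully_faithfulD[OF l(6) \<eta>Y(1), of "?f \<cdot> x" "?f \<cdot> y"] c(4,5,8,9) xX mD(3-5) \<eta>Y(2,3) by simp
      then have "in_rel C ?X x y"
        using fully_faithfulD[OF ff m c(4,8)] c(5,9) xX by simp
      then have "in_rel C (on_ob F ?X) (b \<cdot> u \<cdot> c) (b \<cdot> v \<cdot> c)"
        using PreOrd_mono[OF \<eta>X(1), unfolded \<eta>X(2,3)] c(7,11) by metis
      then show ?thesis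
        by (rule in_rel_descend[OF _ rel(2) c(1)]) (use b(1-3) uvD cu in auto)
    qed
    obtain g where g: "g \<in> Ar (PreOrd C)" "src g = on_ob F ?Y" "tgt g = on_ob F ?X" "base g = b"
      by (rule PreOrd_arrow_ex[OF \<eta>YD(2) \<eta>XD(2) b(1)]) (use b mono in auto)
    have "g \<cdot>\<^bsub>PreOrd C\<^esub> ?h = Id (PreOrd C) (on_ob F ?X)" "?h \<cdot>\<^bsub>PreOrd C\<^esub> g = Id (PreOrd C) (on_ob F ?Y)"
      using g h b(4,5) \<eta>XD(2) \<eta>YD(2) by (auto intro!: PreOrd_eqI)
    then have "is_iso (ParOrd C) ?h"
      unfolding is_iso_def using g h F_ob mD(1,2) by (auto simp: Hom_def intro!: bexI[of _ g])
    then show "m \<in> class_E C F" using m by (simp add: class_E_def)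
  qed
qed

end

theorem proposition1p9:
  fixes C :: "('o, 'a) cat"
    and F :: "(('o, 'a) irel, ('o, 'a) rel_mor, ('o, 'a) irel, ('o, 'a) rel_mor) fctr"
    and X Y :: "('o, 'a) irel"
    and m :: "('o, 'a) rel_mor"
  assumes "exact_category C"
    and "is_left_adjoint (PreOrd C) (ParOrd C) F incl"
    and "m \<in> Hom (PreOrd C) X Y"
  shows "(m \<in> class_E C F \<longleftrightarrow> fully_faithful C m \<and> regular_epi C (quot_map C m)) \<and>
         (m \<in> class_M C \<longleftrightarrow>
            is_pullback C (base m) (lft (sim C Y)) (lft (sim C X)) (sim_map C m) \<and>
            is_pullback C (base m) (rgt (sim C Y)) (rgt (sim C X)) (sim_map C m))"
proof -
  interpret exact_category C by (rule assms(1))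
  have m: "m \<in> Ar (PreOrd C)" "src m = X" "tgt m = Y" using assms(3) by (auto simp: Hom_def)
  \<comment> \<open>Each of the two squares is equivalent to this single lifting condition.\<close>
  have "m \<in> class_M C \<longleftrightarrow> unique_lifting C (sim C X) (sim C Y) (base m)"
    using class_M_unique_lifting unique_lifting_class_M m by blast
  then show ?thesis
    using class_E_iff[OF assms(2) m(1)] sim_map_lft_pullback_iff[OF m(1)] sim_map_rgt_pullback_iff[OF m(1)]
    unfolding m(2,3) by blast
qed

end
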